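(* The C1 root subsystem classification algorithm described in the context is correct: its output is a list of geometric C1 labels $(L,r)$ with $r\in\{2,\ldots,8\}$ such that for every label $(L,r)$ in the list $\varphi(L)$ is a basis of a root subsystem of $R_r$, and for every $r\in\{2,\ldots,8\}$ and every isomorphism class of root subsystems of $R_r$ there is exactly one label $(L,r)$ in the list such that the root subsystem with basis $\varphi(L)$ belongs to that class.
   Context: Root systems. For $2\le r\le 8$ let $\Lambda_r=\mathbb{Z}\langle H,Q_1,\ldots,Q_r\rangle$ with the symmetric bilinear form (intersection product) $H^2=1$, $Q_iQ_j=-\delta_{ij}$, $HQ_i=0$, and let $K=-3H+Q_1+\cdots+Q_r$. Put $R_r=\{\alpha\in\Lambda_r\mid \alpha\cdot K=0,\ \alpha^2=-2\}$. This is a root system (with respect to the negative of the intersection product) of type $A_1$, $A_1+A_2$, $A_4$, $D_5$, $E_6$, $E_7$, $E_8$ for $r=2,\ldots,8$ respectively. A root subsystem $S\subset R_r$ is a (possibly empty) subset that is itself a root system in its span; two root subsystems $S,S'\subset R_r$ are isomorphic if $w(S)=S'$ for some $w$ in the Weyl group of $R_r$. $D(S)$ is the Dynkin diagram of $S$; $C_{R}(S)=\{\alpha\in R\mid \alpha\cdot s=0\ \forall s\in S\}$; $K_{R}(S)=R\cap\mathbb{R}\langle S\rangle$. C1 labels. C1 label elements are the symbols $\pm ab$, $\pm 1abc$, $\pm 2ab$, $\pm 30a$ with $a,b,c\in\{1,\ldots,8\}$ (distinct within a symbol). The function $\varphi$ sends them to roots by $\varphi(ab)=Q_a-Q_b$,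 $\varphi(1abc)=H-Q_a-Q_b-Q_c$, $\varphi(2ab)=2H-\sum_{i\in\{1,\ldots,8\}\setminus\{a,b\}}Q_i$, $\varphi(30a)=3H-\sum_{i\in\{1,\ldots,8\}\setminus\{a\}}Q_i-2Q_a$, and $\varphi(-l)=-\varphi(l)$. A C1 label is a pair $(L,r)$ with $L$ a set of C1 label elements; it is geometric if no element of $L$ carries a minus sign. A label $(L,r)$ is used to represent the root subsystem of $R_r$ with basis $(\varphi(l))_{l\in L}$. The algorithm. Let $Z_0=\{12,23,34,45,56,67,78,1123,-1145,-1345,-1167,-1178,-278,-218,-308,218\}$, $Z_1=\{1123,12,23,34,45,56,67,78\}$, $Z_2=\{1123,12,23,34,45,56,67,78,1145,1347,1678,1127,1456,1567,234,278,308\}$, $Z_3=\{1123,1345,1165,1285,1673,1274,1684,1178\}$. For each $r\in\{2,\ldots,8\}$ and $i\in\{0,1,2,3\}$: (1) let $Y_i$ (for this $r$) be the set of labels $(L,r)$ with $L$ a subset of the elements $l\in Z_i$ for which $\varphi(l)\in\Lambda_r$, such that $\varphi(L)$ is linearly independent and $\varphi(l)\cdot\varphi(m)\in\{0,1\}$ for all distinct $l,m\in L$; (2) reduce $Y_i$ to contain only pairwise non-isomorphic representatives, where two labels representing subsystems $S,S'$ of $R=R_r$ are considered isomorphic if and only if $D(S)\cong D(S')$ as graphs, $|C_R(S)|=|C_R(S')|$ and $|K_R(S)|=|K_R(S')|$, except that $(\{1123\},3)$ and $(\{23\},3)$ are treated as non-isomorphic. Then, for each $r$, for each equivalence class occurring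 in $Y_0$, choose one representative label: take it from $Y_1$ if the class occurs in $Y_1$; otherwise from $Y_2$ if it occurs there; otherwise from $Y_3$ if it occurs there; otherwise from $Y_0$. The output is the list of all chosen labels for all $r$. *)

theory Defs
  imports "HOL-Analysis.Analysis"
begin

section \<open>The lattices and their root systems\<close>

text \<open>
  All lattices live in one real vector space with basis \<open>H, Q 1, \<dots>, Q 8\<close>.  It is modelled by
  \<^typ>\<open>real ^ 9\<close>, whose index type is the integers modulo 9: index \<open>0\<close> belongs to \<open>H\<close>,
  index \<open>of_nat i\<close> to \<open>Q i\<close>.  The constant \<open>Q\<close> is only meaningful at \<open>1, \<dots>, 8\<close>.
\<close>

type_synonym vec9 = "real ^ 9"

definition H :: vec9 where
  "H = axis 0 1"

definition Q :: "nat \<Rightarrow> vec9" where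
  "Q i = axis (of_nat i) 1"

definition ip :: "vec9 \<Rightarrow> vec9 \<Rightarrow> real" where
  "ip x y = x $ 0 * y $ 0 - (\<Sum>i\<in>{1..8::nat}. x $ of_nat i * y $ of_nat i)"

definition Lambda :: "nat \<Rightarrow> vec9 set" where
  "Lambda r = {of_int h *\<^sub>R H + (\<Sum>i=1..r. of_int (q i) *\<^sub>R Q i) | (h :: int) (q :: nat \<Rightarrow> int). True}"

definition canon :: "nat \<Rightarrow> vec9" where
  "canon r = - 3 *\<^sub>R H + (\<Sum>i=1..r. Q i)"

definition Rt :: "nat \<Rightarrow> vec9 set" where
  "Rt r = {\<alpha> \<in> Lambda r. ip \<alpha> (canon r) = 0 \<and> ip \<alpha> \<alpha> = - 2}"

text \<open>
  Reflections and Cartan numbers do not change when \<open>ip\<close> is replaced by its negative; the sign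
  matters only for definiteness.
\<close>

definition reflect :: "vec9 \<Rightarrow> vec9 \<Rightarrow> vec9" where
  "reflect \<alpha> v = v - (2 * ip v \<alpha> / ip \<alpha> \<alpha>) *\<^sub>R \<alpha>"

definition root_system :: "vec9 set \<Rightarrow> bool" where
  "root_system S \<longleftrightarrow>
     (\<forall>v\<in>span S. v \<noteq> 0 \<longrightarrow> - ip v v > 0) \<and>
     finite S \<and> 0 \<notin> S \<and>
     (\<forall>\<alpha>\<in>S. \<forall>\<beta>\<in>S. reflect \<alpha> \<beta> \<in> S) \<and>
     (\<forall>\<alpha>\<in>S. \<forall>\<beta>\<in>S. 2 * ip \<beta> \<alpha> / ip \<alpha> \<alpha> \<in> \<int>) \<and>
     (\<forall>\<alpha>\<in>S. \<forall>c. c *\<^sub>R \<alpha> \<in> S \<longrightarrow> c = 1 \<or> c = - 1)"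

definition root_subsystem :: "nat \<Rightarrow> vec9 set \<Rightarrow> bool" where
  "root_subsystem r S \<longleftrightarrow> S \<subseteq> Rt r \<and> root_system S"

text \<open>
  Reflections are involutions, so the monoid they generate is the Weyl group.  It acts on the
  whole space, trivially on the orthogonal complement of \<open>A\<close>.
\<close>

inductive_set weyl_group :: "(vec9 set) \<Rightarrow> (vec9 \<Rightarrow> vec9) set" for A :: "vec9 set" where
  weyl_id: "id \<in> weyl_group A"
| weyl_step: "\<lbrakk>w \<in> weyl_group A; \<alpha> \<in> A\<rbrakk> \<Longrightarrow> reflect \<alpha> \<circ> w \<in> weyl_group A"

definition subsystem_iso :: "nat \<Rightarrow> vec9 set \<Rightarrow> vec9 set \<Rightarrow> bool" where
  "subsystem_iso r S S' \<longleftrightarrow> (\<exists>w\<in>weyl_group (Rt r). w ` S = S')"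

definition root_basis :: "vec9 set \<Rightarrow> vec9 set \<Rightarrow> bool" where
  "root_basis S B \<longleftrightarrow> B \<subseteq> S \<and> independent B \<and>
     (\<forall>\<beta>\<in>S. \<exists>c :: vec9 \<Rightarrow> nat.
        \<beta> = (\<Sum>\<alpha>\<in>B. real (c \<alpha>) *\<^sub>R \<alpha>) \<or> \<beta> = - (\<Sum>\<alpha>\<in>B. real (c \<alpha>) *\<^sub>R \<alpha>))"

text \<open>
  All roots of \<open>Rt r\<close> have the same length, so Dynkin diagrams have neither multiple edges nor
  arrows and are simple graphs on a basis.
\<close>

definition dynkin_edges :: "vec9 set \<Rightarrow> vec9 set set" where
  "dynkin_edges B = {{\<alpha>, \<beta>} | \<alpha> \<beta>. \<alpha> \<in> B \<and> \<beta> \<in> B \<and> \<alpha> \<noteq> \<beta> \<and> ip \<alpha> \<beta> \<noteq> 0}"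

text \<open>The diagram of \<open>S\<close> is defined up to graph isomorphism only, through the choice of a basis.\<close>

definition dynkin_iso :: "vec9 set \<Rightarrow> vec9 set \<Rightarrow> bool" where
  "dynkin_iso S S' \<longleftrightarrow>
     (\<exists>B B' f. root_basis S B \<and> root_basis S' B' \<and> bij_betw f B B' \<and>
               (\<lambda>e. f ` e) ` dynkin_edges B = dynkin_edges B')"

definition C_of :: "vec9 set \<Rightarrow> vec9 set \<Rightarrow> vec9 set" where
  "C_of A S = {\<alpha> \<in> A. \<forall>s\<in>S. ip \<alpha> s = 0}"

definition K_of :: "vec9 set \<Rightarrow> vec9 set \<Rightarrow> vec9 set" where
  "K_of A S = A \<inter> span S"


section \<open>C1 labels\<close>

text \<open>
  \<open>L0 a b\<close>, \<open>L1 a b c\<close>, \<open>L2 a b\<close>, \<open>L3 a\<close> are the unsigned symbols written \<open>ab\<close>, \<open>1abc\<close>,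
  \<open>2ab\<close>, \<open>30a\<close>; for instance \<open>L1 1 4 5\<close> is 1145 and \<open>L2 7 8\<close> is 278.
\<close>

datatype c1_symbol = L0 nat nat | L1 nat nat nat | L2 nat nat | L3 nat

datatype c1_elem = Pos c1_symbol | Neg c1_symbol

fun wf_symbol :: "c1_symbol \<Rightarrow> bool" where
  "wf_symbol (L0 a b) \<longleftrightarrow> {a, b} \<subseteq> {1..8} \<and> distinct [a, b]"
| "wf_symbol (L1 a b c) \<longleftrightarrow> {a, b, c} \<subseteq> {1..8} \<and> distinct [a, b, c]"
| "wf_symbol (L2 a b) \<longleftrightarrow> {a, b} \<subseteq> {1..8} \<and> distinct [a, b]"
| "wf_symbol (L3 a) \<longleftrightarrow> a \<in> {1..8}"

fun phi_symbol :: "c1_symbol \<Rightarrow> vec9" where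
  "phi_symbol (L0 a b) = Q a - Q b"
| "phi_symbol (L1 a b c) = H - Q a - Q b - Q c"
| "phi_symbol (L2 a b) = 2 *\<^sub>R H - (\<Sum>i\<in>{1..8} - {a, b}. Q i)"
| "phi_symbol (L3 a) = 3 *\<^sub>R H - (\<Sum>i\<in>{1..8} - {a}. Q i) - 2 *\<^sub>R Q a"

fun phi :: "c1_elem \<Rightarrow> vec9" where
  "phi (Pos s) = phi_symbol s"
| "phi (Neg s) = - phi_symbol s"

type_synonym c1_label = "c1_elem set \<times> nat"

definition is_c1_label :: "c1_label \<Rightarrow> bool" where
  "is_c1_label x \<longleftrightarrow> (\<forall>s. Pos s \<in> fst x \<or> Neg s \<in> fst x \<longrightarrow> wf_symbol s)"

definition geometric :: "c1_label \<Rightarrow> bool" where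
  "geometric x \<longleftrightarrow> (\<forall>s. Neg s \<notin> fst x)"

text \<open>\<open>S\<close> is the root subsystem whose basis is the family \<open>phi l\<close>, indexed by \<open>l \<in> L\<close>.\<close>

definition represents :: "c1_label \<Rightarrow> vec9 set \<Rightarrow> bool" where
  "represents x S \<longleftrightarrow>
     root_subsystem (snd x) S \<and> inj_on phi (fst x) \<and> root_basis S (phi ` fst x)"


section \<open>The algorithm\<close>

definition Z0 :: "c1_elem set" where
  "Z0 = Pos ` {L0 1 2, L0 2 3, L0 3 4, L0 4 5, L0 5 6, L0 6 7, L0 7 8, L1 1 2 3, L2 1 8} \<union>
        Neg ` {L1 1 4 5, L1 3 4 5, L1 1 6 7, L1 1 7 8, L2 7 8, L2 1 8, L3 8}"

definition Z1 :: "c1_elem set" where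
  "Z1 = Pos ` {L1 1 2 3, L0 1 2, L0 2 3, L0 3 4, L0 4 5, L0 5 6, L0 6 7, L0 7 8}"

definition Z2 :: "c1_elem set" where
  "Z2 = Pos ` {L1 1 2 3, L0 1 2, L0 2 3, L0 3 4, L0 4 5, L0 5 6, L0 6 7, L0 7 8,
               L1 1 4 5, L1 3 4 7, L1 6 7 8, L1 1 2 7, L1 4 5 6, L1 5 6 7, L2 3 4, L2 7 8, L3 8}"

definition Z3 :: "c1_elem set" where
  "Z3 = Pos ` {L1 1 2 3, L1 3 4 5, L1 1 6 5, L1 2 8 5, L1 6 7 3, L1 2 7 4, L1 6 8 4, L1 1 7 8}"

definition Z :: "nat \<Rightarrow> c1_elem set" where
  "Z i = [Z0, Z1, Z2, Z3] ! i"

definition candidates :: "nat \<Rightarrow> nat \<Rightarrow> c1_label set" where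
  "candidates r i = {(L, r) | L.
     L \<subseteq> {l \<in> Z i. phi l \<in> Lambda r} \<and>
     inj_on phi L \<and> independent (phi ` L) \<and>
     (\<forall>l\<in>L. \<forall>m\<in>L. l \<noteq> m \<longrightarrow> ip (phi l) (phi m) \<in> {0, 1})}"

definition label_iso :: "c1_label \<Rightarrow> c1_label \<Rightarrow> bool" where
  "label_iso x y \<longleftrightarrow>
     snd x = snd y \<and>
     (\<exists>S S'. represents x S \<and> represents y S' \<and> dynkin_iso S S' \<and>
        card (C_of (Rt (snd x)) S) = card (C_of (Rt (snd x)) S') \<and>
        card (K_of (Rt (snd x)) S) = card (K_of (Rt (snd x)) S')) \<and>
     {x, y} \<noteq> {({Pos (L1 1 2 3)}, 3), ({Pos (L0 2 3)}, 3)}"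

text \<open>\<open>Y'\<close> is a possible outcome of reducing \<open>Y\<close> to pairwise non-isomorphic representatives.\<close>

definition is_reduction :: "c1_label set \<Rightarrow> c1_label set \<Rightarrow> bool" where
  "is_reduction Y Y' \<longleftrightarrow> Y' \<subseteq> Y \<and> (\<forall>x\<in>Y. \<exists>!y. y \<in> Y' \<and> label_iso x y)"

definition occurs_in :: "c1_label \<Rightarrow> c1_label set \<Rightarrow> bool" where
  "occurs_in x Y \<longleftrightarrow> (\<exists>y\<in>Y. label_iso x y)"

definition source :: "(nat \<Rightarrow> c1_label set) \<Rightarrow> c1_label \<Rightarrow> nat" where
  "source Y x =
     (if occurs_in x (Y 1) then 1
      else if occurs_in x (Y 2) then 2
      else if occurs_in x (Y 3) then 3
      else 0)"

text \<open>
  The algorithm makes arbitrary choices, in the reduction to \<open>Y\<close> and in the chosen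
  representatives \<open>c\<close>; this relation holds for every possible outcome.
\<close>

definition algorithm_output :: "c1_label set \<Rightarrow> bool" where
  "algorithm_output Out \<longleftrightarrow>
     (\<exists>Y c.
        (\<forall>r\<in>{2..8}. \<forall>i\<in>{0..3}. is_reduction (candidates r i) (Y r i)) \<and>
        (\<forall>r\<in>{2..8}. \<forall>x\<in>Y r 0. c x \<in> Y r (source (Y r) x) \<and> label_iso x (c x)) \<and>
        Out = (\<Union>r\<in>{2..8}. c ` Y r 0))"

end

theory Submission
  imports Defs
begin

text \<open>
  Call a set of roots of \<^term>\<open>Rt r\<close> simple if it is independent and the products of
  distinct elements are nonnegative (the form is negative definite on the roots, so this says
  that the angles are obtuse).  Root subsystems and simple sets carry the same information: a
  simple set \<open>B\<close> is a basis of exactly one root subsystem, the set of all roots in the lattice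
  of \<open>B\<close> (\<open>root_basis_root_closure\<close>, \<open>root_basis_unique\<close>); every root subsystem has a basis
  (\<open>root_basis_exists\<close>); and any two of its bases are related by its Weyl group
  (\<open>weyl_transitive_on_bases\<close>).  Hence the Dynkin diagram, \<open>C_of\<close> and \<open>K_of\<close> are invariants
  of simple sets, and on candidate labels \<open>label_iso\<close> is the equality of these three invariants
  (\<open>label_iso_iff\<close>).

  The theorem now rests on a finite table of simple sets for each \<open>r\<close>.  Every simple set is
  Weyl conjugate to an entry (\<open>classification\<close>), and different entries have different
  invariants (\<open>same_invariants_labels\<close>); so the invariants decide conjugacy.  Moreover every
  entry is a label with elements in \<open>Z 2\<close> or in \<open>Z 3\<close>, hence geometric, and is conjugate to a
  label with elements in \<open>Z 0\<close>.  Thus every class occurs in \<open>Y 0\<close> and in one of \<open>Y 1\<close>, \<open>Y 2\<close>,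
  \<open>Y 3\<close>, and whatever choices the algorithm makes, its output has one geometric label per class.

  The classification is an induction on the rank.  Remove from a simple set the root \<open>b\<close> at which
  the fewest walks of length 3 in the diagram start; by induction the rest may be assumed to be an
  entry \<open>B\<close>.  Reflections in roots orthogonal to \<open>B\<close> fix \<open>B\<close> pointwise and carry \<open>b\<close> into a
  chamber, which leaves few roots \<open>x\<close> in place of \<open>b\<close>.  For each of them the table has either
  a linear relation that excludes \<open>x\<close> or a word in reflections that takes \<open>B\<close> and \<open>x\<close> to another
  entry.  The roots are enumerated as integer vectors, and the table is checked by rewriting.
\<close>

section \<open>The intersection form\<close>

lemma of_nat_9_eq_iff:
  assumes "i \<le> 8" "j \<le> 8"
  shows "(of_nat i :: 9) = of_nat j \<longleftrightarrow> i = j"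
proof -
  have "i \<in> {0,1,2,3,4,5,6,7,8}" "j \<in> {0,1,2,3,4,5,6,7,8}" using assms by auto
  then show ?thesis by auto
qed

lemma UNIV_9: "(UNIV :: 9 set) = of_nat ` {0..8}"
proof -
  have "inj_on (of_nat :: nat \<Rightarrow> 9) {0..8}"
    by (auto simp: inj_on_def of_nat_9_eq_iff)
  then have "card (of_nat ` {0..8} :: 9 set) = CARD(9)" by (simp add: card_image)
  then show ?thesis by (metis card_subset_eq finite subset_UNIV)
qed

lemma vec9_eq_iff: "x = y \<longleftrightarrow> (\<forall>i\<le>8. x $ of_nat i = (y :: vec9) $ of_nat i)"
proof -
  have "x = y \<longleftrightarrow> (\<forall>k\<in>UNIV. x $ k = y $ k)" by (simp add: vec_eq_iff)
  then show ?thesis unfolding UNIV_9 by auto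
qed

lemma ip_commute: "ip x y = ip y x"
  by (simp add: ip_def mult.commute)

lemma ip_add_left: "ip (x + y) z = ip x z + ip y z"
  by (simp add: ip_def algebra_simps sum.distrib)

lemma ip_scaleR_left: "ip (c *\<^sub>R x) y = c * ip x y"
  by (simp add: ip_def algebra_simps sum_distrib_left)

lemma ip_add_right: "ip z (x + y) = ip z x + ip z y"
  by (metis ip_add_left ip_commute)

lemma ip_scaleR_right: "ip y (c *\<^sub>R x) = c * ip y x"
  by (metis ip_scaleR_left ip_commute)

lemma ip_zero [simp]: "ip 0 y = 0" "ip y 0 = 0"
  by (simp_all add: ip_def)

lemma ip_minus_left: "ip (- x) y = - ip x y"
  using ip_scaleR_left[of "-1"] by simp

lemma ip_minus_right: "ip y (- x) = - ip y x"
  using ip_scaleR_right[of _ "-1"] by simp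

lemma ip_diff_left: "ip (x - y) z = ip x z - ip y z"
  using ip_add_left[of x "- y"] by (simp add: ip_minus_left)

lemma ip_diff_right: "ip z (x - y) = ip z x - ip z y"
  using ip_add_right[of z x "- y"] by (simp add: ip_minus_right)

lemma ip_sum_left: "ip (sum f A) y = (\<Sum>a\<in>A. ip (f a) y)"
  by (induction A rule: infinite_finite_induct) (simp_all add: ip_add_left)

lemma ip_sum_right: "ip y (sum f A) = (\<Sum>a\<in>A. ip y (f a))"
  by (induction A rule: infinite_finite_induct) (simp_all add: ip_add_right)

lemmas ip_simps = ip_add_left ip_add_right ip_scaleR_left ip_scaleR_right ip_minus_left
  ip_minus_right ip_diff_left ip_diff_right

text \<open>
  Lists of length 9 are the coordinates in the basis \<open>H, Q 1, \<dots>, Q 8\<close> on which the finite part of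
  the proof computes.
\<close>

definition ivec :: "int list \<Rightarrow> vec9" where
  "ivec xs = of_int (xs ! 0) *\<^sub>R H + (\<Sum>i=1..8. of_int (xs ! i) *\<^sub>R Q i)"

lemma Q_nth: "1 \<le> i \<Longrightarrow> i \<le> 8 \<Longrightarrow> j \<le> 8 \<Longrightarrow> Q i $ of_nat j = (if i = j then 1 else 0)"
  by (simp add: Q_def axis_def of_nat_9_eq_iff)

lemma H_nth: "j \<le> 8 \<Longrightarrow> H $ of_nat j = (if j = 0 then 1 else 0)"
  using of_nat_9_eq_iff[of j 0] by (auto simp add: H_def axis_def)

lemma ivec_nth:
  assumes "j \<le> 8"
  shows "ivec xs $ of_nat j = of_int (xs ! j)"
proof (cases "j = 0")
  case True
  then show ?thesis using H_nth[of 0] Q_nth[of _ 0] by (simp add: ivec_def)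
next
  case False
  have "(\<Sum>i=1..8. of_int (xs ! i) * Q i $ of_nat j) = (\<Sum>i=1..8. if i = j then real_of_int (xs ! i) else 0)"
    using assms by (intro sum.cong) (auto simp: Q_nth)
  also have "\<dots> = of_int (xs ! j)" using False assms by simp
  finally show ?thesis using False assms by (simp add: ivec_def H_nth)
qed

lemma ivec_eqI:
  assumes "\<And>i. i \<le> 8 \<Longrightarrow> v $ of_nat i = of_int (xs ! i)"
  shows "v = ivec xs"
  using assms by (simp add: vec9_eq_iff ivec_nth)

lemma ivec_inject:
  assumes "length xs = 9" "length ys = 9"
  shows "ivec xs = ivec ys \<longleftrightarrow> xs = ys"
  using assms by (auto simp: vec9_eq_iff ivec_nth list_eq_iff_nth_eq less_Suc_eq_le)

fun dot :: "int list \<Rightarrow> int list \<Rightarrow> int" where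
  "dot (x # xs) (y # ys) = x * y + dot xs ys"
| "dot _ _ = 0"

fun ipl :: "int list \<Rightarrow> int list \<Rightarrow> int" where
  "ipl (x # xs) (y # ys) = x * y - dot xs ys"
| "ipl _ _ = 0"

lemma dot_eq_sum: "length xs = length ys \<Longrightarrow> dot xs ys = (\<Sum>i<length xs. xs ! i * ys ! i)"
  by (induction xs ys rule: list_induct2) (simp_all add: sum.lessThan_Suc_shift del: sum.lessThan_Suc)

lemma ip_ivec:
  assumes "length xs = 9" "length ys = 9"
  shows "ip (ivec xs) (ivec ys) = of_int (ipl xs ys)"
proof -
  obtain x xs' y ys' where eq: "xs = x # xs'" "ys = y # ys'"
    using assms by (metis length_0_conv neq_Nil_conv zero_neq_numeral)
  have len: "length xs' = 8" "length ys' = 8" using assms eq by auto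
  have set: "{1..8} = Suc ` {..<8}"
    by (simp add: image_Suc_lessThan)
  have "(\<Sum>i=1..8. ivec xs $ of_nat i * ivec ys $ of_nat i) = (\<Sum>i=1..8. of_int (xs ! i * ys ! i))"
    by (rule sum.cong) (simp_all add: ivec_nth)
  also have "\<dots> = (\<Sum>i<8. of_int (xs' ! i * ys' ! i))"
    unfolding set by (subst sum.reindex) (simp_all add: eq del: sum.lessThan_Suc)
  also have "\<dots> = of_int (dot xs' ys')" using len by (simp only: dot_eq_sum of_int_sum)
  finally show ?thesis
    unfolding ip_def using ivec_nth[of 0 xs] ivec_nth[of 0 ys] by (simp add: eq)
qed

subsection \<open>The lattices\<close>

lemma Lambda_eq:
  assumes "r \<le> 8"
  shows "Lambda r = ivec ` {xs. length xs = 9 \<and> (\<forall>i\<le>8. r < i \<longrightarrow> xs ! i = 0)}"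
proof (intro equalityI subsetI)
  fix v assume "v \<in> Lambda r"
  then obtain h q where v: "v = of_int h *\<^sub>R H + (\<Sum>i=1..r. of_int (q i) *\<^sub>R Q i)"
    by (auto simp: Lambda_def)
  let ?xs = "map (\<lambda>i. if i = 0 then h else if i \<le> r then q i else 0) [0..<9]"
  have "(\<Sum>i=1..8. real_of_int (?xs ! i) *\<^sub>R Q i) = (\<Sum>i=1..r. of_int (q i) *\<^sub>R Q i)"
    using assms by (intro sum.mono_neutral_cong_right) auto
  then have "v = ivec ?xs" by (simp add: v ivec_def del: upt_conv_Cons)
  then show "v \<in> ivec ` {xs. length xs = 9 \<and> (\<forall>i\<le>8. r < i \<longrightarrow> xs ! i = 0)}"
    by (intro image_eqI[of _ _ ?xs]) auto
next
  fix v assume "v \<in> ivec ` {xs. length xs = 9 \<and> (\<forall>i\<le>8. r < i \<longrightarrow> xs ! i = 0)}"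
  then obtain xs where xs: "v = ivec xs" "\<And>i. i \<le> 8 \<Longrightarrow> r < i \<Longrightarrow> xs ! i = 0" by auto
  have "(\<Sum>i=1..8. real_of_int (xs ! i) *\<^sub>R Q i) = (\<Sum>i=1..r. of_int (xs ! i) *\<^sub>R Q i)"
    using assms xs(2) by (intro sum.mono_neutral_right) auto
  then show "v \<in> Lambda r" unfolding Lambda_def xs(1) ivec_def by auto
qed

definition tail_zero :: "nat \<Rightarrow> int list \<Rightarrow> bool" where
  "tail_zero r xs \<longleftrightarrow> list_all (\<lambda>x. x = 0) (drop (Suc r) xs)"

lemma tail_zero_iff:
  assumes "length xs = 9"
  shows "tail_zero r xs \<longleftrightarrow> (\<forall>i\<le>8. r < i \<longrightarrow> xs ! i = 0)"
  unfolding tail_zero_def list_all_length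
proof (intro iffI allI impI)
  fix i assume *: "\<forall>n<length (drop (Suc r) xs). drop (Suc r) xs ! n = 0" "i \<le> 8" "r < i"
  then show "xs ! i = 0" using *(1)[rule_format, of "i - Suc r"] assms by simp
qed (use assms in auto)

definition canon_list :: "nat \<Rightarrow> int list" where
  "canon_list r = -3 # replicate r 1 @ replicate (8 - r) 0"

lemma length_canon_list [simp]: "r \<le> 8 \<Longrightarrow> length (canon_list r) = 9"
  by (simp add: canon_list_def)

lemma canon_list_nth: "r \<le> 8 \<Longrightarrow> i \<le> 8 \<Longrightarrow>
  canon_list r ! i = (if i = 0 then -3 else if i \<le> r then 1 else 0)"
  by (cases i) (auto simp: canon_list_def nth_append)

lemma canon_eq_ivec:
  assumes "r \<le> 8" shows "canon r = ivec (canon_list r)"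
proof -
  have "(\<Sum>i=1..8. real_of_int (canon_list r ! i) *\<^sub>R Q i) = (\<Sum>i=1..r. Q i)"
    using assms by (intro sum.mono_neutral_cong_right) (auto simp: canon_list_nth)
  then show ?thesis using assms by (simp add: canon_def ivec_def canon_list_nth)
qed

definition is_root :: "nat \<Rightarrow> int list \<Rightarrow> bool" where
  "is_root r xs \<longleftrightarrow> length xs = 9 \<and> tail_zero r xs \<and> ipl xs (canon_list r) = 0 \<and> ipl xs xs = -2"

lemma Rt_eq_ivec_image:
  assumes "r \<le> 8" shows "Rt r = ivec ` {xs. is_root r xs}"
  unfolding Rt_def Lambda_eq[OF assms] is_root_def
  using assms by (auto simp: tail_zero_iff canon_eq_ivec ip_ivec)

lemma ivec_in_Rt_iff: "r \<le> 8 \<Longrightarrow> length xs = 9 \<Longrightarrow> ivec xs \<in> Rt r \<longleftrightarrow> is_root r xs"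
  by (auto simp: Rt_eq_ivec_image ivec_inject is_root_def)

definition canon_perp :: "vec9 set" where
  "canon_perp = {v. ip v (canon 8) = 0}"

lemma subspace_canon_perp: "subspace canon_perp"
  by (auto simp: subspace_def canon_perp_def ip_simps)

lemma ip_canon: "r \<le> 8 \<Longrightarrow> ip v (canon r) = - 3 * v $ 0 - (\<Sum>i=1..r. v $ of_nat i)"
proof -
  assume r: "r \<le> 8"
  have "(\<Sum>i=1..8. v $ of_nat i * real_of_int (canon_list r ! i)) = (\<Sum>i=1..r. v $ of_nat i)"
    using r by (intro sum.mono_neutral_cong_right) (auto simp: canon_list_nth)
  then show ?thesis unfolding ip_def canon_eq_ivec[OF r]
    using ivec_nth[of 0 "canon_list r"] r by (simp add: ivec_nth canon_list_nth)
qed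

text \<open>
  The form is negative definite on the complement of \<open>canon 8\<close>: for \<open>v = h H + \<Sum> q i Q i\<close> there
  one has \<open>9 h\<^sup>2 = (\<Sum> q i)\<^sup>2 \<le> 8 \<Sum> (q i)\<^sup>2\<close> by Cauchy and Schwarz.
\<close>

lemma ip_neg_definite:
  assumes "v \<in> canon_perp" "v \<noteq> 0"
  shows "ip v v < 0"
proof -
  define h where "h = v $ 0"
  define s where "s = (\<Sum>i=1..8. (v $ of_nat i)\<^sup>2)"
  have "3 * h = - (\<Sum>i=1..8. v $ of_nat i)"
    using assms(1) ip_canon[of 8 v] by (simp add: canon_perp_def h_def)
  then have "(3 * h)\<^sup>2 = (\<Sum>i=1..8. v $ of_nat i)\<^sup>2" by (simp only: power2_minus)
  then have "9 * h\<^sup>2 = (\<Sum>i=1..8. v $ of_nat i)\<^sup>2" by (simp only: power_mult_distrib) simp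
  also have "\<dots> \<le> 8 * s"
    using Cauchy_Schwarz_ineq_sum[of "\<lambda>i. v $ of_nat i" "\<lambda>_. 1" "{1..8::nat}"] by (simp add: s_def)
  finally have le: "9 * h\<^sup>2 \<le> 8 * s" .
  have "s \<ge> 0" by (simp add: s_def sum_nonneg)
  have "s \<noteq> 0"
  proof
    assume s: "s = 0"
    then have "\<forall>i\<in>{1..8}. v $ of_nat i = 0" unfolding s_def
      by (subst (asm) sum_nonneg_eq_0_iff) auto
    moreover have "h = 0" using le s by simp
    ultimately have "v $ of_nat i = 0" if "i \<le> 8" for i
      using that by (cases "i = 0") (auto simp: h_def)
    then have "v = 0" by (simp add: vec9_eq_iff)
    then show False using assms by simp
  qed
  then have "h\<^sup>2 < s" using le \<open>s \<ge> 0\<close> by (simp add: field_simps)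
  then show ?thesis by (simp add: ip_def h_def s_def power2_eq_square)
qed

lemma Rt_mono:
  assumes "r \<le> 8" shows "Rt r \<subseteq> Rt 8"
proof
  fix v assume "v \<in> Rt r"
  then obtain xs where xs: "v = ivec xs" "is_root r xs" using Rt_eq_ivec_image assms by auto
  have z: "xs ! i = 0" if "i \<le> 8" "r < i" for i
    using xs(2) that by (auto simp: is_root_def tail_zero_iff)
  have "ip v (canon 8) = ip v (canon r)"
    unfolding ip_canon[OF assms] ip_canon[OF order_refl] xs(1) using assms z
    by (auto intro!: sum.mono_neutral_right simp: ivec_nth)
  moreover have "v \<in> Lambda 8" using xs by (auto simp: Lambda_eq is_root_def)
  ultimately show "v \<in> Rt 8" using \<open>v \<in> Rt r\<close> by (simp add: Rt_def)
qed

section \<open>Enumeration of the roots\<close>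

text \<open>
  The integer vectors of length \<open>n\<close> with sum \<open>s\<close> and sum of squares \<open>q\<close>.  The test in the
  recursive case is the inequality of Cauchy and Schwarz, which keeps the search small.
\<close>

fun vecs :: "nat \<Rightarrow> int \<Rightarrow> int \<Rightarrow> int list list" where
  "vecs 0 s q = (if s = 0 \<and> q = 0 then [[]] else [])"
| "vecs (Suc n) s q =
    (if s * s > int (Suc n) * q then []
     else concat (map (\<lambda>a. if a * a \<le> q then map ((#) a) (vecs n (s - a) (q - a * a)) else [])
                      [-4, -3, -2, -1, 0, 1, 2, 3, 4]))"

lemma dot_self_nonneg: "dot v v \<ge> 0"
  by (induction v) auto

lemma sum_list_squared_le: "(sum_list v)\<^sup>2 \<le> int (length v) * dot v v"
proof (induction v)
  case (Cons a v)
  define S Q n where "S = sum_list v" and "Q = dot v v" and "n = int (length v)"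
  have *: "S\<^sup>2 \<le> n * Q" "Q \<ge> 0" "n \<ge> 0"
    using Cons dot_self_nonneg by (auto simp: S_def Q_def n_def)
  have "0 \<le> n * a\<^sup>2 + Q - 2 * a * S"
  proof (cases "n = 0")
    case True
    then show ?thesis using * by auto
  next
    case False
    have "0 \<le> (n * a - S)\<^sup>2" by simp
    also have "\<dots> \<le> n * (n * a\<^sup>2 + Q - 2 * a * S)"
      using * by (simp add: power2_eq_square algebra_simps)
    finally show ?thesis using False *(3) by (simp add: zero_le_mult_iff)
  qed
  then have "(a + S)\<^sup>2 \<le> (n + 1) * (a\<^sup>2 + Q)"
    using * by (simp add: power2_eq_square algebra_simps)
  then show ?case by (simp add: S_def Q_def n_def power2_eq_square algebra_simps)
qed simp

lemma set_vecs:
  assumes "q < 25"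
  shows "set (vecs n s q) = {v. length v = n \<and> sum_list v = s \<and> dot v v = q}"
  using assms
proof (induction n arbitrary: s q)
  case (Suc n)
  show ?case
  proof (intro equalityI subsetI)
    fix v assume "v \<in> set (vecs (Suc n) s q)"
    then obtain a u where "v = a # u" "a * a \<le> q" "u \<in> set (vecs n (s - a) (q - a * a))"
      by (auto split: if_splits)
    moreover have "q - a * a < 25" using Suc.prems by (smt (verit) zero_le_square)
    ultimately show "v \<in> {v. length v = Suc n \<and> sum_list v = s \<and> dot v v = q}"
      using Suc.IH by auto
  next
    fix v assume *: "v \<in> {v. length v = Suc n \<and> sum_list v = s \<and> dot v v = q}"
    then obtain a u where v: "v = a # u" by (cases v) auto
    have q: "a * a \<le> q" using * dot_self_nonneg[of u] by (simp add: v)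
    have "\<not> 5 \<le> \<bar>a\<bar>"
      using q Suc.prems mult_mono[of 5 "\<bar>a\<bar>" 5 "\<bar>a\<bar>"] by (auto simp: abs_mult_self_eq)
    then have "a \<in> {-4, -3, -2, -1, 0, 1, 2, 3, 4}" by auto
    moreover have "q - a * a < 25" using Suc.prems by (smt (verit) zero_le_square)
    then have "u \<in> set (vecs n (s - a) (q - a * a))" using * Suc.IH by (auto simp: v)
    moreover have "\<not> s * s > int (Suc n) * q"
      using * sum_list_squared_le[of v] by (auto simp: power2_eq_square)
    ultimately show "v \<in> set (vecs (Suc n) s q)"
      unfolding v vecs.simps(2) set_concat set_map image_image if_not_P[OF \<open>\<not> s * s > int (Suc n) * q\<close>]
      using q by (intro UN_I[of a]) simp_all
  qed
qed auto

lemma distinct_concat_map: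
  assumes "distinct as" "\<And>a. a \<in> set as \<Longrightarrow> distinct (f a)"
    "\<And>a b. a \<in> set as \<Longrightarrow> b \<in> set as \<Longrightarrow> a \<noteq> b \<Longrightarrow> set (f a) \<inter> set (f b) = {}"
  shows "distinct (concat (map f as))"
  using assms by (induction as) fastforce+

lemma distinct_vecs: "distinct (vecs n s q)"
proof (induction n arbitrary: s q)
  case (Suc n)
  have "distinct (concat (map (\<lambda>a. if a * a \<le> q then map ((#) a) (vecs n (s - a) (q - a * a)) else [])
                      [-4, -3, -2, -1, 0, 1, 2, 3, 4 :: int]))"
    by (rule distinct_concat_map) (auto simp: distinct_map Suc.IH)
  then show ?case by simp
qed auto

text \<open>
  A root \<open>h H + \<Sum> q i Q i\<close> satisfies \<open>\<Sum> q i = -3 h\<close> and \<open>\<Sum> (q i)\<^sup>2 = h\<^sup>2 + 2\<close>; with Cauchy and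
  Schwarz this bounds \<open>h\<close> by 4 in absolute value.
\<close>

definition rts :: "nat \<Rightarrow> int list list" where
  "rts r = concat (map (\<lambda>h. map (\<lambda>v. h # v @ replicate (8 - r) 0) (vecs r (- 3 * h) (h * h + 2)))
                       [-4, -3, -2, -1, 0, 1, 2, 3, 4])"

lemma distinct_rts: "distinct (rts r)"
  unfolding rts_def
  by (rule distinct_concat_map) (auto simp: distinct_map distinct_vecs inj_on_def)

lemma dot_append: "length a = length b \<Longrightarrow> dot (a @ x) (b @ y) = dot a b + dot x y"
  by (induction a b rule: list_induct2) auto

lemma dot_replicate: "length v = n \<Longrightarrow> dot v (replicate n c) = c * sum_list v"
  by (induction v arbitrary: n) (auto simp: algebra_simps)

lemma set_rts:
  assumes "r \<le> 8"
  shows "set (rts r) = {xs. is_root r xs}"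
proof (intro equalityI subsetI)
  have *: "ipl (h # v @ replicate (8 - r) 0) (canon_list r) = - 3 * h - sum_list v"
    "ipl (h # v @ replicate (8 - r) 0) (h # v @ replicate (8 - r) 0) = h * h - dot v v"
    if "length v = r" for h v
    using that by (auto simp: canon_list_def dot_append dot_replicate)
  have bound: "h * h + 2 < 25" if "\<bar>h\<bar> \<le> 4" for h :: int
    using that mult_mono[of "\<bar>h\<bar>" 4 "\<bar>h\<bar>" 4] by auto
  { fix xs assume "xs \<in> set (rts r)"
    then obtain h v where hv: "\<bar>h\<bar> \<le> 4" "xs = h # v @ replicate (8 - r) 0"
      "v \<in> set (vecs r (- 3 * h) (h * h + 2))"
      unfolding rts_def by auto
    then show "xs \<in> {xs. is_root r xs}"
      using assms bound[OF hv(1)] *[of v h]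
      by (simp add: is_root_def tail_zero_def set_vecs list_all_iff) }
  { fix xs assume "xs \<in> {xs. is_root r xs}"
    then have xs: "length xs = 9" "tail_zero r xs" "ipl xs (canon_list r) = 0" "ipl xs xs = - 2"
      by (auto simp: is_root_def)
    define h v where "h = hd xs" and "v = take r (tl xs)"
    have lv: "length v = r" using xs(1) assms by (simp add: v_def)
    have "drop (Suc r) xs = replicate (8 - r) 0"
      using xs(1,2) by (intro replicate_eqI) (auto simp: tail_zero_def list_all_iff)
    moreover have "xs = hd xs # take r (tl xs) @ drop r (tl xs)"
      using xs(1) by (cases xs) auto
    ultimately have xs_eq: "xs = h # v @ replicate (8 - r) 0"
      by (simp add: h_def v_def drop_Suc)
    have s: "sum_list v = - 3 * h" "dot v v = h * h + 2"
      using xs(3,4) *[OF lv, of h] by (simp_all add: xs_eq)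
    have "9 * (h * h) \<le> int r * (h * h + 2)"
      using sum_list_squared_le[of v] by (simp add: s lv power2_eq_square)
    also have "\<dots> \<le> 8 * (h * h + 2)" using assms by (intro mult_right_mono) auto
    finally have "h * h \<le> 16" by simp
    then have "\<not> 5 \<le> \<bar>h\<bar>"
      using mult_mono[of 5 "\<bar>h\<bar>" 5 "\<bar>h\<bar>"] by (auto simp: abs_mult_self_eq)
    then have h: "\<bar>h\<bar> \<le> 4" by simp
    then have "h \<in> {-4, -3, -2, -1, 0, 1, 2, 3, 4}" by auto
    moreover have "v \<in> set (vecs r (- 3 * h) (h * h + 2))"
      using lv s bound[OF h] by (subst set_vecs) auto
    ultimately show "xs \<in> set (rts r)"
      unfolding rts_def xs_eq set_concat set_map image_image by (intro UN_I[of h]) simp_all }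
qed

lemma Rt_eq: "r \<le> 8 \<Longrightarrow> Rt r = ivec ` set (rts r)"
  by (simp add: Rt_eq_ivec_image set_rts)

lemma finite_Rt: "r \<le> 8 \<Longrightarrow> finite (Rt r)"
  by (simp add: Rt_eq)

section \<open>Roots and reflections\<close>

lemma Rt_norm: "\<alpha> \<in> Rt r \<Longrightarrow> ip \<alpha> \<alpha> = - 2"
  by (simp add: Rt_def)

lemma Rt_canon_perp: "r \<le> 8 \<Longrightarrow> Rt r \<subseteq> canon_perp"
  using Rt_mono by (auto simp: Rt_def canon_perp_def)

lemma ip_Rt_int: "\<lbrakk>r \<le> 8; \<alpha> \<in> Rt r; \<beta> \<in> Rt r\<rbrakk> \<Longrightarrow> ip \<alpha> \<beta> \<in> \<int>"
  by (auto simp: Rt_eq_ivec_image is_root_def ip_ivec)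

lemma reflect_eq: "ip \<alpha> \<alpha> = - 2 \<Longrightarrow> reflect \<alpha> v = v + ip v \<alpha> *\<^sub>R \<alpha>"
  by (simp add: reflect_def)

lemma linear_reflect: "linear (reflect \<alpha>)"
  by (rule linearI) (simp_all add: reflect_def ip_simps algebra_simps add_divide_distrib)

lemma ip_reflect: "ip \<alpha> \<alpha> = - 2 \<Longrightarrow> ip (reflect \<alpha> x) (reflect \<alpha> y) = ip x y"
  by (simp add: reflect_eq ip_simps ip_commute[of \<alpha> x] ip_commute[of \<alpha> y])

lemma reflect_reflect: "ip \<alpha> \<alpha> = - 2 \<Longrightarrow> reflect \<alpha> (reflect \<alpha> x) = x"
  by (simp add: reflect_eq ip_simps)

lemma reflect_self: "ip \<alpha> \<alpha> = - 2 \<Longrightarrow> reflect \<alpha> \<alpha> = - \<alpha>"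
  by (simp add: reflect_eq vec_eq_iff)

lemma Lambda_add: "x \<in> Lambda r \<Longrightarrow> y \<in> Lambda r \<Longrightarrow> x + y \<in> Lambda r"
proof -
  assume "x \<in> Lambda r" "y \<in> Lambda r"
  then obtain h q h' q' where *: "x = of_int h *\<^sub>R H + (\<Sum>i=1..r. of_int (q i) *\<^sub>R Q i)"
    "y = of_int h' *\<^sub>R H + (\<Sum>i=1..r. of_int (q' i) *\<^sub>R Q i)" by (auto simp: Lambda_def)
  have "x + y = of_int (h + h') *\<^sub>R H + (\<Sum>i=1..r. of_int (q i + q' i) *\<^sub>R Q i)"
    unfolding * by (simp add: algebra_simps sum.distrib)
  then show ?thesis unfolding Lambda_def
    by (intro CollectI exI[of _ "h + h'"] exI[of _ "\<lambda>i. q i + q' i"]) simp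
qed

lemma Lambda_scale: "x \<in> Lambda r \<Longrightarrow> of_int k *\<^sub>R x \<in> Lambda r"
proof -
  assume "x \<in> Lambda r"
  then obtain h q where *: "x = of_int h *\<^sub>R H + (\<Sum>i=1..r. of_int (q i) *\<^sub>R Q i)"
    by (auto simp: Lambda_def)
  have "of_int k *\<^sub>R x = of_int (k * h) *\<^sub>R H + (\<Sum>i=1..r. of_int (k * q i) *\<^sub>R Q i)"
    unfolding * by (simp add: algebra_simps scaleR_sum_right)
  then show ?thesis unfolding Lambda_def
    by (intro CollectI exI[of _ "k * h"] exI[of _ "\<lambda>i. k * q i"]) simp
qed

lemma Lambda_zero: "0 \<in> Lambda r"
  unfolding Lambda_def by (rule CollectI, rule exI[of _ 0], rule exI[of _ "\<lambda>_. 0"]) simp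

lemma Lambda_sum: "(\<And>b. b \<in> B \<Longrightarrow> b \<in> Lambda r) \<Longrightarrow> (\<Sum>b\<in>B. of_int (c b) *\<^sub>R b) \<in> Lambda r"
  by (induction B rule: infinite_finite_induct) (auto intro: Lambda_add Lambda_scale Lambda_zero)

lemma reflect_Rt:
  assumes "r \<le> 8" "\<alpha> \<in> Rt r" "\<beta> \<in> Rt r"
  shows "reflect \<alpha> \<beta> \<in> Rt r"
proof -
  obtain k where "ip \<beta> \<alpha> = of_int k" using ip_Rt_int[OF assms(1,3,2)] by (auto elim: Ints_cases)
  then have eq: "reflect \<alpha> \<beta> = \<beta> + of_int k *\<^sub>R \<alpha>" using assms by (simp add: reflect_eq Rt_norm)
  have "reflect \<alpha> \<beta> \<in> Lambda r" unfolding eq using assms by (auto simp: Rt_def intro: Lambda_add Lambda_scale)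
  moreover have "ip (reflect \<alpha> \<beta>) (canon r) = 0" using assms unfolding eq by (auto simp: ip_simps Rt_def)
  ultimately show ?thesis using assms ip_reflect[of \<alpha> \<beta> \<beta>] by (simp add: Rt_def)
qed

text \<open>Definiteness applied to \<open>\<alpha> + \<beta>\<close> and \<open>\<alpha> - \<beta>\<close> leaves only three products.\<close>

lemma ip_Rt_cases:
  assumes "r \<le> 8" "\<alpha> \<in> Rt r" "\<beta> \<in> Rt r" "\<alpha> \<noteq> \<beta>" "\<alpha> \<noteq> - \<beta>"
  shows "ip \<alpha> \<beta> \<in> {-1, 0, 1}"
proof -
  have "\<alpha> + \<beta> \<in> canon_perp" "\<alpha> - \<beta> \<in> canon_perp"
    using assms Rt_canon_perp subspace_canon_perp by (auto intro: subspace_add subspace_diff)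
  moreover have "\<alpha> + \<beta> \<noteq> 0" "\<alpha> - \<beta> \<noteq> 0" using assms by (auto simp: add_eq_0_iff2)
  ultimately have "ip (\<alpha> + \<beta>) (\<alpha> + \<beta>) < 0" "ip (\<alpha> - \<beta>) (\<alpha> - \<beta>) < 0"
    using ip_neg_definite by blast+
  then have "ip \<alpha> \<beta> < 2" "ip \<alpha> \<beta> > -2"
    using assms Rt_norm[of \<alpha> r] Rt_norm[of \<beta> r] by (simp_all add: ip_simps ip_commute[of \<beta> \<alpha>])
  moreover obtain k where k: "ip \<alpha> \<beta> = of_int k" using ip_Rt_int[OF assms(1-3)] by (auto elim: Ints_cases)
  ultimately have "k \<in> {-1, 0, 1}" by auto
  then show ?thesis using k by auto
qed

text \<open>
  Inside \<open>Rt r\<close>, everything that a root system demands beyond stability under reflections holds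
  automatically.
\<close>

lemma root_subsystem_iff:
  assumes "r \<le> 8"
  shows "root_subsystem r S \<longleftrightarrow> S \<subseteq> Rt r \<and> (\<forall>\<alpha>\<in>S. \<forall>\<beta>\<in>S. reflect \<alpha> \<beta> \<in> S)"
proof -
  have "root_system S" if S: "S \<subseteq> Rt r" and refl: "\<forall>\<alpha>\<in>S. \<forall>\<beta>\<in>S. reflect \<alpha> \<beta> \<in> S"
    unfolding root_system_def
  proof (intro conjI ballI allI impI)
    fix v assume "v \<in> span S" "v \<noteq> 0"
    moreover have "span S \<subseteq> canon_perp"
      using S Rt_canon_perp[OF assms] subspace_canon_perp by (intro span_minimal) auto
    ultimately show "- ip v v > 0" using ip_neg_definite by auto
  next
    show "finite S" using S finite_Rt[OF assms] finite_subset by blast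
    show "0 \<notin> S" using S by (auto simp: Rt_def)
  next
    fix \<alpha> \<beta> assume "\<alpha> \<in> S" "\<beta> \<in> S"
    then have "ip \<beta> \<alpha> \<in> \<int>" "ip \<alpha> \<alpha> = -2" using S assms ip_Rt_int Rt_norm by blast+
    then show "2 * ip \<beta> \<alpha> / ip \<alpha> \<alpha> \<in> \<int>" by simp
  next
    fix \<alpha> c assume "\<alpha> \<in> S" "c *\<^sub>R \<alpha> \<in> S"
    then have "ip \<alpha> \<alpha> = -2" "ip (c *\<^sub>R \<alpha>) (c *\<^sub>R \<alpha>) = -2" using S Rt_norm by blast+
    then have "c\<^sup>2 = 1" by (simp add: ip_simps power2_eq_square)
    then show "c = 1 \<or> c = - 1" by (simp add: power2_eq_1_iff)
  qed (use refl in auto)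
  moreover have "\<forall>\<alpha>\<in>S. \<forall>\<beta>\<in>S. reflect \<alpha> \<beta> \<in> S" if "root_system S"
    using that unfolding root_system_def by (elim conjE) assumption
  ultimately show ?thesis unfolding root_subsystem_def by blast
qed

lemma root_subsystem_uminus:
  assumes "r \<le> 8" "root_subsystem r S" "\<alpha> \<in> S"
  shows "- \<alpha> \<in> S"
proof -
  have "\<alpha> \<in> Rt r" "reflect \<alpha> \<alpha> \<in> S" using assms(2,3) unfolding root_subsystem_iff[OF assms(1)] by auto
  then show ?thesis by (simp add: reflect_self Rt_norm)
qed

section \<open>The Weyl group\<close>

abbreviation W :: "nat \<Rightarrow> (vec9 \<Rightarrow> vec9) set" where
  "W r \<equiv> weyl_group (Rt r)"

lemma weyl_comp: "u \<in> weyl_group A \<Longrightarrow> v \<in> weyl_group A \<Longrightarrow> u \<circ> v \<in> weyl_group A"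
  by (induction u rule: weyl_group.induct) (auto simp: comp_assoc intro: weyl_group.intros)

lemma weyl_reflect: "\<alpha> \<in> A \<Longrightarrow> reflect \<alpha> \<in> weyl_group A"
  using weyl_step[OF weyl_id] by fastforce

lemma weyl_mono: "A \<subseteq> A' \<Longrightarrow> weyl_group A \<subseteq> weyl_group A'"
proof
  fix w assume "A \<subseteq> A'" "w \<in> weyl_group A"
  from this(2,1) show "w \<in> weyl_group A'"
    by induction (auto intro: weyl_group.intros)
qed

lemma linear_weyl: "w \<in> weyl_group A \<Longrightarrow> linear w"
proof (induction rule: weyl_group.induct)
  case weyl_id
  then show ?case using linear_id by (simp add: id_def)
next
  case (weyl_step w \<alpha>)
  then show ?case using linear_compose linear_reflect by blast
qed

lemma weyl_ip: "w \<in> weyl_group A \<Longrightarrow> A \<subseteq> Rt r \<Longrightarrow> ip (w x) (w y) = ip x y"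
  by (induction rule: weyl_group.induct) (auto simp: ip_reflect Rt_norm)

lemma weyl_inverse:
  assumes "w \<in> weyl_group A" "A \<subseteq> Rt r"
  shows "\<exists>u\<in>weyl_group A. (\<forall>x. u (w x) = x) \<and> (\<forall>x. w (u x) = x)"
  using assms
proof (induction rule: weyl_group.induct)
  case weyl_id
  then show ?case by (intro bexI[of _ id]) (auto intro: weyl_group.intros)
next
  case (weyl_step w \<alpha>)
  then obtain u where "u \<in> weyl_group A" "\<forall>x. u (w x) = x" "\<forall>x. w (u x) = x" by auto
  moreover have "ip \<alpha> \<alpha> = - 2" using weyl_step by (auto simp: Rt_norm)
  ultimately show ?case using weyl_step.hyps
    by (intro bexI[of _ "u \<circ> reflect \<alpha>"]) (auto simp: reflect_reflect intro: weyl_comp weyl_reflect)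
qed

lemma weyl_inj: "w \<in> weyl_group A \<Longrightarrow> A \<subseteq> Rt r \<Longrightarrow> inj w"
  using weyl_inverse by (metis injI)

lemma weyl_maps_into:
  assumes "w \<in> weyl_group A" "\<And>\<alpha> x. \<alpha> \<in> A \<Longrightarrow> x \<in> X \<Longrightarrow> reflect \<alpha> x \<in> X" "x \<in> X"
  shows "w x \<in> X"
  using assms(1) by (induction rule: weyl_group.induct) (use assms in auto)

lemma weyl_image_eq:
  assumes "w \<in> weyl_group A" "A \<subseteq> Rt r" "\<And>\<alpha> x. \<alpha> \<in> A \<Longrightarrow> x \<in> X \<Longrightarrow> reflect \<alpha> x \<in> X"
  shows "w ` X = X"
proof
  show "w ` X \<subseteq> X" using weyl_maps_into[OF assms(1,3)] by blast
  obtain u where u: "u \<in> weyl_group A" "\<And>x. w (u x) = x" using weyl_inverse[OF assms(1,2)] by auto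
  then show "X \<subseteq> w ` X" using weyl_maps_into[OF u(1) assms(3)] by (metis image_eqI subsetI)
qed

lemma weyl_image_Rt: "r \<le> 8 \<Longrightarrow> w \<in> W r \<Longrightarrow> w ` Rt r = Rt r"
  by (rule weyl_image_eq) (auto intro: reflect_Rt)

lemma weyl_fixes:
  assumes "w \<in> weyl_group A" "\<And>\<alpha>. \<alpha> \<in> A \<Longrightarrow> ip x \<alpha> = 0"
  shows "w x = x"
  using assms(1) by (induction rule: weyl_group.induct) (auto simp: reflect_def assms(2))

section \<open>Simple systems\<close>

lemma independent_coeffs_eq:
  fixes f g :: "vec9 \<Rightarrow> real"
  assumes "independent B" "finite B" "(\<Sum>b\<in>B. f b *\<^sub>R b) = (\<Sum>b\<in>B. g b *\<^sub>R b)" "b \<in> B"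
  shows "f b = g b"
proof (rule ccontr)
  assume "f b \<noteq> g b"
  moreover have "(\<Sum>b\<in>B. (f b - g b) *\<^sub>R b) = 0"
    using assms(3) by (simp add: algebra_simps sum_subtractf)
  ultimately have "dependent B" unfolding dependent_finite[OF assms(2)]
    using assms(4) by (intro exI[of _ "\<lambda>b. f b - g b"]) auto
  then show False using assms(1) by simp
qed

abbreviation ncomb :: "vec9 set \<Rightarrow> (vec9 \<Rightarrow> nat) \<Rightarrow> vec9" where
  "ncomb B c \<equiv> (\<Sum>b\<in>B. real (c b) *\<^sub>R b)"

abbreviation icomb :: "vec9 set \<Rightarrow> (vec9 \<Rightarrow> int) \<Rightarrow> vec9" where
  "icomb B c \<equiv> (\<Sum>b\<in>B. of_int (c b) *\<^sub>R b)"

definition obtuse :: "vec9 set \<Rightarrow> bool" where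
  "obtuse B \<longleftrightarrow> (\<forall>x\<in>B. \<forall>y\<in>B. x \<noteq> y \<longrightarrow> ip x y \<ge> 0)"

definition simple_set :: "nat \<Rightarrow> vec9 set \<Rightarrow> bool" where
  "simple_set r B \<longleftrightarrow> B \<subseteq> Rt r \<and> independent B \<and> obtuse B"

text \<open>
  The roots in the lattice spanned by \<open>B\<close>; for roots of equal length this lattice condition
  replaces the closure under reflections.
\<close>

definition root_closure :: "vec9 set \<Rightarrow> vec9 set" where
  "root_closure B = {v. ip v v = - 2 \<and> (\<exists>c. v = icomb B c)}"

lemma root_closureE:
  assumes "v \<in> root_closure B"
  obtains c :: "vec9 \<Rightarrow> int" where "ip v v = - 2" "v = icomb B c"
proof -
  have "ip v v = - 2 \<and> (\<exists>c. v = icomb B c)"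
    using assms unfolding root_closure_def mem_Collect_eq .
  then show thesis using that by (elim conjE exE) 
qed

lemma root_basisE:
  assumes "root_basis S B" "v \<in> S"
  obtains c :: "vec9 \<Rightarrow> nat" where "v = ncomb B c"
  | c :: "vec9 \<Rightarrow> nat" where "v = - ncomb B c"
  using assms unfolding root_basis_def by blast

lemma simple_set_finite: "r \<le> 8 \<Longrightarrow> simple_set r B \<Longrightarrow> finite B"
  using finite_Rt finite_subset simple_set_def by blast

lemma ip_disjoint_supports:
  assumes "obtuse B" "\<And>b. b \<in> B \<Longrightarrow> p b \<ge> 0" "\<And>b. b \<in> B \<Longrightarrow> n b \<ge> 0"
    "\<And>b. b \<in> B \<Longrightarrow> p b = 0 \<or> n b = 0"
  shows "ip (\<Sum>b\<in>B. p b *\<^sub>R b) (\<Sum>b\<in>B. n b *\<^sub>R b) \<ge> 0"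
proof -
  have "0 \<le> p b * n b' * ip b b'" if "b \<in> B" "b' \<in> B" for b b'
    using that assms(1) assms(2)[OF that(1)] assms(3)[OF that(2)] assms(4)[OF that(1)]
    by (cases "b = b'") (auto simp: obtuse_def)
  then have "0 \<le> (\<Sum>b\<in>B. \<Sum>b'\<in>B. p b * n b' * ip b b')" by (intro sum_nonneg)
  also have "\<dots> = (\<Sum>b\<in>B. ip (p b *\<^sub>R b) (\<Sum>b\<in>B. n b *\<^sub>R b))"
    by (intro sum.cong refl) (simp add: ip_sum_right ip_scaleR_left ip_scaleR_right sum_distrib_left mult_ac)
  finally show ?thesis by (simp only: ip_sum_left)
qed

lemma canon_perp_sum: "B \<subseteq> canon_perp \<Longrightarrow> (\<Sum>b\<in>B. f b *\<^sub>R b) \<in> canon_perp"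
  by (intro subspace_sum subspace_mul subspace_canon_perp) auto

text \<open>
  A linear relation reads \<open>p = n\<close> with nonnegative coefficients on disjoint parts of \<open>B\<close>.  Then
  \<open>ip p p = ip p n \<ge> 0\<close>, so \<open>p = 0\<close> by definiteness, and applying \<open>h\<close> shows that all
  coefficients vanish.
\<close>

lemma obtuse_positive_independent:
  fixes h :: "vec9 \<Rightarrow> real"
  assumes "finite B" "B \<subseteq> canon_perp" "obtuse B" "linear h" "\<And>b. b \<in> B \<Longrightarrow> h b > 0"
  shows "independent B"
proof
  assume "dependent B"
  then obtain u v where u: "v \<in> B" "u v \<noteq> 0" "(\<Sum>b\<in>B. u b *\<^sub>R b) = 0"
    using dependent_finite[OF assms(1)] by auto
  define p n where "p = (\<Sum>b\<in>B. max (u b) 0 *\<^sub>R b)" and "n = (\<Sum>b\<in>B. max (- u b) 0 *\<^sub>R b)"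
  have "p - n = (\<Sum>b\<in>B. u b *\<^sub>R b)"
    unfolding p_def n_def sum_subtractf[symmetric] by (intro sum.cong) (auto simp: max_def)
  then have "p = n" using u by simp
  have "ip p n \<ge> 0"
    unfolding p_def n_def using assms(3) by (intro ip_disjoint_supports) auto
  then have "p = 0"
    using ip_neg_definite[of p] canon_perp_sum[OF assms(2)] \<open>p = n\<close> by (fastforce simp: p_def)
  have h: "h (\<Sum>b\<in>B. f b *\<^sub>R b) = (\<Sum>b\<in>B. f b * h b)" for f
    using assms(4) by (simp add: linear_sum linear_scale)
  have z: "(\<Sum>b\<in>B. max (u b) 0 * h b) = 0" "(\<Sum>b\<in>B. max (- u b) 0 * h b) = 0"
    using h[of "\<lambda>b. max (u b) 0"] h[of "\<lambda>b. max (- u b) 0"] \<open>p = 0\<close> \<open>p = n\<close> linear_0[OF assms(4)]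
    by (auto simp: p_def n_def)
  have "max (f v) 0 * h v = 0" if "(\<Sum>b\<in>B. max (f b) 0 * h b) = 0" for f
  proof (rule sum_nonneg_0[OF assms(1) _ that u(1)])
    show "0 \<le> max (f b) 0 * h b" if "b \<in> B" for b using assms(5)[OF that] by simp
  qed
  from this[of u] this[of "\<lambda>b. - u b"] z
  have "max (u v) 0 * h v = 0" "max (- u v) 0 * h v = 0" by simp_all
  then show False using u assms(5)[OF u(1)] by (auto simp: max_def split: if_splits)
qed

lemma dot_parity: "even (dot v v - sum_list v)"
  by (induction v) auto

text \<open>
  Modulo 2, \<open>h\<^sup>2 - \<Sum> (q i)\<^sup>2\<close> agrees with \<open>h + \<Sum> q i\<close>, and orthogonality to \<open>canon 8\<close> turns
  this into \<open>-2 h\<close>.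
\<close>

lemma Lambda_even:
  assumes "v \<in> Lambda 8" "v \<in> canon_perp" "v \<noteq> 0"
  shows "ip v v \<le> - 2"
proof -
  obtain xs where xs: "v = ivec xs" "length xs = 9" using assms(1) by (auto simp: Lambda_eq)
  obtain x q where q: "xs = x # q" "length q = 8" using xs(2) by (cases xs) auto
  have "real_of_int (ipl xs (canon_list 8)) = 0"
    using assms(2) xs by (simp add: canon_perp_def canon_eq_ivec ip_ivec)
  then have "sum_list q = - 3 * x"
    using q dot_replicate[of q 8 1] by (simp add: canon_list_def)
  moreover have "even (dot q q - sum_list q)" by (rule dot_parity)
  ultimately have "even (ipl xs xs)" using q by auto
  moreover have "ipl xs xs < 0" using ip_neg_definite[OF assms(2,3)] xs by (simp add: ip_ivec)
  ultimately have "ipl xs xs \<le> -2" by presburger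
  then show ?thesis using xs by (simp add: ip_ivec)
qed

lemma root_closure_subset_Rt:
  assumes "B \<subseteq> Rt r"
  shows "root_closure B \<subseteq> Rt r"
proof
  fix v assume "v \<in> root_closure B"
  then obtain c where v: "ip v v = -2" "v = icomb B c"
    by (auto simp: root_closure_def)
  have "v \<in> Lambda r" unfolding v(2) using assms by (intro Lambda_sum) (auto simp: Rt_def)
  moreover have "ip v (canon r) = 0"
    unfolding v(2) ip_sum_left ip_scaleR_left using assms by (auto intro!: sum.neutral simp: Rt_def)
  ultimately show "v \<in> Rt r" using v by (simp add: Rt_def)
qed

lemma subset_root_closure:
  assumes "finite B" "B \<subseteq> Rt r"
  shows "B \<subseteq> root_closure B"
proof
  fix b assume b: "b \<in> B"
  have "(\<Sum>x\<in>B. of_int (if x = b then 1 else 0) *\<^sub>R x) = (\<Sum>x\<in>B. if x = b then x else 0)"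
    by (intro sum.cong) auto
  also have "\<dots> = b" using assms b by simp
  finally show "b \<in> root_closure B"
    unfolding root_closure_def using assms b Rt_norm
    by (intro CollectI conjI exI[of _ "\<lambda>x. if x = b then 1 else 0"]) auto
qed

lemma root_subsystem_root_closure:
  assumes "r \<le> 8" "B \<subseteq> Rt r"
  shows "root_subsystem r (root_closure B)"
  unfolding root_subsystem_iff[OF assms(1)]
proof (intro conjI ballI)
  show sub: "root_closure B \<subseteq> Rt r" using assms by (intro root_closure_subset_Rt)
  fix \<alpha> \<beta> assume ab: "\<alpha> \<in> root_closure B" "\<beta> \<in> root_closure B"
  then obtain c d where c: "\<alpha> = icomb B c" "\<beta> = icomb B d"
    by (auto simp: root_closure_def)
  have R: "\<alpha> \<in> Rt r" "\<beta> \<in> Rt r" using ab sub by auto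
  obtain k where k: "ip \<beta> \<alpha> = of_int k" using ip_Rt_int[OF assms(1) R(2,1)] by (auto elim: Ints_cases)
  have "reflect \<alpha> \<beta> = \<beta> + of_int k *\<^sub>R \<alpha>" using R k by (simp add: reflect_eq Rt_norm)
  also have "\<dots> = (\<Sum>b\<in>B. of_int (d b + k * c b) *\<^sub>R b)"
    by (simp add: c scaleR_sum_right sum.distrib[symmetric] algebra_simps)
  finally have "reflect \<alpha> \<beta> = (\<Sum>b\<in>B. of_int (d b + k * c b) *\<^sub>R b)" .
  moreover have "ip (reflect \<alpha> \<beta>) (reflect \<alpha> \<beta>) = - 2"
    using reflect_Rt[OF assms(1) R] by (rule Rt_norm)
  ultimately show "reflect \<alpha> \<beta> \<in> root_closure B"
    unfolding root_closure_def by (intro CollectI conjI exI[of _ "\<lambda>b. d b + k * c b"])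
qed

text \<open>
  Split a root of the lattice of \<open>B\<close> as \<open>p - n\<close> with nonnegative coefficients on disjoint parts of
  \<open>B\<close>.  Obtuseness gives \<open>-2 \<le> ip p p + ip n n\<close>, and the lattice is even, so \<open>p\<close> or \<open>n\<close> vanishes.
\<close>

lemma root_basis_root_closure:
  assumes "r \<le> 8" "simple_set r B"
  shows "root_basis (root_closure B) B"
proof -
  have fin: "finite B" by (rule simple_set_finite[OF assms])
  have B: "B \<subseteq> Rt r" "independent B" "obtuse B" using assms(2) by (auto simp: simple_set_def)
  have B8: "B \<subseteq> Rt 8" using B(1) Rt_mono[OF assms(1)] by auto
  have "\<exists>c. v = ncomb B c \<or> v = - ncomb B c"
    if mem: "v \<in> root_closure B" for v
  proof -
    obtain c where v: "ip v v = -2" "v = icomb B c"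
      using mem by (rule root_closureE)
    define P N where "P = (\<lambda>b. nat (c b))" and "N = (\<lambda>b. nat (- c b))"
    define p n where "p = ncomb B P" and "n = ncomb B N"
    have pn: "v = p - n"
      unfolding p_def n_def sum_subtractf[symmetric] v(2)
      by (intro sum.cong) (auto simp: P_def N_def scaleR_left.diff[symmetric] simp del: scaleR_left.diff)
    have mem: "(ncomb B f) \<in> Lambda 8" "(ncomb B f) \<in> canon_perp"
      for f :: "vec9 \<Rightarrow> nat"
    proof -
      show "(ncomb B f) \<in> Lambda 8"
        using Lambda_sum[of B 8 "\<lambda>b. int (f b)"] B8 by (auto simp: Rt_def)
      show "(ncomb B f) \<in> canon_perp"
        using B8 Rt_canon_perp[of 8] by (intro canon_perp_sum) auto
    qed
    have "ip p n \<ge> 0"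
      unfolding p_def n_def using B(3) by (intro ip_disjoint_supports) (auto simp: P_def N_def)
    moreover have "ip v v = ip p p + ip n n - 2 * ip p n"
      unfolding pn by (simp add: ip_simps ip_commute[of n p])
    moreover have "p \<noteq> 0 \<Longrightarrow> ip p p \<le> -2" "n \<noteq> 0 \<Longrightarrow> ip n n \<le> -2"
      using Lambda_even mem by (auto simp: p_def n_def)
    ultimately have "p = 0 \<or> n = 0" using v(1) by linarith
    then show ?thesis using pn by (auto simp: p_def n_def)
  qed
  then show ?thesis unfolding root_basis_def using B subset_root_closure[OF fin B(1)] by auto
qed

text \<open>
  Descent on the size of the coefficients: \<open>-2 = \<Sum> c b * ip v b\<close> has a negative summand, so for
  \<open>a = b\<close> or \<open>a = - b\<close> the vector \<open>v - a\<close> is zero or again a root, with smaller coefficients,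
  and \<open>v = reflect a (v - a)\<close>.
\<close>

lemma root_closure_subset:
  assumes "r \<le> 8" "root_subsystem r S" "B \<subseteq> S"
  shows "root_closure B \<subseteq> S"
proof
  have S: "S \<subseteq> Rt r" "\<And>\<alpha> \<beta>. \<alpha> \<in> S \<Longrightarrow> \<beta> \<in> S \<Longrightarrow> reflect \<alpha> \<beta> \<in> S"
    using assms(2) root_subsystem_iff[OF assms(1)] by auto
  then have fin: "finite B" using assms finite_Rt finite_subset by (metis)
  have *: "v \<in> S" if "ip v v = -2" "v = icomb B c" for v and c :: "vec9 \<Rightarrow> int"
    using that
  proof (induction "nat (\<Sum>b\<in>B. \<bar>c b\<bar>)" arbitrary: v c rule: less_induct)
    case less
    have vR: "v \<in> Rt r" using less.prems root_closure_subset_Rt[of B r] assms(3) S(1)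
      unfolding root_closure_def by blast
    have "ip v v = (\<Sum>b\<in>B. of_int (c b) * ip v b)"
      by (subst (2) less.prems(2)) (simp add: ip_sum_right ip_scaleR_right)
    then have "(\<Sum>b\<in>B. of_int (c b) * ip v b) < 0" using less.prems(1) by simp
    then obtain b where b: "b \<in> B" "of_int (c b) * ip v b < 0"
      by (meson not_less sum_nonneg)
    define a where "a = of_int (sgn (c b)) *\<^sub>R b"
    have sg: "sgn (c b) = 1 \<or> sgn (c b) = -1" using b(2) by (auto simp: sgn_if)
    then have aS: "a \<in> S" using b assms(3) root_subsystem_uminus[OF assms(1,2)] by (auto simp: a_def)
    then have aR: "a \<in> Rt r" using S by auto
    have "ip v a < 0" using b(2) sg by (auto simp: a_def ip_simps mult_less_0_iff sgn_if split: if_splits)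
    show ?case
    proof (cases "v = a")
      case False
      moreover have "v \<noteq> - a" using \<open>ip v a < 0\<close> Rt_norm[OF aR] by (auto simp: ip_simps)
      ultimately have va: "ip v a = -1"
        using ip_Rt_cases[OF assms(1) vR aR] \<open>ip v a < 0\<close> by auto
      define c' where "c' = c(b := c b - sgn (c b))"
      have "(icomb B c') = (\<Sum>x\<in>B. of_int (c x) *\<^sub>R x - (if x = b then a else 0))"
        by (intro sum.cong) (auto simp: c'_def a_def algebra_simps)
      also have "\<dots> = v - a" using fin b(1) by (simp add: sum_subtractf less.prems(2)[symmetric])
      finally have eq: "v - a = icomb B c'" by simp
      have "(\<Sum>x\<in>B. \<bar>c' x\<bar>) < (\<Sum>x\<in>B. \<bar>c x\<bar>)"
        using fin b sg by (intro sum_strict_mono_ex1) (auto simp: c'_def sgn_if split: if_splits)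
      moreover have "0 \<le> (\<Sum>x\<in>B. \<bar>c' x\<bar>)" by (simp add: sum_nonneg)
      ultimately have "nat (\<Sum>x\<in>B. \<bar>c' x\<bar>) < nat (\<Sum>x\<in>B. \<bar>c x\<bar>)" by linarith
      moreover have "ip (v - a) (v - a) = -2"
        using va less.prems(1) Rt_norm[OF aR] by (simp add: ip_simps ip_commute[of a v])
      ultimately have "v - a \<in> S" using less.hyps[of c' "v - a"] eq by blast
      moreover have "reflect a (v - a) = v" using va Rt_norm[OF aR] by (simp add: reflect_eq ip_simps)
      ultimately show ?thesis using S(2)[OF aS] by metis
    qed (use aS in simp)
  qed
  fix v assume "v \<in> root_closure B"
  then show "v \<in> S" using * by (auto simp: root_closure_def)
qed

text \<open>A root subsystem is thus determined by a basis.\<close>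

lemma root_basis_unique:
  assumes "r \<le> 8" "root_subsystem r S" "root_basis S B"
  shows "S = root_closure B"
proof
  show "root_closure B \<subseteq> S" using assms root_closure_subset by (auto simp: root_basis_def)
  show "S \<subseteq> root_closure B"
  proof
    fix v assume v: "v \<in> S"
    then have "ip v v = -2" using assms(1,2) Rt_norm by (auto simp: root_subsystem_iff)
    moreover obtain c where
      "v = ncomb B c \<or> v = - ncomb B c"
      using assms(3) v unfolding root_basis_def by blast
    then have "v = (\<Sum>b\<in>B. of_int (int (c b)) *\<^sub>R b) \<or> v = (\<Sum>b\<in>B. of_int (- int (c b)) *\<^sub>R b)"
      by (auto simp: sum_negf)
    then have "\<exists>d. v = icomb B d"
      by (elim disjE) (rule exI, assumption)+
    ultimately show "v \<in> root_closure B" unfolding root_closure_def by blast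
  qed
qed

text \<open>
  If \<open>ip x y\<close> were negative, the root \<open>reflect y x = x - y\<close> would have coefficients of both signs.
\<close>

lemma root_basis_simple_set:
  assumes "r \<le> 8" "root_subsystem r S" "root_basis S B"
  shows "simple_set r B"
proof -
  have S: "S \<subseteq> Rt r" "\<And>\<alpha> \<beta>. \<alpha> \<in> S \<Longrightarrow> \<beta> \<in> S \<Longrightarrow> reflect \<alpha> \<beta> \<in> S"
    using assms(2) root_subsystem_iff[OF assms(1)] by auto
  have B: "B \<subseteq> S" "independent B" using assms(3) by (auto simp: root_basis_def)
  have fin: "finite B" using S B finite_Rt[OF assms(1)] finite_subset by (metis)
  have "ip x y \<ge> 0" if xy: "x \<in> B" "y \<in> B" "x \<noteq> y" for x y
  proof (rule ccontr)
    assume neg: "\<not> ip x y \<ge> 0"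
    have R: "x \<in> Rt r" "y \<in> Rt r" using xy B S by auto
    have "x \<noteq> - y" using neg R Rt_norm[of y] by (auto simp: ip_simps)
    then have xy1: "ip x y = -1" using ip_Rt_cases[OF assms(1) R] xy(3) neg by auto
    have "reflect y x \<in> S" using S(2) xy B by auto
    moreover have "reflect y x = x - y" using xy1 R by (simp add: reflect_eq Rt_norm)
    ultimately have xyS: "x - y \<in> S" by simp
    define d where "d = (\<lambda>b. (if b = x then 1 else 0) - (if b = y then 1 else (0::real)))"
    have "(\<Sum>b\<in>B. d b *\<^sub>R b) = (\<Sum>b\<in>B. (if b = x then b else 0) - (if b = y then b else 0))"
      by (intro sum.cong) (auto simp: d_def)
    also have "\<dots> = x - y" using fin xy by (simp add: sum_subtractf)
    finally have d: "x - y = (\<Sum>b\<in>B. d b *\<^sub>R b)" by simp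
    from assms(3) xyS show False
    proof (cases rule: root_basisE)
      case (1 c)
      then have "d y = real (c y)" using d xy by (intro independent_coeffs_eq[OF B(2) fin]) auto
      then show False using xy by (auto simp: d_def)
    next
      case (2 c)
      then have "x - y = (\<Sum>b\<in>B. (- real (c b)) *\<^sub>R b)" by (simp add: sum_negf)
      then have "d x = - real (c x)" using d xy by (intro independent_coeffs_eq[OF B(2) fin]) auto
      then show False using xy by (auto simp: d_def)
    qed
  qed
  then show ?thesis using S B by (auto simp: simple_set_def obtuse_def)
qed

section \<open>Bases of root subsystems\<close>

fun hgt :: "int list \<Rightarrow> int" where
  "hgt (x # xs) = 2 ^ length xs * x + hgt xs"
| "hgt [] = 0"

text \<open>
  The weights are such that on roots the height has the sign of the first nonzero coordinate; in
  particular no root has height 0.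
\<close>

definition height :: "vec9 \<Rightarrow> real" where
  "height v = (\<Sum>i<9. 2 ^ (8 - i) * v $ of_nat i)"

lemma linear_height: "linear height"
  by (rule linearI) (simp_all only: height_def vector_add_component vector_scaleR_component
      distrib_left sum.distrib sum_distrib_left real_scaleR_def mult.left_commute)

lemma hgt_eq_sum: "hgt xs = (\<Sum>i<length xs. 2 ^ (length xs - Suc i) * xs ! i)"
  by (induction xs) (simp_all add: sum.lessThan_Suc_shift del: sum.lessThan_Suc)

lemma height_ivec:
  assumes "length xs = 9" shows "height (ivec xs) = of_int (hgt xs)"
proof -
  have "height (ivec xs) = (\<Sum>i<9. of_int (2 ^ (8 - i) * xs ! i))"
    unfolding height_def by (intro sum.cong) (simp_all add: ivec_nth)
  also have "\<dots> = of_int (\<Sum>i<9. 2 ^ (8 - i) * xs ! i)" by (simp only: of_int_sum)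
  also have "(\<Sum>i<9. 2 ^ (8 - i) * xs ! i) = (\<Sum>i<9. 2 ^ (9 - Suc i) * xs ! i)"
    by (intro sum.cong) simp_all
  also have "\<dots> = hgt xs" using assms by (simp only: hgt_eq_sum)
  finally show ?thesis .
qed

lemma hgt_rts: "list_all (\<lambda>x. hgt x \<noteq> 0) (rts 8)"
  by code_simp

lemma height_nonzero:
  assumes "r \<le> 8" "v \<in> Rt r" shows "height v \<noteq> 0"
proof -
  have "v \<in> ivec ` set (rts 8)" using assms Rt_mono Rt_eq[of 8] by auto
  then obtain xs where "xs \<in> set (rts 8)" "v = ivec xs" by auto
  moreover have "length xs = 9" using calculation set_rts[of 8] by (auto simp: is_root_def)
  ultimately show ?thesis using hgt_rts by (simp add: height_ivec list_all_iff)
qed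

lemma sum_indicator:
  fixes b :: vec9
  assumes "finite B" "b \<in> B"
  shows "(\<Sum>x\<in>B. real (if x = b then 1 else 0) *\<^sub>R x) = b"
proof -
  have "(\<Sum>x\<in>B. real (if x = b then 1 else 0) *\<^sub>R x) = (\<Sum>x\<in>B. if x = b then x else 0)"
    by (intro sum.cong) auto
  then show ?thesis using assms by simp
qed

text \<open>
  The roots of positive height that are not a sum of two such roots form a basis.
\<close>

lemma root_basis_exists:
  assumes "r \<le> 8" "root_subsystem r S"
  shows "\<exists>B. root_basis S B"
proof -
  have S: "S \<subseteq> Rt r" "\<And>\<alpha> \<beta>. \<alpha> \<in> S \<Longrightarrow> \<beta> \<in> S \<Longrightarrow> reflect \<alpha> \<beta> \<in> S"
    using assms(2) root_subsystem_iff[OF assms(1)] by auto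
  have hadd: "height (x + y) = height x + height y" for x y using linear_height by (rule linear_add)
  have hminus: "height (- x) = - height x" for x using linear_height by (rule linear_neg)
  define P where "P = {v \<in> S. height v > 0}"
  define B where "B = {b \<in> P. \<forall>x\<in>P. \<forall>y\<in>P. b \<noteq> x + y}"
  have finP: "finite P" using S finite_Rt[OF assms(1)] finite_subset by (fastforce simp: P_def)
  have BP: "B \<subseteq> P" by (auto simp: B_def)
  then have finB: "finite B" using finP finite_subset by auto
  have comb: "\<exists>c. v = ncomb B c" if "v \<in> P" for v
    using that
  proof (induction "card {u \<in> P. height u < height v}" arbitrary: v rule: less_induct)
    case less
    show ?case
    proof (cases "v \<in> B")
      case True
      then show ?thesis using sum_indicator[OF finB True] by (intro exI[of _ "\<lambda>x. if x = v then 1 else 0"]) simp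
    next
      case False
      then obtain x y where xy: "x \<in> P" "y \<in> P" "v = x + y" using less.prems by (auto simp: B_def)
      have pos: "height x > 0" "height y > 0" using xy by (auto simp: P_def)
      have "card {u \<in> P. height u < height z} < card {u \<in> P. height u < height v}"
        if "z \<in> P" "height z < height v" for z
        using that finP by (intro psubset_card_mono) auto
      then have "\<exists>c. z = ncomb B c" if "z \<in> {x, y}" for z
        using less.hyps xy pos that by (auto simp: hadd)
      then obtain c d where
        "x = ncomb B c" "y = ncomb B d" by (meson insertI1 insertI2)
      then have "v = (\<Sum>b\<in>B. real (c b + d b) *\<^sub>R b)"
        unfolding xy(3) by (simp add: sum.distrib scaleR_left_distrib)
      then show ?thesis by (rule exI[of _ "\<lambda>b. c b + d b"])
    qed
  qed
  have "obtuse B" unfolding obtuse_def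
  proof (intro ballI impI, rule ccontr)
    fix x y assume xy: "x \<in> B" "y \<in> B" "x \<noteq> y" "\<not> 0 \<le> ip x y"
    have P: "x \<in> P" "y \<in> P" using xy BP by auto
    then have R: "x \<in> Rt r" "y \<in> Rt r" using S by (auto simp: P_def)
    have "x \<noteq> - y" using P hminus[of y] by (auto simp: P_def)
    then have "ip x y = -1" using ip_Rt_cases[OF assms(1) R] xy by auto
    then have "reflect y x = x - y" using R by (simp add: reflect_eq Rt_norm)
    then have d: "x - y \<in> S" using S(2)[of y x] P by (auto simp: P_def)
    then have "height (x - y) \<noteq> 0" using S assms(1) height_nonzero by blast
    then consider "height (x - y) > 0" | "height (- (x - y)) > 0" unfolding hminus by linarith
    then show False
    proof cases
      case 1
      then have "x - y \<in> P" using d by (simp add: P_def)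
      then have "x \<noteq> (x - y) + y" using xy(1) P unfolding B_def by blast
      then show False by simp
    next
      case 2
      then have "y - x \<in> P" using root_subsystem_uminus[OF assms d] by (simp add: P_def)
      then have "y \<noteq> (y - x) + x" using xy(2) P unfolding B_def by blast
      then show False by simp
    qed
  qed
  moreover have "B \<subseteq> canon_perp" using BP S Rt_canon_perp[OF assms(1)] by (auto simp: P_def)
  ultimately have "independent B"
    using BP linear_height by (intro obtuse_positive_independent[OF finB, of height]) (auto simp: P_def)
  moreover have "\<exists>c. v = ncomb B c \<or> v = - ncomb B c"
    if v: "v \<in> S" for v
  proof -
    have "height v \<noteq> 0" using v S assms(1) height_nonzero by blast
    then consider "v \<in> P" | "- v \<in> P"
      using v root_subsystem_uminus[OF assms v] hminus[of v] by (fastforce simp: P_def)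
    then show ?thesis
    proof cases
      case 1
      then show ?thesis using comb by blast
    next
      case 2
      then obtain c where "- v = ncomb B c" using comb by blast
      then have "v = - ncomb B c" by (metis add.inverse_inverse)
      then show ?thesis by blast
    qed
  qed
  ultimately have "root_basis S B" using BP unfolding root_basis_def P_def by blast
  then show ?thesis by blast
qed

subsection \<open>The Weyl group permutes the bases transitively\<close>

definition positive_roots :: "vec9 set \<Rightarrow> vec9 set \<Rightarrow> vec9 set" where
  "positive_roots S B = {v \<in> S. \<exists>c. v = ncomb B c}"

lemma positive_rootsI: "v \<in> S \<Longrightarrow> v = ncomb B c \<Longrightarrow> v \<in> positive_roots S B"
  unfolding positive_roots_def by blast

lemma positive_rootsE:
  assumes "v \<in> positive_roots S B"
  obtains c :: "vec9 \<Rightarrow> nat" where "v \<in> S" "v = ncomb B c"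
  using assms unfolding positive_roots_def by blast

lemma positive_roots_coeffs:
  "v \<in> positive_roots S B \<Longrightarrow> \<exists>c. v = ncomb B c"
  unfolding positive_roots_def mem_Collect_eq by (rule conjunct2)

lemma basis_positive_roots: "finite B \<Longrightarrow> B \<subseteq> S \<Longrightarrow> B \<subseteq> positive_roots S B"
  by (intro subsetI positive_rootsI[OF _ sum_indicator[symmetric]]) auto

context
  fixes r S
  assumes r: "r \<le> 8" and S: "root_subsystem r S"
begin

abbreviation pos :: "vec9 set \<Rightarrow> vec9 set" where
  "pos \<equiv> positive_roots S"

lemma subsystem_reflect: "\<alpha> \<in> S \<Longrightarrow> \<beta> \<in> S \<Longrightarrow> reflect \<alpha> \<beta> \<in> S"
  using S root_subsystem_iff[OF r] by auto

lemma subsystem_subset: "S \<subseteq> Rt r"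
  using S root_subsystem_iff[OF r] by auto

lemma subsystem_norm: "\<alpha> \<in> S \<Longrightarrow> ip \<alpha> \<alpha> = - 2"
  using subsystem_subset Rt_norm by blast

lemma root_basis_facts:
  assumes "root_basis S B"
  shows "B \<subseteq> S" "independent B" "finite B"
  using assms finite_subset[of B "Rt r"] finite_Rt[OF r] subsystem_subset
  unfolding root_basis_def by auto

lemma positive_or_negative:
  assumes "root_basis S B" "v \<in> S"
  shows "v \<in> pos B \<or> - v \<in> pos B"
  using assms(1,2)
proof (cases rule: root_basisE)
  case (1 c)
  then show ?thesis using assms(2) positive_rootsI by blast
next
  case (2 c)
  then have "- v = ncomb B c" by simp
  then show ?thesis using root_subsystem_uminus[OF r S assms(2)] positive_rootsI by blast
qed

lemma not_positive_and_negative: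
  assumes "root_basis S B" "v \<in> pos B"
  shows "- v \<notin> pos B"
proof
  assume "- v \<in> pos B"
  then obtain d where d: "- v = ncomb B d" by (rule positive_rootsE)
  obtain c where c: "v \<in> S" "v = ncomb B c"
    using assms(2) by (rule positive_rootsE)
  have "(\<Sum>b\<in>B. real (c b + d b) *\<^sub>R b) = ncomb B c + (ncomb B d)"
    by (simp add: scaleR_left_distrib sum.distrib)
  also have "\<dots> = v + - v" using c d by simp
  also have "\<dots> = (\<Sum>b\<in>B. 0 *\<^sub>R b)" by simp
  finally have "real (c b + d b) = 0" if "b \<in> B" for b
    using independent_coeffs_eq[of B "\<lambda>b. real (c b + d b)" "\<lambda>_. 0"] root_basis_facts[OF assms(1)] that by auto
  then have "c b = 0" if "b \<in> B" for b using that by (metis add_is_0 of_nat_eq_0_iff)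
  then have "v = 0" using c by simp
  then show False using subsystem_norm[OF c(1)] by simp
qed

lemma root_multiple_eq:
  assumes "a \<in> S" "b \<in> S" "a = real k *\<^sub>R b"
  shows "a = b"
proof -
  have "(real k)\<^sup>2 = 1" using subsystem_norm[OF assms(1)] subsystem_norm[OF assms(2)]
    by (simp add: assms(3) ip_simps power2_eq_square)
  then have "real k = 1" by (simp add: power2_eq_1_iff)
  then show ?thesis using assms(3) by simp
qed

text \<open>
  The reflection changes only the coefficient of \<open>b\<close>, and \<open>v\<close> has a positive coefficient
  elsewhere.
\<close>

lemma reflect_positive:
  assumes B: "root_basis S B" and b: "b \<in> B" and v: "v \<in> pos B" "v \<noteq> b"
  shows "reflect b v \<in> pos B"
proof (rule ccontr)
  assume neg: "reflect b v \<notin> pos B"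
  note facts = root_basis_facts[OF B]
  obtain c where c: "v \<in> S" "v = ncomb B c"
    using v(1) by (rule positive_rootsE)
  have bS: "b \<in> S" using b facts by auto
  have "reflect b v \<in> S" using subsystem_reflect bS c by auto
  then have "- reflect b v \<in> pos B" using positive_or_negative[OF B] neg by blast
  then obtain d where d: "- reflect b v = ncomb B d"
    by (rule positive_rootsE)
  have "(\<Sum>x\<in>B. (real (c x) + real (d x)) *\<^sub>R x) = v - reflect b v"
    using c d by (simp add: scaleR_left_distrib sum.distrib)
  also have "\<dots> = - ip v b *\<^sub>R b" using subsystem_norm[OF bS] by (simp add: reflect_eq)
  also have "\<dots> = (\<Sum>x\<in>B. if x = b then - ip v b *\<^sub>R x else 0)" using b facts(3) by simp
  also have "\<dots> = (\<Sum>x\<in>B. (if x = b then - ip v b else 0) *\<^sub>R x)" by (intro sum.cong) auto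
  finally have eq: "(\<Sum>x\<in>B. (real (c x) + real (d x)) *\<^sub>R x) = (\<Sum>x\<in>B. (if x = b then - ip v b else 0) *\<^sub>R x)" .
  have "c x = 0" if "x \<in> B" "x \<noteq> b" for x
    using independent_coeffs_eq[OF facts(2,3) eq that(1)] that(2) by simp
  then have "v = (\<Sum>x\<in>B. if x = b then real (c b) *\<^sub>R b else 0)"
    unfolding c(2) by (intro sum.cong) auto
  then have "v = real (c b) *\<^sub>R b" using b facts(3) by simp
  then show False using root_multiple_eq[OF c(1) bS] v(2) by blast
qed

lemma positive_roots_mono:
  assumes "B \<subseteq> pos B'" "finite B"
  shows "pos B \<subseteq> pos B'"
proof
  fix v assume "v \<in> pos B"
  then obtain c where c: "v \<in> S" "v = ncomb B c" by (rule positive_rootsE)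
  have "\<forall>b\<in>B. \<exists>d. b = ncomb B' d"
    using assms(1) by (intro ballI positive_roots_coeffs) auto
  from bchoice[OF this] obtain d :: "vec9 \<Rightarrow> vec9 \<Rightarrow> nat" where
    d: "\<And>b. b \<in> B \<Longrightarrow> b = ncomb B' (d b)" by auto
  have "v = (\<Sum>b\<in>B. real (c b) *\<^sub>R (ncomb B' (d b)))"
    unfolding c(2) by (intro sum.cong refl arg_cong2[where f = "(*\<^sub>R)"] d)
  also have "\<dots> = (\<Sum>b\<in>B. \<Sum>x\<in>B'. real (c b * d b x) *\<^sub>R x)" by (simp add: scaleR_sum_right)
  also have "\<dots> = (\<Sum>x\<in>B'. \<Sum>b\<in>B. real (c b * d b x) *\<^sub>R x)" by (rule sum.swap)
  also have "\<dots> = (\<Sum>x\<in>B'. real (\<Sum>b\<in>B. c b * d b x) *\<^sub>R x)" by (simp add: scaleR_sum_left)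
  finally show "v \<in> pos B'" using c(1) by (intro positive_rootsI)
qed

text \<open>A basis consists of the indecomposable positive roots, so the positive roots determine it.\<close>

lemma basis_subset_if_positive_roots_eq:
  assumes B: "root_basis S B" and B': "root_basis S B'"
    and eq: "pos B = pos B'"
  shows "B \<subseteq> B'"
proof
  fix b assume b: "b \<in> B"
  note facts = root_basis_facts[OF B] and facts' = root_basis_facts[OF B']
  have bS: "b \<in> S" using b facts by auto
  have "b \<in> pos B'" using basis_positive_roots facts b eq by blast
  then obtain c where c: "b = ncomb B' c" by (rule positive_rootsE)
  have "B' \<subseteq> pos B" using basis_positive_roots facts' eq by blast
  then have "\<forall>x\<in>B'. \<exists>d. x = ncomb B d"
    by (intro ballI positive_roots_coeffs) auto
  from bchoice[OF this] obtain d :: "vec9 \<Rightarrow> vec9 \<Rightarrow> nat" where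
    d: "\<And>x. x \<in> B' \<Longrightarrow> x = ncomb B (d x)" by auto
  have "(\<Sum>y\<in>B. real (if y = b then 1 else 0) *\<^sub>R y) = b" using sum_indicator facts(3) b by blast
  also have "b = (\<Sum>x\<in>B'. real (c x) *\<^sub>R (ncomb B (d x)))"
    by (subst c) (intro sum.cong refl arg_cong2[where f = "(*\<^sub>R)"] d)
  also have "\<dots> = (\<Sum>x\<in>B'. \<Sum>y\<in>B. real (c x * d x y) *\<^sub>R y)" by (simp add: scaleR_sum_right)
  also have "\<dots> = (\<Sum>y\<in>B. \<Sum>x\<in>B'. real (c x * d x y) *\<^sub>R y)" by (rule sum.swap)
  also have "\<dots> = (\<Sum>y\<in>B. real (\<Sum>x\<in>B'. c x * d x y) *\<^sub>R y)" by (simp add: scaleR_sum_left)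
  finally have eq2: "(\<Sum>y\<in>B. real (if y = b then 1 else 0) *\<^sub>R y) = (\<Sum>y\<in>B. real (\<Sum>x\<in>B'. c x * d x y) *\<^sub>R y)" .
  have zero: "(\<Sum>x\<in>B'. c x * d x y) = 0" if "y \<in> B" "y \<noteq> b" for y
    using independent_coeffs_eq[OF facts(2,3) eq2 that(1)] that(2) by (simp only: of_nat_eq_iff if_False)
  have "\<exists>x\<in>B'. c x \<noteq> 0"
  proof (rule ccontr)
    assume "\<not> (\<exists>x\<in>B'. c x \<noteq> 0)"
    then have "b = 0" by (subst c) simp
    then show False using subsystem_norm[OF bS] by simp
  qed
  then obtain x where x: "x \<in> B'" "c x \<noteq> 0" by blast
  have "d x y = 0" if "y \<in> B" "y \<noteq> b" for y
    using zero[OF that] x facts'(3) by auto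
  then have "(ncomb B (d x)) = (\<Sum>y\<in>B. if y = b then real (d x b) *\<^sub>R b else 0)"
    by (intro sum.cong) auto
  then have "x = real (d x b) *\<^sub>R b" using d[OF x(1)] b facts(3) by simp
  then have "x = b" using root_multiple_eq x(1) facts'(1) bS by blast
  then show "b \<in> B'" using x by simp
qed

lemma positive_roots_image:
  assumes "linear w" "inj w" "w ` S = S"
  shows "pos (w ` B) = w ` pos B"
proof -
  have sum: "(ncomb (w ` B) c) = w (\<Sum>b\<in>B. real (c (w b)) *\<^sub>R b)" for c :: "vec9 \<Rightarrow> nat"
    using assms by (subst sum.reindex) (auto simp: linear_sum linear_scale inj_on_def inj_def)
  show ?thesis
  proof (intro equalityI subsetI)
    fix v assume "v \<in> pos (w ` B)"
    then obtain c where c: "v \<in> S" "v = ncomb (w ` B) c" by (rule positive_rootsE)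
    obtain u where u: "u \<in> S" "v = w u" using c(1) assms(3) by auto
    have "w u = w (\<Sum>b\<in>B. real (c (w b)) *\<^sub>R b)" using c(2) u(2) sum[of c] by simp
    then have "u = (\<Sum>b\<in>B. real (c (w b)) *\<^sub>R b)" by (rule injD[OF assms(2)])
    with u(1) have "u \<in> pos B" by (rule positive_rootsI)
    then show "v \<in> w ` pos B" using u(2) by simp
  next
    fix v assume "v \<in> w ` pos B"
    then obtain u where u: "v = w u" "u \<in> pos B" by auto
    from u(2) obtain c where c: "u \<in> S" "u = ncomb B c" by (rule positive_rootsE)
    have "v = (\<Sum>b\<in>w ` B. real (c (inv w b)) *\<^sub>R b)"
      unfolding sum inv_f_f[OF assms(2)] using u(1) c(2) by simp
    moreover have "v \<in> S" using u c assms(3) by auto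
    ultimately show "v \<in> pos (w ` B)" by (intro positive_rootsI)
  qed
qed

lemma root_basis_image:
  assumes B: "root_basis S B" and w: "linear w" "inj w" "w ` S = S"
  shows "root_basis S (w ` B)"
proof -
  note facts = root_basis_facts[OF B]
  have spanned: "v \<in> pos (w ` B) \<or> - v \<in> pos (w ` B)" if v: "v \<in> S" for v
  proof -
    obtain u where u: "u \<in> S" "v = w u" using v w(3) by auto
    then show ?thesis unfolding positive_roots_image[OF w]
      using positive_or_negative[OF B u(1)] linear_neg[OF w(1), of u] by force
  qed
  have "\<exists>c. v = ncomb (w ` B) c \<or> v = - ncomb (w ` B) c"
    if v: "v \<in> S" for v
    using spanned[OF v]
  proof
    assume "v \<in> pos (w ` B)"
    then obtain c where "v = ncomb (w ` B) c" by (rule positive_rootsE)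
    then show ?thesis by (intro exI disjI1)
  next
    assume "- v \<in> pos (w ` B)"
    then obtain c where "- v = ncomb (w ` B) c" by (rule positive_rootsE)
    from arg_cong[OF this, of uminus]
    have "v = - ncomb (w ` B) c" by (simp only: minus_minus)
    then show ?thesis by (intro exI disjI2)
  qed
  moreover have "independent (w ` B)"
    using facts(2) w by (intro linear_independent_injective_image) (auto intro: inj_on_subset)
  moreover have "w ` B \<subseteq> S" using facts(1) w(3) by auto
  ultimately show ?thesis unfolding root_basis_def by blast
qed

text \<open>
  If some \<open>b \<in> B\<close> is not positive for \<open>B'\<close>, then \<open>reflect b\<close> permutes the positive roots of
  \<open>B\<close> other than \<open>b\<close>, so moving \<open>B'\<close> by it lowers by one the number of positive roots of \<open>B\<close>
  that are not positive for \<open>B'\<close>.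
\<close>

theorem weyl_transitive_on_bases:
  assumes B: "root_basis S B" and "root_basis S B'"
  shows "\<exists>w\<in>weyl_group S. w ` B' = B"
  using assms(2)
proof (induction "card (pos B - pos B')" arbitrary: B' rule: less_induct)
  case less
  note B' = less.prems
  note facts = root_basis_facts[OF B] and facts' = root_basis_facts[OF B']
  show ?case
  proof (cases "B \<subseteq> pos B'")
    case True
    have sub: "pos B \<subseteq> pos B'" using True facts(3) by (rule positive_roots_mono)
    have "pos B' \<subseteq> pos B"
    proof
      fix v assume v: "v \<in> pos B'"
      then have "v \<in> S" by (simp add: positive_roots_def)
      then show "v \<in> pos B"
        using positive_or_negative[OF B] not_positive_and_negative[OF B' v] sub by blast
    qed
    then have eq: "pos B = pos B'" using sub by simp
    have "B = B'" using basis_subset_if_positive_roots_eq[OF B B' eq]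
        basis_subset_if_positive_roots_eq[OF B' B eq[symmetric]] by simp
    then show ?thesis by (intro bexI[of _ id]) (auto intro: weyl_id)
  next
    case False
    then obtain b where b: "b \<in> B" "b \<notin> pos B'" by auto
    have bS: "b \<in> S" using b facts by auto
    have nb: "ip b b = -2" using subsystem_norm[OF bS] .
    have W: "reflect b \<in> weyl_group S" using bS by (rule weyl_reflect)
    have w: "linear (reflect b)" "inj (reflect b)" "reflect b ` S = S"
      using linear_reflect weyl_inj[OF W subsystem_subset]
        weyl_image_eq[OF W subsystem_subset subsystem_reflect] by auto
    define B'' where "B'' = reflect b ` B'"
    have B'': "root_basis S B''" unfolding B''_def using B' w by (rule root_basis_image)
    have pos'': "pos B'' = reflect b ` pos B'"
      unfolding B''_def using w by (rule positive_roots_image)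
    have nb': "- b \<in> pos B'" using positive_or_negative[OF B' bS] b by blast
    then have b'': "b \<in> pos B''"
      unfolding pos'' using linear_neg[OF w(1), of b] reflect_self[OF nb] by force
    have "reflect b ` (pos B - pos B'') \<subseteq> (pos B - pos B') - {b}"
    proof
      fix y assume "y \<in> reflect b ` (pos B - pos B'')"
      then obtain x where x: "y = reflect b x" "x \<in> pos B" "x \<notin> pos B''" by auto
      have "x \<noteq> b" using x b'' by auto
      then have "y \<in> pos B" using reflect_positive[OF B b(1)] x by auto
      moreover have "y \<notin> pos B'"
        using x reflect_reflect[OF nb, of x] unfolding pos'' by (metis image_eqI)
      moreover have "y \<noteq> b"
      proof
        assume "y = b"
        then have "x = - b" using x(1) reflect_reflect[OF nb, of x] reflect_self[OF nb] by simp
        moreover have "b \<in> pos B" using basis_positive_roots facts b by blast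
        ultimately show False using not_positive_and_negative[OF B] x(2) by blast
      qed
      ultimately show "y \<in> (pos B - pos B') - {b}" by blast
    qed
    moreover have fin: "finite (pos B - pos B')"
      using finite_Rt[OF r] subsystem_subset finite_subset unfolding positive_roots_def
      by (metis (no_types, lifting) finite_Diff mem_Collect_eq subsetI)
    ultimately have "card (reflect b ` (pos B - pos B''))
        \<le> card ((pos B - pos B') - {b})"
      by (intro card_mono) auto
    moreover have "b \<in> pos B - pos B'" using basis_positive_roots facts b by blast
    ultimately have "card (reflect b ` (pos B - pos B'')) < card (pos B - pos B')"
      using fin by (meson card_Diff1_less order.strict_trans1)
    then have "card (pos B - pos B'') < card (pos B - pos B')"
      using card_image[OF inj_on_subset[OF w(2) subset_UNIV]] by metis
    then obtain u where u: "u \<in> weyl_group S" "u ` B'' = B" using less.hyps B'' by blast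
    then show ?thesis using W
      by (intro bexI[of _ "u \<circ> reflect b"]) (auto simp: B''_def image_comp intro: weyl_comp)
  qed
qed

end

section \<open>Dynkin diagrams and other invariants\<close>

text \<open>
  For bases this is isomorphism of Dynkin diagrams, in a form that composes and that Weyl
  elements visibly produce.
\<close>

definition gram_iso :: "vec9 set \<Rightarrow> vec9 set \<Rightarrow> bool" where
  "gram_iso B B' \<longleftrightarrow> (\<exists>f. bij_betw f B B' \<and> (\<forall>x\<in>B. \<forall>y\<in>B. ip (f x) (f y) = ip x y))"

lemma gram_iso_refl: "gram_iso B B"
  unfolding gram_iso_def by (intro exI[of _ id]) auto

lemma gram_iso_sym:
  assumes "gram_iso B B'" shows "gram_iso B' B"
proof -
  obtain f where f: "bij_betw f B B'" "\<And>x y. x \<in> B \<Longrightarrow> y \<in> B \<Longrightarrow> ip (f x) (f y) = ip x y"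
    using assms by (auto simp: gram_iso_def)
  have inv: "inv_into B f x \<in> B" "f (inv_into B f x) = x" if "x \<in> B'" for x
    using that bij_betw_imp_surj_on[OF f(1)] inv_into_into[of x f B] f_inv_into_f[of x f B] by auto
  have "ip (inv_into B f x) (inv_into B f y) = ip x y" if "x \<in> B'" "y \<in> B'" for x y
    using f(2)[OF inv(1)[OF that(1)] inv(1)[OF that(2)]] inv(2) that by simp
  then show ?thesis using bij_betw_inv_into[OF f(1)] unfolding gram_iso_def by blast
qed

lemma gram_iso_trans:
  assumes "gram_iso B B'" "gram_iso B' B''" shows "gram_iso B B''"
proof -
  obtain f where f: "bij_betw f B B'" "\<And>x y. x \<in> B \<Longrightarrow> y \<in> B \<Longrightarrow> ip (f x) (f y) = ip x y"
    using assms(1) by (auto simp: gram_iso_def)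
  obtain g where g: "bij_betw g B' B''" "\<And>x y. x \<in> B' \<Longrightarrow> y \<in> B' \<Longrightarrow> ip (g x) (g y) = ip x y"
    using assms(2) by (auto simp: gram_iso_def)
  have "ip (g (f x)) (g (f y)) = ip x y" if "x \<in> B" "y \<in> B" for x y
    using f(2)[OF that] g(2)[of "f x" "f y"] bij_betwE[OF f(1)] that by simp
  then show ?thesis using bij_betw_trans[OF f(1) g(1)] unfolding gram_iso_def
    by (intro exI[of _ "g \<circ> f"]) auto
qed

lemma gram_iso_image:
  assumes "inj_on w B" "\<And>x y. ip (w x) (w y) = ip x y"
  shows "gram_iso B (w ` B)"
  using assms unfolding gram_iso_def by (intro exI[of _ w]) (auto simp: bij_betw_def)

lemma mem_dynkin_edges:
  assumes "x \<in> B" "y \<in> B" "x \<noteq> y"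
  shows "{x, y} \<in> dynkin_edges B \<longleftrightarrow> ip x y \<noteq> 0"
proof
  assume "{x, y} \<in> dynkin_edges B"
  then obtain a b where "{x, y} = {a, b}" "ip a b \<noteq> 0" by (auto simp: dynkin_edges_def)
  then show "ip x y \<noteq> 0" by (metis doubleton_eq_iff ip_commute)
qed (use assms in \<open>auto simp: dynkin_edges_def\<close>)

lemma gram_iso_edges:
  assumes f: "bij_betw f B B'" and ip: "\<And>x y. x \<in> B \<Longrightarrow> y \<in> B \<Longrightarrow> ip (f x) (f y) = ip x y"
  shows "(\<lambda>e. f ` e) ` dynkin_edges B = dynkin_edges B'"
proof (intro equalityI subsetI)
  fix e assume "e \<in> (\<lambda>e. f ` e) ` dynkin_edges B"
  then obtain x y where xy: "e = {f x, f y}" "x \<in> B" "y \<in> B" "x \<noteq> y" "ip x y \<noteq> 0"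
    by (auto simp: dynkin_edges_def)
  then have "f x \<noteq> f y" "f x \<in> B'" "f y \<in> B'" using f by (auto simp: bij_betw_def inj_on_def)
  then show "e \<in> dynkin_edges B'" using xy ip by (simp add: mem_dynkin_edges)
next
  fix e assume "e \<in> dynkin_edges B'"
  then obtain u v where uv: "e = {u, v}" "u \<in> B'" "v \<in> B'" "u \<noteq> v" "ip u v \<noteq> 0"
    by (auto simp: dynkin_edges_def)
  then obtain x y where xy: "x \<in> B" "y \<in> B" "u = f x" "v = f y" using f by (auto simp: bij_betw_def)
  then have "{x, y} \<in> dynkin_edges B" using uv ip[OF xy(1,2)] by (subst mem_dynkin_edges) auto
  moreover have "e = f ` {x, y}" using uv xy by simp
  ultimately show "e \<in> (\<lambda>e. f ` e) ` dynkin_edges B" by blast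
qed

text \<open>Distinct simple roots have product 0 or 1, so the graph determines the Gram matrix.\<close>

lemma simple_set_ip:
  assumes "r \<le> 8" "simple_set r B" "x \<in> B" "y \<in> B" "x \<noteq> y"
  shows "ip x y = 0 \<or> ip x y = 1"
proof -
  have R: "x \<in> Rt r" "y \<in> Rt r" and pos: "ip x y \<ge> 0"
    using assms by (auto simp: simple_set_def obtuse_def)
  have "x \<noteq> - y"
  proof
    assume "x = - y"
    then have "x = (-1) *\<^sub>R y" by simp
    moreover have "y \<in> span (B - {x})" using assms by (intro span_base) auto
    ultimately have "x \<in> span (B - {x})" by (metis span_mul)
    then show False using assms(2,3) by (auto simp: simple_set_def dependent_def)
  qed
  then show ?thesis using ip_Rt_cases[OF assms(1) R assms(5)] pos by auto
qed

lemma gram_iso_of_edges: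
  assumes "r \<le> 8" "simple_set r B" "simple_set r B'"
    and f: "bij_betw f B B'" and e: "(\<lambda>e. f ` e) ` dynkin_edges B = dynkin_edges B'"
  shows "gram_iso B B'"
proof -
  have "ip (f x) (f y) = ip x y" if xy: "x \<in> B" "y \<in> B" for x y
  proof (cases "x = y")
    case True
    have "f x \<in> B'" using f xy by (auto simp: bij_betw_def)
    then have "f x \<in> Rt r" "x \<in> Rt r" using xy assms(2,3) unfolding simple_set_def by blast+
    then show ?thesis using True by (simp add: Rt_norm)
  next
    case False
    have fxy: "f x \<in> B'" "f y \<in> B'" "f x \<noteq> f y" using f xy False by (auto simp: bij_betw_def inj_on_def)
    have "{f x, f y} \<in> dynkin_edges B' \<longleftrightarrow> {x, y} \<in> dynkin_edges B"
    proof
      assume "{f x, f y} \<in> dynkin_edges B'"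
      then have "f ` {x, y} \<in> (\<lambda>e. f ` e) ` dynkin_edges B" using e by simp
      then obtain d where d: "d \<in> dynkin_edges B" "f ` {x, y} = f ` d" by auto
      have "d \<subseteq> B" using d(1) by (auto simp: dynkin_edges_def)
      then have "d = {x, y}" using d(2) f xy inj_on_image_eq_iff[of f B "{x, y}" d] by (auto simp: bij_betw_def)
      then show "{x, y} \<in> dynkin_edges B" using d(1) by simp
    next
      assume "{x, y} \<in> dynkin_edges B"
      then have "f ` {x, y} \<in> dynkin_edges B'" using e by blast
      then show "{f x, f y} \<in> dynkin_edges B'" by simp
    qed
    then have "ip (f x) (f y) \<noteq> 0 \<longleftrightarrow> ip x y \<noteq> 0" using mem_dynkin_edges fxy xy False by simp
    then show ?thesis using simple_set_ip[OF assms(1,2) xy False] simple_set_ip[OF assms(1,3) fxy] by auto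
  qed
  then show ?thesis using f unfolding gram_iso_def by blast
qed

lemma gram_iso_bases:
  assumes "r \<le> 8" "root_subsystem r S" "root_basis S B" "root_basis S B'"
  shows "gram_iso B B'"
proof -
  obtain w where w: "w \<in> weyl_group S" "w ` B = B'"
    using weyl_transitive_on_bases[OF assms(1,2,4,3)] by auto
  have "S \<subseteq> Rt r" using assms root_subsystem_iff by auto
  then have "gram_iso B (w ` B)"
    using weyl_inj[OF w(1)] weyl_ip[OF w(1)] by (intro gram_iso_image) (auto intro: inj_on_subset)
  then show ?thesis using w by simp
qed

text \<open>
  By transitivity of the Weyl group on bases, the diagram may be read off from any basis.
\<close>

lemma dynkin_iso_iff_gram_iso:
  assumes "r \<le> 8" "root_subsystem r S" "root_subsystem r S'" "root_basis S B" "root_basis S' B'"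
  shows "dynkin_iso S S' \<longleftrightarrow> gram_iso B B'"
proof
  assume "dynkin_iso S S'"
  then obtain A A' f where A: "root_basis S A" "root_basis S' A'" "bij_betw f A A'"
    "(\<lambda>e. f ` e) ` dynkin_edges A = dynkin_edges A'"
    by (auto simp: dynkin_iso_def)
  then have "gram_iso A A'"
    using root_basis_simple_set assms by (intro gram_iso_of_edges[OF assms(1)]) auto
  then show "gram_iso B B'"
    using gram_iso_bases[OF assms(1)] A assms gram_iso_trans by meson
next
  assume "gram_iso B B'"
  then obtain f where "bij_betw f B B'" "\<And>x y. x \<in> B \<Longrightarrow> y \<in> B \<Longrightarrow> ip (f x) (f y) = ip x y"
    by (auto simp: gram_iso_def)
  then show "dynkin_iso S S'" using assms gram_iso_edges unfolding dynkin_iso_def by blast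
qed

text \<open>
  On a simple set the Gram matrix is \<open>-2\<close> times the identity plus the adjacency matrix of the
  diagram, so \<open>walks B k v\<close> is the number of walks of length \<open>k\<close> that start at \<open>v\<close>.
\<close>

fun walks :: "vec9 set \<Rightarrow> nat \<Rightarrow> vec9 \<Rightarrow> real" where
  "walks B 0 v = 1"
| "walks B (Suc k) v = (\<Sum>u\<in>B. ip v u * walks B k u) + 2 * walks B k v"

lemma walks_isometry:
  assumes "inj_on f B" "\<And>x y. x \<in> B \<Longrightarrow> y \<in> B \<Longrightarrow> ip (f x) (f y) = ip x y" "v \<in> B"
  shows "walks (f ` B) k (f v) = walks B k v"
  using assms(3)
proof (induction k arbitrary: v)
  case (Suc k)
  have "(\<Sum>u\<in>f ` B. ip (f v) u * walks (f ` B) k u) = (\<Sum>u\<in>B. ip v u * walks B k u)"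
    using assms Suc by (subst sum.reindex) (auto intro!: sum.cong)
  then show ?case using Suc by simp
qed simp

definition walk_sum :: "vec9 set \<Rightarrow> nat \<Rightarrow> real" where
  "walk_sum B k = (\<Sum>v\<in>B. walks B k v)"

lemma gram_iso_walk_sum:
  assumes "gram_iso B B'" shows "walk_sum B k = walk_sum B' k"
proof -
  obtain f where f: "inj_on f B" "f ` B = B'" "\<And>x y. x \<in> B \<Longrightarrow> y \<in> B \<Longrightarrow> ip (f x) (f y) = ip x y"
    using assms by (auto simp: gram_iso_def bij_betw_def)
  have "walk_sum (f ` B) k = walk_sum B k"
    unfolding walk_sum_def using f(1) walks_isometry[OF f(1,3)] by (subst sum.reindex) auto
  then show ?thesis using f by simp
qed

lemma C_of_eq_span: "C_of A S = {\<alpha> \<in> A. \<forall>s\<in>span S. ip \<alpha> s = 0}"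
proof -
  have "\<forall>s\<in>span S. ip \<alpha> s = 0" if "\<forall>s\<in>S. ip \<alpha> s = 0" for \<alpha>
  proof -
    have "span S \<subseteq> {s. ip \<alpha> s = 0}"
      using that by (intro span_minimal) (auto simp: subspace_def ip_simps)
    then show ?thesis by auto
  qed
  then show ?thesis unfolding C_of_def by (auto intro: span_base)
qed

lemma C_of_span: "span S = span S' \<Longrightarrow> C_of A S = C_of A S'"
  by (simp add: C_of_eq_span)

lemma K_of_span: "span S = span S' \<Longrightarrow> K_of A S = K_of A S'"
  by (simp add: K_of_def)

lemma root_basis_span:
  assumes "root_basis S B" shows "span S = span B"
proof
  show "span B \<subseteq> span S" using assms by (intro span_mono) (auto simp: root_basis_def)
  have comb: "(\<Sum>b\<in>B. real (c b) *\<^sub>R b) \<in> span B" for c :: "vec9 \<Rightarrow> nat"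
    by (rule span_sum, rule span_scale, rule span_base)
  have "v \<in> span B" if "v \<in> S" for v
    using assms that
  proof (cases rule: root_basisE)
    case (1 c)
    then show ?thesis by (simp only: comb)
  next
    case (2 c)
    then show ?thesis by (simp only: comb span_neg)
  qed
  then show "span S \<subseteq> span B" by (intro span_minimal) auto
qed

lemma C_of_weyl:
  assumes "r \<le> 8" "w \<in> W r"
  shows "C_of (Rt r) (w ` S) = w ` C_of (Rt r) S"
  using weyl_image_Rt[OF assms] weyl_ip[OF assms(2) order_refl] unfolding C_of_def by fastforce

lemma K_of_weyl:
  assumes "r \<le> 8" "w \<in> W r"
  shows "K_of (Rt r) (w ` S) = w ` K_of (Rt r) S"
proof -
  have "w ` Rt r \<inter> w ` span S = w ` (Rt r \<inter> span S)"
    using weyl_inj[OF assms(2) order_refl] by (simp add: image_Int)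
  then show ?thesis
    unfolding K_of_def using weyl_image_Rt[OF assms] span_linear_image linear_weyl[OF assms(2)]
    by (metis linear_span_image)
qed

lemma card_image_weyl:
  "r \<le> 8 \<Longrightarrow> w \<in> W r \<Longrightarrow> card (w ` X) = card X"
  using weyl_inj[of w "Rt r" r] by (intro card_image) (auto intro: inj_on_subset)

section \<open>Ranks\<close>

text \<open>
  Pairing a linear relation with an element of \<open>N\<close> isolates the coefficient of that element.
\<close>

lemma independent_Un_orthogonal:
  assumes "independent B" "finite B" "finite N"
    and N: "\<And>m n. m \<in> N \<Longrightarrow> n \<in> N \<Longrightarrow> m \<noteq> n \<Longrightarrow> ip m n = 0" "\<And>n. n \<in> N \<Longrightarrow> ip n n \<noteq> 0"
    and BN: "\<And>b n. b \<in> B \<Longrightarrow> n \<in> N \<Longrightarrow> ip b n = 0"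
  shows "independent (B \<union> N)"
proof
  assume "dependent (B \<union> N)"
  then obtain u v where u: "v \<in> B \<union> N" "u v \<noteq> 0" "(\<Sum>b\<in>B \<union> N. u b *\<^sub>R b) = 0"
    using dependent_finite[of "B \<union> N"] assms by auto
  have disj: "B \<inter> N = {}" using N(2) BN by blast
  have sum: "(\<Sum>b\<in>B. u b *\<^sub>R b) + (\<Sum>b\<in>N. u b *\<^sub>R b) = 0"
    using u(3) assms disj by (simp add: sum.union_disjoint)
  have un: "u n = 0" if n: "n \<in> N" for n
  proof -
    have "0 = (\<Sum>b\<in>B. u b * ip b n) + (\<Sum>m\<in>N. u m * ip m n)"
      using arg_cong[OF sum, of "\<lambda>x. ip x n"] by (simp add: ip_add_left ip_sum_left ip_scaleR_left)
    also have "(\<Sum>b\<in>B. u b * ip b n) = 0" using BN n by (intro sum.neutral) auto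
    also have "(\<Sum>m\<in>N. u m * ip m n) = (\<Sum>m\<in>N. if m = n then u n * ip n n else 0)"
      using N(1) n by (intro sum.cong) auto
    finally show ?thesis using N(2) n assms(3) by simp
  qed
  then have "(\<Sum>b\<in>B. u b *\<^sub>R b) = 0" using sum by simp
  moreover have "v \<in> B" using u un by auto
  ultimately have "dependent B" using u(2) dependent_finite[OF assms(2)] by blast
  then show False using assms(1) by simp
qed

lemma Lambda_subset_span: "Lambda r \<subseteq> span (insert H (Q ` {1..r}))"
  unfolding Lambda_def
  by (auto intro!: span_add span_scale span_sum intro: span_base)

text \<open>
  The class \<open>canon r\<close> has self-intersection \<open>9 - r > 0\<close>, so it leaves rank \<open>r\<close> for its
  complement.
\<close>

lemma orthogonal_card_le:
  assumes r: "r \<le> 8" and "independent B" "B \<subseteq> Rt r" "finite N" "N \<subseteq> Lambda r"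
    and N: "\<And>m n. m \<in> N \<Longrightarrow> n \<in> N \<Longrightarrow> m \<noteq> n \<Longrightarrow> ip m n = 0" "\<And>n. n \<in> N \<Longrightarrow> ip n n \<noteq> 0"
      "\<And>n. n \<in> N \<Longrightarrow> ip n (canon r) = 0"
    and BN: "\<And>b n. b \<in> B \<Longrightarrow> n \<in> N \<Longrightarrow> ip b n = 0"
  shows "card B + card N \<le> r"
proof -
  have finB: "finite B" using assms finite_Rt finite_subset by blast
  have K: "ip (canon r) (canon r) = 9 - r"
    using ip_canon[OF r, of "canon r"] r
    by (simp add: canon_eq_ivec[OF r] ivec_nth canon_list_nth ivec_nth[of 0, simplified])
  then have K0: "ip (canon r) (canon r) \<noteq> 0" using r by simp
  have ind: "independent (B \<union> insert (canon r) N)"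
  proof (rule independent_Un_orthogonal)
    show "ip m n = 0" if "m \<in> insert (canon r) N" "n \<in> insert (canon r) N" "m \<noteq> n" for m n
      using that N(1)[of m n] N(3)[of m] N(3)[of n] ip_commute[of m n] by auto
    show "ip b n = 0" if "b \<in> B" "n \<in> insert (canon r) N" for b n
      using that assms(3) BN by (auto simp: Rt_def)
  qed (use assms(2,4) K0 N(2) finB in auto)
  have "canon r \<in> Lambda r"
    using r by (auto simp: Lambda_eq canon_eq_ivec canon_list_nth)
  then have "B \<union> insert (canon r) N \<subseteq> span (insert H (Q ` {1..r}))"
  proof -
    have "B \<subseteq> Lambda r" using assms(3) by (auto simp: Rt_def)
    then show ?thesis using assms(5) \<open>canon r \<in> Lambda r\<close> Lambda_subset_span[of r] by blast
  qed
  then have "card (B \<union> insert (canon r) N) \<le> card (insert H (Q ` {1..r}))"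
    by (rule independent_span_bound[OF _ ind, THEN conjunct2, rotated]) simp
  also have "\<dots> \<le> Suc (card (Q ` {1..r}))" by (simp add: card_insert_if)
  also have "\<dots> \<le> Suc r" using card_image_le[of "{1..r}" Q] by simp
  finally have "card (B \<union> insert (canon r) N) \<le> Suc r" .
  moreover have "canon r \<notin> N" using N(3) K0 by auto
  moreover have "B \<inter> insert (canon r) N = {}" using K0 BN N(2) assms(3) by (auto simp: Rt_def)
  ultimately show ?thesis using finB assms(4) by (simp add: card_Un_disjoint)
qed

lemma simple_set_card_le:
  assumes "r \<le> 8" "simple_set r B" shows "card B \<le> r"
  using orthogonal_card_le[OF assms(1), of B "{}"] assms(2) by (simp add: simple_set_def)

text \<open>When \<open>N\<close> fills the rank that \<open>B\<close> leaves, orthogonality to \<open>N\<close> recognizes the span of \<open>B\<close>.\<close>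

lemma K_of_eq_orthogonal:
  assumes r: "r \<le> 8" and "independent B" "B \<subseteq> Rt r" "finite N" "N \<subseteq> Lambda r"
    and N: "\<And>m n. m \<in> N \<Longrightarrow> n \<in> N \<Longrightarrow> m \<noteq> n \<Longrightarrow> ip m n = 0" "\<And>n. n \<in> N \<Longrightarrow> ip n n \<noteq> 0"
      "\<And>n. n \<in> N \<Longrightarrow> ip n (canon r) = 0"
    and BN: "\<And>b n. b \<in> B \<Longrightarrow> n \<in> N \<Longrightarrow> ip b n = 0"
    and card: "card B + card N = r"
  shows "K_of (Rt r) B = {x \<in> Rt r. \<forall>n\<in>N. ip x n = 0}"
proof (intro equalityI subsetI)
  fix x assume x: "x \<in> K_of (Rt r) B"
  have "span B \<subseteq> {x. \<forall>n\<in>N. ip x n = 0}"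
    using BN by (intro span_minimal) (auto simp: subspace_def ip_simps)
  then show "x \<in> {x \<in> Rt r. \<forall>n\<in>N. ip x n = 0}" using x by (auto simp: K_of_def)
next
  fix x assume x: "x \<in> {x \<in> Rt r. \<forall>n\<in>N. ip x n = 0}"
  have "x \<in> span B"
  proof (rule ccontr)
    assume nx: "x \<notin> span B"
    then have ind: "independent (insert x B)" using assms(2) by (simp add: independent_insert)
    have "card (insert x B) + card N \<le> r"
      using x BN assms by (intro orthogonal_card_le[OF r ind _ _ _ N]) auto
    moreover have "finite B" using assms finite_Rt finite_subset by blast
    moreover have "x \<notin> B" using nx span_base by auto
    ultimately show False using card by simp
  qed
  then show "x \<in> K_of (Rt r) B" using x by (auto simp: K_of_def)
qed

section \<open>Moving a root into a chamber\<close>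

text \<open>
  If \<open>ip v a < 0\<close> for a root \<open>a\<close> of positive height, then \<open>reflect a v\<close> is lower than \<open>v\<close>; a
  lowest element of the finite orbit has no such \<open>a\<close>.
\<close>

lemma exists_dominant:
  assumes "r \<le> 8" "A \<subseteq> Rt r" "\<And>a. a \<in> A \<Longrightarrow> height a > 0" "v \<in> Rt r"
  shows "\<exists>w\<in>weyl_group A. w v \<in> Rt r \<and> (\<forall>a\<in>A. ip (w v) a \<ge> 0)"
  using assms(4)
proof (induction "card {u \<in> Rt r. height u < height v}" arbitrary: v rule: less_induct)
  case less
  show ?case
  proof (cases "\<forall>a\<in>A. ip v a \<ge> 0")
    case True
    then show ?thesis using less.prems by (intro bexI[of _ id]) (auto intro: weyl_id)
  next
    case False
    then obtain a where a: "a \<in> A" "ip v a < 0" by auto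
    have aR: "a \<in> Rt r" using a assms by auto
    have "reflect a v = v + ip v a *\<^sub>R a" using aR by (simp add: reflect_eq Rt_norm)
    then have "height (reflect a v) = height v + ip v a * height a"
      by (simp add: linear_add[OF linear_height] linear_scale[OF linear_height])
    then have lt: "height (reflect a v) < height v" using a assms(3) by (simp add: mult_less_0_iff)
    have R: "reflect a v \<in> Rt r" using reflect_Rt assms(1) aR less.prems by auto
    have "card {u \<in> Rt r. height u < height (reflect a v)} < card {u \<in> Rt r. height u < height v}"
      using lt R finite_Rt[OF assms(1)] by (intro psubset_card_mono) auto
    from less.hyps[OF this R] obtain w where w: "w \<in> weyl_group A"
      "w (reflect a v) \<in> Rt r \<and> (\<forall>b\<in>A. ip (w (reflect a v)) b \<ge> 0)" by blast
    then show ?thesis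
      using a by (intro bexI[of _ "w \<circ> reflect a"]) (auto intro: weyl_comp weyl_reflect)
  qed
qed

section \<open>Computing with coordinate lists\<close>

fun coords :: "c1_symbol \<Rightarrow> int list" where
  "coords (L0 a b) = map (\<lambda>i. if i = a then 1 else if i = b then - 1 else 0) [0..<9]"
| "coords (L1 a b c) = 1 # map (\<lambda>i. if i = a \<or> i = b \<or> i = c then - 1 else 0) [1..<9]"
| "coords (L2 a b) = 2 # map (\<lambda>i. if i = a \<or> i = b then 0 else - 1) [1..<9]"
| "coords (L3 a) = 3 # map (\<lambda>i. if i = a then - 2 else - 1) [1..<9]"

fun elem_coords :: "c1_elem \<Rightarrow> int list" where
  "elem_coords (Pos s) = coords s"
| "elem_coords (Neg s) = map uminus (coords s)"

fun valid_symbol :: "c1_symbol \<Rightarrow> bool" where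
  "valid_symbol (L0 a b) \<longleftrightarrow> 1 \<le> a \<and> a \<le> 8 \<and> 1 \<le> b \<and> b \<le> 8 \<and> a \<noteq> b"
| "valid_symbol (L1 a b c) \<longleftrightarrow> 1 \<le> a \<and> a \<le> 8 \<and> 1 \<le> b \<and> b \<le> 8 \<and> 1 \<le> c \<and> c \<le> 8
     \<and> a \<noteq> b \<and> a \<noteq> c \<and> b \<noteq> c"
| "valid_symbol (L2 a b) \<longleftrightarrow> 1 \<le> a \<and> a \<le> 8 \<and> 1 \<le> b \<and> b \<le> 8 \<and> a \<noteq> b"
| "valid_symbol (L3 a) \<longleftrightarrow> 1 \<le> a \<and> a \<le> 8"

fun symbol_of :: "c1_elem \<Rightarrow> c1_symbol" where
  "symbol_of (Pos s) = s"
| "symbol_of (Neg s) = s"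

fun axpy :: "int \<Rightarrow> int list \<Rightarrow> int list \<Rightarrow> int list" where
  "axpy c (x # xs) (y # ys) = (c * x + y) # axpy c xs ys"
| "axpy c _ _ = []"

definition reflect_list :: "int list \<Rightarrow> int list \<Rightarrow> int list" where
  "reflect_list a v = axpy (ipl v a) a v"

fun reflect_word :: "int list list \<Rightarrow> int list list \<Rightarrow> int list list" where
  "reflect_word [] vs = vs"
| "reflect_word (a # as) vs = reflect_word as (map (reflect_list a) vs)"

fun combination :: "int list \<Rightarrow> int list list \<Rightarrow> int list" where
  "combination (c # cs) (b # bs) = axpy c b (combination cs bs)"
| "combination _ _ = [0, 0, 0, 0, 0, 0, 0, 0, 0]"

definition gram :: "int list list \<Rightarrow> int list list" where
  "gram B = map (\<lambda>b. map (ipl b) B) B"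

fun next_walks :: "int list list \<Rightarrow> int list \<Rightarrow> int list \<Rightarrow> int list" where
  "next_walks (g # G) w (x # xs) = (dot g w + 2 * x) # next_walks G w xs"
| "next_walks _ _ _ = []"

definition extend_walks :: "int list list \<Rightarrow> int list \<Rightarrow> int list" where
  "extend_walks G w = next_walks G w w"

fun walk_list :: "int list list \<Rightarrow> nat \<Rightarrow> int list" where
  "walk_list G 0 = map (\<lambda>_. 1) G"
| "walk_list G (Suc k) = extend_walks G (walk_list G k)"

text \<open>
  The root that the induction removes is one at which a number of walks is minimal.  In the lists
  below the root under consideration always comes first.
\<close>

definition hd_minimal :: "int list \<Rightarrow> bool" where
  "hd_minimal w = list_all ((\<le>) (hd w)) w"

text \<open>
  This is the step of a filter, with the test as an argument: under innermost rewriting the list is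
  then traversed once, whereas a conditional would cause its rest to be simplified at each step.
\<close>

fun keep :: "bool \<Rightarrow> 'a \<Rightarrow> 'a list \<Rightarrow> 'a list" where
  "keep True x xs = x # xs"
| "keep False x xs = xs"

fun nonneg_with :: "int list \<Rightarrow> int list list \<Rightarrow> int list list" where
  "nonneg_with b [] = []"
| "nonneg_with b (x # xs) = keep (0 \<le> ipl x b) x (nonneg_with b xs)"

fun orth_with :: "int list \<Rightarrow> int list list \<Rightarrow> int list list" where
  "orth_with b [] = []"
| "orth_with b (x # xs) = keep (ipl x b = 0) x (orth_with b xs)"

fun walk_minimal :: "int list list \<Rightarrow> int list list \<Rightarrow> int list list" where
  "walk_minimal B [] = []"
| "walk_minimal B (x # xs) =
     keep (hd_minimal (walk_list (gram (x # B)) 3)) x (walk_minimal B xs)"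

text \<open>
  The roots that may have to be added to \<open>B\<close>: obtuse to \<open>B\<close>, in the chamber of \<open>A\<close>, and minimal
  for the number of walks of length 3.  Length 3 already favours the ends of small components and
  so leaves few roots.
\<close>

definition required :: "int list list \<Rightarrow> int list list \<Rightarrow> int list list \<Rightarrow> int list list" where
  "required R B A = walk_minimal B (fold nonneg_with A (fold nonneg_with B R))"

fun obtuse_list :: "int list list \<Rightarrow> bool" where
  "obtuse_list [] \<longleftrightarrow> True"
| "obtuse_list (b # bs) \<longleftrightarrow> list_all (\<lambda>c. 0 \<le> ipl b c) bs \<and> obtuse_list bs"

definition contained :: "'a list \<Rightarrow> 'a list \<Rightarrow> bool" where
  "contained xs ys \<longleftrightarrow> list_all (\<lambda>x. list_ex ((=) x) ys) xs"

section \<open>The table of simple sets\<close>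

text \<open>
  The entry of a simple set \<open>B\<close> consists of the symbols of \<open>B\<close>; the simple roots of the system of
  roots orthogonal to \<open>B\<close>, whose reflections serve to move a further root; one extension for each
  required root \<open>x\<close>, in the order of \<open>rts r\<close>; and, if the symbols of \<open>B\<close> do not all lie in \<open>Z 0\<close>,
  a label with elements of \<open>Z 0\<close> and a word that takes it to \<open>B\<close>.

  An extension \<open>Dependent k c\<close> states that \<open>k x = \<Sum> c b\<close>.  An extension \<open>Conjugate j w\<close> states
  that the word \<open>w\<close> takes \<open>B\<close> and \<open>x\<close> to entry number \<open>j\<close>, counted from 0.  Words consist of the symbols of
  positive roots, and the reflection in the first one is applied first.
\<close>

datatype extension =
    Dependent int "int list"
  | Conjugate nat "c1_symbol list"

datatype node = Node (node_label: "c1_symbol list") (chamber: "c1_symbol list")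
  (extensions: "extension list") (original: "(c1_elem list \<times> c1_symbol list) option")

text \<open>
  In the table the symbols are written as the numbers that they look like: 1123 is \<open>L1 1 2 3\<close>,
  278 is \<open>L2 7 8\<close>, 308 is \<open>L3 8\<close>, and a sign is that of the element.
\<close>

definition digit :: "int \<Rightarrow> int \<Rightarrow> nat" where
  "digit k n = nat (n div k mod 10)"

definition symbol :: "int \<Rightarrow> c1_symbol" where
  "symbol n =
     (if n < 100 then L0 (digit 10 n) (digit 1 n)
      else if n < 300 then L2 (digit 10 n) (digit 1 n)
      else if n < 400 then L3 (digit 1 n)
      else L1 (digit 100 n) (digit 10 n) (digit 1 n))"

definition signed_symbol :: "int \<Rightarrow> c1_elem" where
  "signed_symbol n = (if n < 0 then Neg (symbol (- n)) else Pos (symbol n))"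

definition move :: "nat \<Rightarrow> int list \<Rightarrow> extension" where
  "move j ws = Conjugate j (map symbol ws)"

definition entry :: "int list \<Rightarrow> int list \<Rightarrow> extension list \<Rightarrow> (int list \<times> int list) option \<Rightarrow> node" where
  "entry l ch es ow = Node (map symbol l) (map symbol ch) es
     (map_option (\<lambda>(os, ws). (map signed_symbol os, map symbol ws)) ow)"

definition nodes2 :: "node list" where
  "nodes2 = [
   entry [] [12] [move 1 [12]] None,
   entry [12] [] [Dependent 1 [-1]] None]"

definition nodes3 :: "node list" where
  "nodes3 = [
   entry [] [23, 12, 1123] [move 2 [1123], move 1 [23, 12]] None,
   entry [12] [1123] [move 3 [1123], move 4 [23, 12], Dependent 1 [-1], move 4 []] None,
   entry [1123] [23, 12] [Dependent 1 [-1], move 3 [23, 12]] None,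
   entry [1123, 12] [] [] None,
   entry [12, 23] [1123] [move 5 [1123], Dependent 1 [-1, -1]] None,
   entry [1123, 12, 23] [] [] None]"

definition nodes4 :: "node list" where
  "nodes4 = [
   entry [] [34, 23, 12, 1123] [move 1 [14, 1123]] None,
   entry [1123] [23, 12] [move 3 [34, 1123, 1234], Dependent 1 [-1], move 2 [23, 12], move 3 []]
     None,
   entry [1123, 12] [] [] None,
   entry [1123, 34] [12] [move 5 [14, 1123, 13, 12], Dependent 1 [-1, -1], move 4 [24, 1124, 1234],
     move 5 []] None,
   entry [1123, 12, 23] [] [] None,
   entry [1123, 23, 34] [] [move 6 [14, 1123, 23, 13], Dependent 1 [-1, -1, -1], move 6 []] None,
   entry [1123, 12, 23, 34] [] [] None]"

definition nodes5 :: "node list" where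
  "nodes5 = [
   entry [] [45, 34, 23, 12, 1123] [move 1 [1134, 1235]] None,
   entry [1123] [45, 23, 12, 1145] [move 2 [13, 1245], move 4 [1245], Dependent 1 [-1], move 3
     [45]] None,
   entry [1123, 12] [45, 1345] [move 5 [14, 1134, 45], move 5 [45]] None,
   entry [1123, 45] [23, 12, 1145] [move 5 [13, 1245]] None,
   entry [1123, 34] [12, 1345] [move 6 [14, 1134, 34, 1125, 1345], move 7 [1345], move 7 [34, 1123,
     1134, 1234], move 8 [45, 34, 1123], Dependent 1 [-1, -1], move 6 [24, 1234, 13], move 8 []]
     None,
   entry [1123, 12, 45] [1345] [move 9 [23, 12, 1145]] None,
   entry [1123, 12, 23] [45] [move 10 [45]] None,
   entry [1123, 23, 34] [] [move 12 [1134, 1235, 45, 23, 1145, 12], move 12 [34, 1123, 1134, 1234],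
     move 13 [25, 1125], Dependent 1 [-1, -1, -1], move 13 [], move 12 [], move 12 [25, 1125]] None,
   entry [1123, 34, 45] [12, 1345] [move 11 [15, 1234], move 13 [1345], Dependent 1 [-1, -1, -1],
     move 11 [12]] None,
   entry [1123, 23, 45, 1145] [] [] (Some ([23, 45, 1123, -1145], [1145])),
   entry [1123, 12, 23, 45] [] [] None,
   entry [1123, 12, 34, 45] [1345] [move 14 [25, 1235, 13, 1145, 1123]] None,
   entry [1123, 12, 23, 34] [] [move 15 [25, 14, 23, 1123, 1145, 1345], Dependent 1 [-1, -1, -1,
     -1], move 15 []] None,
   entry [1123, 23, 34, 45] [] [move 15 [15, 1234], Dependent 1 [-1, -1, -2, -1], move 15 []] None,
   entry [1123, 12, 23, 45, 1145] [] [] (Some ([12, 23, 45, 1123, -1345], [12, 1245, 23])),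
   entry [1123, 12, 23, 34, 45] [] [] None]"

definition nodes6 :: "node list" where
  "nodes6 = [
   entry [] [56, 45, 34, 23, 12, 1123] [move 1 [1123, 278]] None,
   entry [1123] [56, 45, 23, 12, 1145] [move 3 [1145, 1246], move 2 [13, 1256], Dependent 1 [-1]]
     None,
   entry [1123, 12] [56, 45, 1345] [move 4 [45, 1356]] None,
   entry [1123, 34] [56, 12, 1156, 1345] [move 6 [34, 1123, 1134, 278], move 5 [35, 278, 13, 1246,
     1356], move 5 [24, 1124, 278, 1156], move 6 [1346], Dependent 1 [-1, -1]] None,
   entry [1123, 12, 45] [1345] [move 7 [23, 1345, 1145]] None,
   entry [1123, 12, 23] [56, 45] [move 10 [26, 15, 1256, 1234], move 8 [56, 45], move 10 [23, 12,
     15, 1145, 1234]] None,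
   entry [1123, 23, 34] [56, 1156] [move 11 [23, 13, 1123, 278, 1356], move 11 [35, 278, 1246,
     1356, 1156], move 9 [1256, 1346], move 12 [1156], Dependent 1 [-1, -1, -1], move 9 [25, 1134,
     16, 278], move 11 [], move 11 [25, 1125]] None,
   entry [1123, 23, 45, 1145] [] [] (Some ([23, 45, 1123, -1145], [1145])),
   entry [1123, 12, 23, 45] [] [] None,
   entry [1123, 12, 34, 45] [1345] [move 13 [25, 14, 23, 12, 1123]] None,
   entry [12, 23, 45, 56] [1123, 1456] [move 14 [1123, 278]] None,
   entry [1123, 12, 23, 34] [56] [move 16 [1234, 1256, 1346, 1126], move 17 [35, 278, 13, 1246,
     1356], Dependent 1 [-1, -1, -1, -1], move 15 [56], move 17 [], move 16 [34, 24, 45, 1145, 14,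
     1123]] None,
   entry [1123, 23, 34, 45] [] [move 17 [1234, 1256, 1126, 1346], move 17 [15, 1234], move 17
     [1256, 1346], Dependent 1 [-1, -1, -2, -1], move 17 [26, 15, 1126, 1346], move 17 [], move 17
     [26, 1126]] None,
   entry [1123, 12, 23, 45, 1145] [] [] (Some ([12, 34, 45, 56, -278], [1135, 1234, 1126])),
   entry [1123, 12, 23, 45, 56] [] [move 19 [1123, 278], move 19 []] None,
   entry [1123, 12, 23, 34, 56] [] [] None,
   entry [12, 23, 34, 45, 56] [278] [move 18 [1135, 1234, 1126], Dependent 1 [-1, -1, -1, -1, -1]]
     None,
   entry [1123, 12, 23, 34, 45] [] [move 20 [26, 15, 1234, 1256], Dependent 1 [-1, -1, -2, -2, -1],
     move 20 []] None,
   entry [1123, 12, 23, 45, 56, 1145] [] [] (Some ([12, 34, 45, 56, 1123, -278], [1135, 1346, 15])),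
   entry [1123, 12, 23, 45, 56, 1456] [] [] (Some ([12, 23, 45, 56, 1123, -278], [1123, 278])),
   entry [1123, 12, 23, 34, 45, 56] [] [] None]"

definition nodes7 :: "node list" where
  "nodes7 = [
   entry [] [67, 56, 45, 34, 23, 12, 1123] [move 1 [1234, 248]] None,
   entry [1123] [67, 56, 45, 23, 12, 1145] [move 2 [12, 218], move 3 [238], Dependent 1 [-1]] None,
   entry [1123, 12] [67, 56, 45, 1345, 238] [move 5 [1156, 1246, 67], move 4 [46, 1357]] None,
   entry [1123, 34] [67, 56, 12, 1156, 1345] [move 6 [24, 1124, 1234, 248], move 7 [228], move 7
     [34, 1123, 1134, 258], Dependent 1 [-1, -1]] None,
   entry [1123, 12, 45] [67, 1345, 1367, 238] [move 8 [1156, 1246, 67], move 8 [27, 1237, 1123,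
     12], move 9 [13, 1145, 23], move 8 [67]] None,
   entry [1123, 45, 67] [23, 12, 1145, 1167] [move 8 [12, 218]] None,
   entry [1123, 12, 23] [67, 56, 45] [move 13 [1147, 1246, 238, 1345], move 10 [57, 45], move 13
     [1356, 1257, 1167]] None,
   entry [1123, 23, 34] [67, 56, 1156, 218] [move 12 [1257, 1347], move 14 [218], move 14 [25, 218,
     1125], move 11 [1267, 56, 1347], move 15 [1157], Dependent 1 [-1, -1, -1]] None,
   entry [1123, 12, 45, 67] [1345, 1367, 238] [move 16 [12, 1245, 37, 1126, 23], move 16 [228,
     1247, 1256], move 16 [13, 1145, 23]] None,
   entry [1123, 23, 45, 1145] [67, 1167, 218] [move 16 [1256, 1346, 67], move 16 [46, 1146, 67],
     move 16 [67]] (Some ([23, 45, 1123, -1145], [1145])),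
   entry [1123, 12, 23, 45] [67] [move 17 [67]] None,
   entry [1123, 12, 34, 45] [67, 1345] [move 23 [1256, 1346, 67, 1167], move 19 [34, 25, 23, 14,
     1123], move 18 [67], move 23 [1157, 1256, 228]] None,
   entry [1123, 34, 45, 67] [12, 1167, 1345] [move 18 [12, 218]] None,
   entry [1123, 34, 56, 67] [12, 228] [move 20 [1234, 248, 1147, 1156, 23, 12, 218]] None,
   entry [1123, 12, 23, 34] [67, 56] [move 25 [1257, 1347, 1167], move 24 [56, 258, 1567], move 26
     [1357, 16, 1136, 238], Dependent 1 [-1, -1, -1, -1], move 21 [67, 56], move 26 [], move 24
     [25, 14, 23, 1145, 1345, 1123], move 25 [36, 1125, 14, 1134, 1356]] None,
   entry [1123, 23, 34, 45] [67, 1167, 218] [move 22 [1256, 1346, 67], move 26 [218], move 26 [26,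
     1126, 218], move 22 [26, 1126, 67], move 26 [1257, 1347], Dependent 1 [-1, -1, -2, -1], move
     22 [67]] None,
   entry [1123, 23, 45, 67, 1145] [1167, 218] [move 27 [1126, 1467, 1135, 12], move 27 [1135, 1126,
     17, 1347, 1567]] (Some ([23, 45, 67, 1123, -1145], [1145])),
   entry [1123, 12, 23, 45, 67] [] [] None,
   entry [1123, 12, 34, 45, 67] [1345] [move 28 [35, 24, 15, 45, 1123]] None,
   entry [1123, 12, 23, 45, 1145] [67] [move 28 [67]] (Some ([12, 23, 45, 67, -218], [1457, 278])),
   entry [1123, 12, 23, 45, 56] [] [move 34 [1123, 278], move 34 []] None,
   entry [1123, 12, 23, 34, 56] [] [move 35 [67, 56], move 35 []] None,
   entry [1123, 23, 34, 45, 67] [1167, 218] [move 29 [13, 228, 1167, 1457, 278], move 29 [35, 1124,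
     37, 1126, 23]] None,
   entry [1123, 23, 34, 56, 67] [218] [move 30 [35, 24, 37, 26, 17, 1123, 278], move 36 [47, 36,
     1345, 25], move 36 [34, 24, 14, 1123]] None,
   entry [12, 23, 34, 45, 56] [278] [move 37 [26, 15, 1127, 1347, 1567], move 32 [1135, 1126,
     1234], Dependent 1 [-1, -1, -1, -1, -1], move 37 []] None,
   entry [1123, 34, 45, 56, 67] [12, 228] [move 31 [12, 218], Dependent 1 [-1, -1, -1, -1, -1]]
     None,
   entry [1123, 12, 23, 34, 45] [67] [move 38 [1257, 1347, 1167], move 39 [258, 1567], Dependent 1
     [-1, -1, -2, -2, -1], move 33 [67], move 39 [], move 38 [26, 15, 1256, 1234]] None,
   entry [12, 34, 56, 1347, 1127, 1567] [278] [move 40 [278]] (Some ([45, 67, 1123, -1145, -1167,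
     -218], [1467, 1126, 1245])),
   entry [1123, 12, 23, 45, 67, 1145] [] [] (Some ([45, 67, 1123, -1345, -1167, 218], [12, 1367,
     1167, 218])),
   entry [1123, 23, 45, 56, 67, 1145] [218] [move 41 [1135, 1126, 1234, 1567, 278]] (Some ([45, 56,
     67, 1123, -1167, -218], [13, 228])),
   entry [1123, 12, 23, 45, 56, 67] [] [] None,
   entry [1123, 12, 34, 45, 56, 67] [] [move 44 [34, 24, 16, 1235, 45, 1156, 57], move 44 [36,
     1125, 1146, 1245, 1356]] None,
   entry [1123, 12, 23, 45, 56, 1145] [] [] (Some ([12, 34, 45, 56, 1123, -278], [1135, 15, 1346])),
   entry [1123, 12, 23, 34, 45, 67] [] [] None,
   entry [1123, 12, 23, 45, 56, 1456] [] [] (Some ([12, 34, 56, 67, 1123, -218], [1356, 1347])),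
   entry [1123, 12, 23, 34, 56, 67] [] [] None,
   entry [12, 23, 34, 56, 67, 278] [1567] [move 42 [1567]] (Some ([23, 34, 56, 67, 1123, -1167],
     [1267, 1456, 1357])),
   entry [12, 23, 34, 45, 56, 67] [] [move 45 [67, 268, 45, 34, 23, 12, 16], Dependent 1 [-1, -1,
     -1, -1, -1, -1], move 45 []] None,
   entry [1123, 23, 34, 45, 56, 67] [218] [move 43 [35, 24, 13, 1245, 26, 37, 1123], Dependent 1
     [-1, -1, -2, -2, -2, -1]] None,
   entry [1123, 12, 23, 34, 45, 56] [] [move 46 [26, 15, 1127, 1347, 1567], Dependent 1 [-2, -1,
     -2, -3, -2, -1], move 46 []] None,
   entry [12, 34, 56, 1347, 1127, 1567, 278] [] [] (Some ([23, 45, 67, 1123, -1145, -1167, -218],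
     [1126, 1245, 1467])),
   entry [12, 23, 34, 56, 1127, 1567, 278] [] [] (Some ([23, 34, 45, 67, -1145, -1167, -218],
     [1245, 36, 1356, 258])),
   entry [12, 23, 34, 56, 67, 1567, 278] [] [] (Some ([23, 34, 56, 67, 1123, -1167, -218], [1267,
     1357, 1456])),
   entry [1123, 12, 23, 45, 56, 67, 1145] [] [] (Some ([23, 34, 45, 67, 1123, -1345, 218], [13,
     1245, 37, 1126])),
   entry [1123, 12, 23, 34, 56, 67, 1567] [] [] (Some ([23, 34, 56, 1123, -1167, -278, 218], [37,
     1256, 1137, 24])),
   entry [12, 23, 34, 45, 56, 67, 278] [] [] (Some ([34, 45, 56, 1123, -1167, -278, 218], [56, 45,
     47, 1124, 228, 34])),
   entry [1123, 12, 23, 34, 45, 56, 67] [] [] None]"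

definition nodes8 :: "node list" where
  "nodes8 = [
   entry [] [78, 67, 56, 45, 34, 23, 12, 1123] [move 1 [1128, 303]] None,
   entry [1123] [78, 67, 56, 45, 23, 12, 1145] [move 2 [1248, 214], move 3 [304], Dependent 1 [-1]]
     None,
   entry [1123, 12] [78, 67, 56, 45, 1345, 238] [move 4 [48, 305]] None,
   entry [1123, 34] [78, 67, 56, 12, 1156, 1345] [move 5 [1128, 303, 1145, 225, 1358], move 6
     [1345, 225], move 6 [303, 14, 223], Dependent 1 [-1, -1]] None,
   entry [1123, 12, 45] [78, 67, 1345, 1367, 238] [move 7 [68, 307], move 8 [12, 1245, 23]] None,
   entry [1123, 12, 23] [78, 67, 56, 45, 304] [move 9 [48, 305], move 11 [235, 226, 217]] None,
   entry [1123, 23, 34] [78, 67, 56, 1156, 218] [move 10 [1258, 215, 1348], move 13 [305], move 12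
     [302, 212], move 12 [215], Dependent 1 [-1, -1, -1]] None,
   entry [1123, 12, 45, 67] [1345, 1367, 238, 308] [move 14 [308], move 14 [18, 1138, 308], move 14
     [1156, 1246, 78, 1378], move 14 [1178, 1268, 308]] None,
   entry [1123, 23, 45, 1145] [78, 67, 1167, 218] [move 14 [1268, 1378, 67, 1245]] (Some ([12, 34,
     56, -278], [1135, 1234, 1126])),
   entry [1123, 12, 23, 45] [78, 67, 306] [move 15 [68, 307]] None,
   entry [1123, 12, 34, 45] [78, 67, 1345, 306] [move 16 [68, 307], move 21 [26, 15, 1256, 307,
     1234], move 17 [24, 13, 1124, 1123, 45]] None,
   entry [1123, 34, 56, 67] [12, 1348, 234, 228] [move 18 [24, 13, 1124, 256, 247], move 18 [34,
     24, 1234, 248, 1147, 1156, 218]] None,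
   entry [1123, 12, 23, 34] [78, 67, 56, 305] [move 19 [58, 306], move 23 [305], move 22 [1256,
     1346, 67, 1167, 1278], move 22 [36, 1125, 14, 1134, 1356, 307], move 23 [1358, 16, 1136, 237],
     Dependent 1 [-1, -1, -1, -1]] None,
   entry [1123, 23, 34, 45] [78, 67, 1167, 218] [move 20 [68, 307], move 23 [1256, 1346, 216], move
     23 [302, 212], move 23 [216], Dependent 1 [-1, -1, -2, -1]] None,
   entry [1123, 12, 45, 67, 308] [1345, 1367, 238] [move 24 [228, 17, 1236], move 24 [228, 28,
     213], move 24 [13, 1145, 23]] (Some ([45, 67, 1123, -1167, -218], [217, 307, 1267])),
   entry [1123, 12, 23, 45, 67] [308] [move 25 [308]] None,
   entry [1123, 12, 34, 45, 67] [1345, 308] [move 26 [34, 25, 23, 1178, 1568, 14, 1123], move 26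
     [35, 24, 15, 45, 1123]] None,
   entry [1123, 12, 23, 45, 1145] [78, 67, 306] [move 26 [68, 307]] (Some ([67, 1123, -1145, -1178,
     -218], [1278, 1368, 48, 305])),
   entry [1123, 12, 23, 45, 56] [78, 307] [move 27 [78, 308], move 34 [1123, 278], move 34 []] None,
   entry [1123, 12, 23, 34, 56] [78, 307] [move 28 [78, 308], move 35 [307], move 35 [67, 56, 58]]
     None,
   entry [1123, 23, 34, 45, 67] [1167, 218, 308] [move 29 [308], move 36 [308], move 29 [28, 1128,
     308], move 29 [234, 225]] None,
   entry [1123, 23, 34, 56, 67] [218, 308] [move 30 [37, 26, 15, 1467, 1458, 1678, 1123], move 37
     [308], move 37 [56, 215, 217, 218], move 30 [37, 26, 57, 46, 17, 1123, 278], move 38 [35,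
     1357, 1123, 1567, 1368, 1146], move 38 [35, 1124, 268, 1238, 1123, 1245, 1136]] None,
   entry [1123, 34, 45, 56, 67] [12, 228, 308] [move 32 [36, 1125, 1245, 1356, 1146, 308], move 39
     [308], move 39 [1136, 1145, 27, 308], move 31 [12, 218], Dependent 1 [-1, -1, -1, -1, -1]]
     None,
   entry [1123, 12, 23, 34, 45] [78, 67, 306] [move 33 [68, 307], move 41 [306], move 40 [67, 216,
     225, 234], move 41 [257, 1568], Dependent 1 [-1, -1, -2, -2, -1]] None,
   entry [1123, 23, 45, 67, 1145, 308] [1167, 218] [move 42 [1467, 1135, 268, 28, 217], move 42
     [1135, 28, 301, 68, 1128]] (Some ([23, 67, 1123, -1145, -218, -308], [1148, 305])),
   entry [1123, 12, 23, 45, 67, 308] [] [] (Some ([12, 45, 67, 1123, -218, -308], [1345, 1367,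
     308])),
   entry [1123, 12, 23, 45, 67, 1145] [308] [move 43 [308]] (Some ([23, 45, 67, 78, 1123, 218],
     [28, 17, 1128, 1368])),
   entry [1123, 12, 23, 45, 56, 78] [] [] None,
   entry [1123, 12, 23, 34, 56, 78] [] [] None,
   entry [1123, 23, 34, 45, 67, 308] [1167, 218] [move 44 [13, 1245, 37, 1126, 23], move 44 [46,
     35, 1124, 37, 23]] (Some ([23, 34, 45, -1145, -218, -308], [308, 17, 268])),
   entry [1123, 12, 23, 45, 56, 67] [308] [move 45 [308]] None,
   entry [1123, 12, 34, 45, 56, 67] [308] [move 46 [34, 24, 308, 15, 1145, 46, 1123, 1456], move 54
     [27, 16, 23, 1167, 258, 248, 238], move 54 [14, 1134, 36, 1125, 1356]] None,
   entry [1123, 12, 23, 34, 1567, 308] [67, 56] [move 46 [67, 56]] (Some ([23, 45, 56, 67, 78,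
     218], [228, 1467, 247, 236, 34, 278])),
   entry [1123, 12, 23, 34, 45, 67] [308] [move 47 [308], move 55 [308], move 55 [78, 67]] None,
   entry [1123, 12, 23, 45, 56, 1456] [78, 307] [move 48 [78, 308]] (Some ([12, 23, 45, 56, 1123,
     -278], [1123, 278])),
   entry [1123, 12, 23, 34, 56, 67] [308] [move 49 [27, 16, 1128, 303, 47, 306, 45, 304, 238], move
     56 [308], move 56 [68, 56, 78]] None,
   entry [1123, 23, 34, 45, 67, 78] [] [move 57 [35, 1678, 257, 1137, 1247, 303], move 57 [235,
     215, 34, 12, 1123], move 57 [45, 35, 1678, 25, 15], move 57 [23, 224, 1368, 27, 1237, 34,
     1124, 12], move 57 [34, 24, 1123, 78, 218, 1234, 1578, 1678], move 57 [305, 14, 1134, 234, 34,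
     1124, 212]] None,
   entry [1123, 23, 34, 56, 67, 78] [] [] None,
   entry [1123, 45, 78, 1347, 1678, 1456] [12, 236] [move 50 [26, 301, 1178, 56, 45, 1356], move 50
     [1125, 25, 1146, 278]] (Some ([34, 45, 67, 78, -1145, -1178], [223, 1346, 34, 301])),
   entry [1123, 34, 45, 56, 67, 78] [12] [move 59 [1456, 1357, 1258, 215], move 58 [12, 302, 212],
     Dependent 1 [-1, -1, -1, -1, -1, -1], move 51 [12], move 58 [56, 45, 1137, 1156, 1128, 48,
     1148], move 59 [68, 268, 1128, 226, 1168]] None,
   entry [1123, 23, 34, 45, 56, 67] [218, 308] [move 52 [26, 15, 1346, 37, 267, 245], move 60
     [308], move 52 [26, 15, 46, 1456, 37, 1467, 1123], Dependent 1 [-1, -1, -2, -2, -2, -1]] None,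
   entry [1123, 12, 23, 34, 45, 56] [78, 307] [move 53 [78, 308], move 61 [307], move 61 [216, 225,
     234], Dependent 1 [-2, -1, -2, -3, -2, -1]] None,
   entry [12, 34, 56, 1347, 1127, 1567, 278] [308] [move 62 [308]] (Some ([23, 67, 1123, -1145,
     -1167, -308, 218], [1456, 1137, 1357, 1348, 307])),
   entry [1123, 12, 23, 45, 67, 1145, 308] [] [] (Some ([12, 23, 45, 67, 1123, -218, -308], [58,
     304, 45])),
   entry [1123, 23, 45, 56, 67, 1145, 308] [218] [move 63 [1135, 1126, 1234, 278, 1567]] (Some
     ([23, 45, 56, 67, 1123, -1167, 218], [12, 238, 28, 1128])),
   entry [1123, 12, 23, 45, 56, 67, 308] [] [] (Some ([12, 45, 56, 67, 1123, -218, -308], [38, 212,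
     1123])),
   entry [1123, 12, 23, 34, 56, 1567, 308] [] [] (Some ([12, 23, 34, 56, 1123, -278, -308], [68,
     305, 56])),
   entry [1123, 12, 23, 34, 45, 67, 308] [] [] (Some ([12, 23, 34, 45, 67, 1123, -308], [308])),
   entry [1123, 12, 23, 45, 56, 78, 1456] [] [move 69 [1357, 216, 1178, 1345, 238, 1246], move 69
     [1147, 58, 13, 68, 1256]] (Some ([12, 23, 45, 56, 78, 1123, -278], [1123, 278])),
   entry [1123, 12, 23, 45, 56, 67, 78] [] [] None,
   entry [1123, 12, 23, 56, 67, 78, 234] [304] [move 64 [48, 308, 248, 1567]] (Some ([12, 23, 67,
     78, 1123, -1345, -308], [67, 57, 78, 308])),
   entry [1123, 12, 34, 45, 56, 67, 78] [] [] None,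
   entry [1123, 12, 23, 45, 56, 67, 1145] [308] [move 65 [308]] (Some ([34, 45, 56, 67, 1123,
     -1167, -218], [24, 13, 1124, 248])),
   entry [1123, 12, 23, 34, 45, 56, 78] [] [move 70 [1578, 256], move 70 [1578, 256, 78, 68]] None,
   entry [1123, 12, 23, 34, 56, 67, 1567] [308] [move 66 [308]] (Some ([12, 23, 34, 78, 1123, -278,
     -308], [68, 307, 305])),
   entry [1123, 12, 23, 34, 45, 67, 78] [] [move 71 [78, 68, 35, 1678, 15, 1135, 1248, 1245], move
     71 [35, 1678, 1135, 1245, 1124]] None,
   entry [1123, 12, 23, 34, 56, 67, 78] [] [move 72 [58, 258, 1567, 308], move 72 [57, 1567, 67,
     258]] None,
   entry [12, 23, 34, 56, 67, 78, 234] [] [move 74 [1234, 301], move 74 []] (Some ([23, 34, 67, 78,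
     1123, -1145, 218], [1245, 1357, 37, 1568])),
   entry [12, 23, 34, 45, 56, 67, 78] [] [move 73 [58, 306, 1568, 307, 278, 308], Dependent 1 [-1,
     -1, -1, -1, -1, -1, -1], move 73 [1158, 1167, 34, 23, 1134, 234]] None,
   entry [12, 23, 34, 45, 56, 67, 278] [308] [move 67 [48, 248, 301, 1234], Dependent 1 [-1, -1,
     -1, -1, -1, -1, -1]] (Some ([23, 34, 78, 1123, -1345, -308, 218], [1456, 1357, 1238, 213, 35,
     1458])),
   entry [1123, 23, 34, 45, 56, 67, 78] [] [move 75 [47, 36, 1345, 1258, 215, 1567], Dependent 1
     [-1, -1, -2, -2, -2, -2, -1], move 75 [56, 45, 1137, 1156, 48, 1148, 28, 301]] None,
   entry [1123, 12, 23, 34, 45, 56, 67] [308] [move 68 [308], move 76 [308], Dependent 1 [-2, -2,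
     -3, -4, -3, -2, -1]] None,
   entry [12, 34, 56, 1347, 1127, 1567, 278, 308] [] [] (Some ([23, 45, 67, 1123, -1145, -1167,
     -308, 218], [308, 17, 1467, 24, 34])),
   entry [12, 23, 34, 56, 1127, 1567, 278, 308] [] [] (Some ([23, 34, 45, 67, -1145, -1167, -218,
     -308], [68, 1568, 235, 1245, 303])),
   entry [12, 23, 34, 56, 67, 1567, 278, 308] [] [] (Some ([23, 34, 56, 67, 1123, -1167, -308,
     218], [308, 1267, 1357, 47, 1456])),
   entry [1123, 12, 23, 45, 56, 67, 1145, 308] [] [] (Some ([23, 34, 45, 67, 1123, -1345, -308,
     218], [308, 13, 1245, 1126, 37])),
   entry [1123, 12, 23, 34, 56, 67, 1567, 308] [] [] (Some ([12, 23, 34, 56, 78, 1123, -278, -308],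
     [68, 57, 307])),
   entry [1123, 12, 23, 56, 67, 78, 1145, 234] [] [] (Some ([12, 23, 34, 45, 56, 67, -218, -308],
     [217, 36, 25, 14, 256, 304])),
   entry [1123, 12, 23, 34, 45, 56, 67, 308] [] [] (Some ([12, 23, 34, 45, 56, 67, 1123, -308],
     [308])),
   entry [1123, 1345, 1165, 1285, 1673, 1274, 1684, 1178] [] [] (Some ([12, 23, 45, 56, 78, 1123,
     -278, -308], [1267, 1146, 48, 37, 302, 1235, 1468, 226])),
   entry [1123, 12, 23, 34, 45, 67, 78, 1678] [] [] (Some ([12, 23, 34, 45, 56, 78, 1123, -308],
     [1578, 256])),
   entry [1123, 12, 23, 34, 56, 67, 78, 234] [] [] (Some ([12, 23, 34, 67, 78, 1123, -1345, -308],
     [78, 68, 308, 305])),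
   entry [12, 23, 34, 45, 67, 78, 1678, 278] [] [] (Some ([12, 23, 34, 56, 67, 78, 1123, -308],
     [1678, 308, 258, 305])),
   entry [1123, 12, 23, 34, 56, 67, 78, 1567] [] [] (Some ([12, 23, 34, 45, 56, 67, 78, -308], [78,
     67, 56, 306, 256, 278])),
   entry [12, 23, 34, 56, 67, 78, 234, 278] [] [] (Some ([34, 45, 67, 78, 1123, -1145, -308, 218],
     [1456, 1357, 15, 1128, 1567, 308])),
   entry [12, 23, 34, 45, 56, 67, 78, 278] [] [] (Some ([23, 34, 45, 67, 78, -1345, -308, 218],
     [78, 68, 58, 1358, 13, 1245, 38, 308])),
   entry [1123, 12, 23, 34, 45, 56, 67, 78] [] [] None]"

definition valid_word :: "nat \<Rightarrow> c1_symbol list \<Rightarrow> bool" where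
  "valid_word r ws \<longleftrightarrow> list_all (\<lambda>s. valid_symbol s \<and> is_root r (coords s)) ws"

fun extension_ok :: "nat \<Rightarrow> c1_symbol list list \<Rightarrow> int list list \<Rightarrow> int list \<Rightarrow> extension \<Rightarrow> bool" where
  "extension_ok r ls B x (Dependent k cs) \<longleftrightarrow>
     k \<noteq> 0 \<and> length cs = length B \<and> map ((*) k) x = combination cs B"
| "extension_ok r ls B x (Conjugate j ws) \<longleftrightarrow>
     valid_word r ws \<and> j < length ls \<and> length (ls ! j) = Suc (length B) \<and>
     contained (reflect_word (map coords ws) (x # B)) (map coords (ls ! j))"

fun extensions_ok :: "nat \<Rightarrow> c1_symbol list list \<Rightarrow> int list list \<Rightarrow> int list list \<Rightarrow> extension list \<Rightarrow> bool" where
  "extensions_ok r ls B [] [] \<longleftrightarrow> True"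
| "extensions_ok r ls B (x # xs) (e # es) \<longleftrightarrow> extension_ok r ls B x e \<and> extensions_ok r ls B xs es"
| "extensions_ok r ls B _ _ \<longleftrightarrow> False"

definition z0_list :: "c1_elem list" where
  "z0_list = map Pos [L0 1 2, L0 2 3, L0 3 4, L0 4 5, L0 5 6, L0 6 7, L0 7 8, L1 1 2 3, L2 1 8] @
     map Neg [L1 1 4 5, L1 3 4 5, L1 1 6 7, L1 1 7 8, L2 7 8, L2 1 8, L3 8]"

definition z2_list :: "c1_symbol list" where
  "z2_list = [L1 1 2 3, L0 1 2, L0 2 3, L0 3 4, L0 4 5, L0 5 6, L0 6 7, L0 7 8,
     L1 1 4 5, L1 3 4 7, L1 6 7 8, L1 1 2 7, L1 4 5 6, L1 5 6 7, L2 3 4, L2 7 8, L3 8]"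

definition z3_list :: "c1_symbol list" where
  "z3_list = [L1 1 2 3, L1 3 4 5, L1 1 6 5, L1 2 8 5, L1 6 7 3, L1 2 7 4, L1 6 8 4, L1 1 7 8]"

definition root_symbols :: "nat \<Rightarrow> c1_symbol list \<Rightarrow> bool" where
  "root_symbols r ss \<longleftrightarrow> list_all (\<lambda>s. valid_symbol s \<and> is_root r (coords s) \<and> 0 < hgt (coords s)) ss"

fun original_ok :: "nat \<Rightarrow> c1_symbol list \<Rightarrow> (c1_elem list \<times> c1_symbol list) option \<Rightarrow> bool" where
  "original_ok r l None \<longleftrightarrow> contained (map Pos l) z0_list"
| "original_ok r l (Some (es, ws)) \<longleftrightarrow>
     contained es z0_list \<and> valid_word r ws \<and> length es = length l \<and> distinct (map elem_coords es) \<and>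
     list_all (\<lambda>e. is_root r (elem_coords e)) es \<and>
     contained (reflect_word (map coords ws) (map elem_coords es)) (map coords l)"

definition orthogonal_lists :: "int list list \<Rightarrow> int list list \<Rightarrow> bool" where
  "orthogonal_lists A B \<longleftrightarrow> list_all (\<lambda>a. list_all (\<lambda>b. ipl a b = 0) B) A"

text \<open>
  An entry with \<open>r\<close> elements needs no extension, since the rank is exhausted.
\<close>

definition node_ok :: "nat \<Rightarrow> int list list \<Rightarrow> c1_symbol list list \<Rightarrow> node \<Rightarrow> bool" where
  "node_ok r R ls n \<longleftrightarrow>
     root_symbols r (node_label n) \<and> root_symbols r (chamber n) \<and>
     distinct (map coords (node_label n)) \<and> obtuse_list (map coords (node_label n)) \<and>
     orthogonal_lists (map coords (chamber n)) (map coords (node_label n)) \<and>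
     (contained (node_label n) z2_list \<or> contained (node_label n) z3_list) \<and>
     original_ok r (node_label n) (original n) \<and>
     extensions_ok r ls (map coords (node_label n))
       (if length (node_label n) < r then required R (map coords (node_label n)) (map coords (chamber n)) else [])
       (extensions n)"

definition nodes :: "nat \<Rightarrow> node list" where
  "nodes r = (if r = 2 then nodes2 else if r = 3 then nodes3 else if r = 4 then nodes4
     else if r = 5 then nodes5 else if r = 6 then nodes6 else if r = 7 then nodes7 else nodes8)"

text \<open>
  In rank 7 three pairs of types are told apart only by \<^term>\<open>K_of\<close>.  For them a list of
  pairwise orthogonal vectors is given that spans the complement of the simple set.
\<close>

definition complements :: "(c1_symbol list \<times> int list list) list" where
  "complements =
   [([L1 1 2 3, L0 1 2, L0 4 5, L0 6 7],
       [[-2, 1, 1, 0, 1, 1, 1, 1, 0], [-1, 0, 0, 1, 0, 0, 1, 1, 0], [-1, 0, 0, 1, 1, 1, 0, 0, 0]]),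
    ([L1 1 2 3, L0 2 3, L0 4 5, L1 1 4 5],
       [[-2, 0, 1, 1, 1, 1, 1, 1, 0], [-1, 1, 0, 0, 0, 0, 1, 1, 0], [0, 0, 0, 0, 0, 0, -1, 1, 0]]),
    ([L1 1 2 3, L0 1 2, L0 3 4, L0 4 5, L0 6 7],
       [[-1, 0, 0, 1, 1, 1, 0, 0, 0], [-3, 1, 1, 1, 1, 1, 2, 2, 0]]),
    ([L1 1 2 3, L0 1 2, L0 2 3, L0 4 5, L1 1 4 5],
       [[0, 0, 0, 0, 0, 0, -1, 1, 0], [-3, 1, 1, 1, 1, 1, 2, 2, 0]]),
    ([L1 1 2 3, L0 1 2, L0 3 4, L0 4 5, L0 5 6, L0 6 7],
       [[-4, 1, 1, 2, 2, 2, 2, 2, 0]]),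
    ([L1 1 2 3, L0 1 2, L0 2 3, L0 4 5, L0 5 6, L1 1 4 5],
       [[-3, 1, 1, 1, 1, 1, 1, 3, 0]])]"

fun pairwise_orthogonal :: "int list list \<Rightarrow> bool" where
  "pairwise_orthogonal [] \<longleftrightarrow> True"
| "pairwise_orthogonal (x # xs) \<longleftrightarrow> list_all (\<lambda>y. ipl x y = 0) xs \<and> pairwise_orthogonal xs"

definition complement_ok :: "nat \<Rightarrow> int list list \<Rightarrow> int list list \<Rightarrow> bool" where
  "complement_ok r B N \<longleftrightarrow> length B + length N = r \<and> pairwise_orthogonal N \<and> orthogonal_lists B N \<and>
     list_all (\<lambda>x. length x = 9 \<and> tail_zero r x \<and> ipl x (canon_list r) = 0 \<and> ipl x x \<noteq> 0) N"

text \<open>The value 0 stands for a count that is not computed.\<close>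

definition K_count :: "nat \<Rightarrow> int list list \<Rightarrow> c1_symbol list \<Rightarrow> nat" where
  "K_count r R l = (case map_of complements l of None \<Rightarrow> 0
     | Some N \<Rightarrow> if complement_ok r (map coords l) N then length (fold orth_with N R) else 0)"

definition invariants :: "nat \<Rightarrow> int list list \<Rightarrow> c1_symbol list \<Rightarrow> int list \<times> nat \<times> nat" where
  "invariants r R l = (map (\<lambda>k. sum_list (walk_list (gram (map coords l)) k)) [0, 1, 2, 3, 4],
     length (fold orth_with (map coords l) R), K_count r R l)"

fun all_invariants :: "nat \<Rightarrow> int list list \<Rightarrow> c1_symbol list list \<Rightarrow> (int list \<times> nat \<times> nat) list" where
  "all_invariants r R [] = []"
| "all_invariants r R (l # ls) = invariants r R l # all_invariants r R ls"

text \<open>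
  Entries that agree in the walk sums and in the size of \<^term>\<open>C_of\<close> must both have a computed
  count of \<^term>\<open>K_of\<close>, and these counts must differ.
\<close>

fun separated :: "(int list \<times> nat \<times> nat) list \<Rightarrow> bool" where
  "separated [] \<longleftrightarrow> True"
| "separated (x # xs) \<longleftrightarrow>
     list_all (\<lambda>y. fst x = fst y \<and> fst (snd x) = fst (snd y) \<longrightarrow>
       snd (snd x) \<noteq> 0 \<and> snd (snd y) \<noteq> 0 \<and> snd (snd x) \<noteq> snd (snd y)) xs \<and> separated xs"

definition labels :: "nat \<Rightarrow> c1_symbol list list" where
  "labels r = map node_label (nodes r)"

definition table_ok :: "nat \<Rightarrow> bool" where
  "table_ok r \<longleftrightarrow> list_all (node_ok r (rts r) (labels r)) (nodes r) \<and> list_ex ((=) []) (labels r)"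

definition table_separated :: "nat \<Rightarrow> bool" where
  "table_separated r \<longleftrightarrow> separated (all_invariants r (rts r) (labels r))"

section \<open>Correctness of the computations\<close>

lemma length_coords [simp]: "length (coords s) = 9"
  by (cases s) auto

lemma length_elem_coords [simp]: "length (elem_coords e) = 9"
  by (cases e) auto

lemma valid_symbol_iff: "valid_symbol s \<longleftrightarrow> wf_symbol s"
  by (cases s) auto

lemma sum_Q_nth:
  assumes "A \<subseteq> {1..8}" "j \<le> 8"
  shows "(\<Sum>i\<in>A. Q i) $ of_nat j = (if j \<in> A then 1 else 0)"
proof -
  have "(\<Sum>i\<in>A. Q i $ of_nat j) = (\<Sum>i\<in>A. if i = j then 1 else 0 :: real)"
    using assms by (intro sum.cong) (auto simp: Q_nth subset_eq)
  moreover have "finite A" using assms(1) finite_subset by blast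
  ultimately show ?thesis by simp
qed

lemma ivec_coords:
  assumes "valid_symbol s" shows "ivec (coords s) = phi_symbol s"
proof (rule ivec_eqI[symmetric])
  fix j :: nat assume j: "j \<le> 8"
  show "phi_symbol s $ of_nat j = of_int (coords s ! j)"
  proof (cases s)
    case (L0 a b)
    have "coords s ! j = (if j = a then 1 else if j = b then - 1 else 0)"
      unfolding L0 coords.simps using j by (subst nth_map) auto
    then show ?thesis using assms j L0 Q_nth[of a j] Q_nth[of b j] by auto
  next
    case (L1 a b c)
    have "coords s ! j = (if j = 0 then 1 else if j = a \<or> j = b \<or> j = c then - 1 else 0)"
      unfolding L1 coords.simps using j by (cases j) (auto simp del: upt_Suc)
    then show ?thesis using assms j L1 Q_nth[of a j] Q_nth[of b j] Q_nth[of c j] H_nth[OF j] by auto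
  next
    case (L2 a b)
    have "coords s ! j = (if j = 0 then 2 else if j = a \<or> j = b then 0 else - 1)"
      unfolding L2 coords.simps using j by (cases j) (auto simp del: upt_Suc)
    then show ?thesis using assms j L2 sum_Q_nth[of "{1..8} - {a, b}" j] H_nth[OF j] by auto
  next
    case (L3 a)
    have "coords s ! j = (if j = 0 then 3 else if j = a then - 2 else - 1)"
      unfolding L3 coords.simps using j by (cases j) (auto simp del: upt_Suc)
    then show ?thesis using assms j L3 sum_Q_nth[of "{1..8} - {a}" j] Q_nth[of a j] H_nth[OF j] by auto
  qed
qed

lemma ivec_uminus:
  assumes "length xs = 9" shows "ivec (map uminus xs) = - ivec xs"
  using assms by (simp add: vec9_eq_iff ivec_nth)

lemma ivec_elem_coords: "valid_symbol (symbol_of e) \<Longrightarrow> ivec (elem_coords e) = phi e"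
  by (cases e) (simp_all add: ivec_coords ivec_uminus)

lemma length_axpy: "length xs = length ys \<Longrightarrow> length (axpy c xs ys) = length ys"
  by (induction xs ys rule: list_induct2) auto

lemma axpy_nth: "length xs = length ys \<Longrightarrow> i < length ys \<Longrightarrow> axpy c xs ys ! i = c * xs ! i + ys ! i"
  by (induction xs ys arbitrary: i rule: list_induct2) (auto simp: nth_Cons split: nat.split)

lemma ivec_axpy:
  assumes "length xs = 9" "length ys = 9"
  shows "ivec (axpy c xs ys) = of_int c *\<^sub>R ivec xs + ivec ys"
  using assms by (simp add: vec9_eq_iff ivec_nth axpy_nth)

lemma ivec_reflect_list:
  assumes "is_root r a" "length v = 9"
  shows "ivec (reflect_list a v) = reflect (ivec a) (ivec v)" "length (reflect_list a v) = 9"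
proof -
  have a: "length a = 9" "ipl a a = - 2" using assms by (auto simp: is_root_def)
  then show "length (reflect_list a v) = 9" using assms by (simp add: reflect_list_def length_axpy)
  have "ip (ivec a) (ivec a) = - 2" using a by (simp add: ip_ivec)
  then show "ivec (reflect_list a v) = reflect (ivec a) (ivec v)"
    using a assms(2) by (simp add: reflect_list_def ivec_axpy reflect_eq ip_ivec add.commute)
qed

lemma reflect_word_weyl:
  assumes "r \<le> 8" "list_all (is_root r) as"
  shows "\<exists>w\<in>W r. \<forall>vs. (\<forall>v\<in>set vs. length v = 9) \<longrightarrow>
    map ivec (reflect_word as vs) = map (\<lambda>v. w (ivec v)) vs \<and> (\<forall>v\<in>set (reflect_word as vs). length v = 9)"
  using assms(2)
proof (induction as)
  case Nil
  show ?case by (intro bexI[of _ id]) (auto intro: weyl_id)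
next
  case (Cons a as)
  then obtain w where w: "w \<in> W r" "\<And>vs. \<forall>v\<in>set vs. length v = 9 \<Longrightarrow>
    map ivec (reflect_word as vs) = map (\<lambda>v. w (ivec v)) vs \<and> (\<forall>v\<in>set (reflect_word as vs). length v = 9)"
    by auto
  have a: "is_root r a" using Cons by simp
  then have "ivec a \<in> Rt r" using assms(1) by (auto simp: Rt_eq_ivec_image)
  then have "w \<circ> reflect (ivec a) \<in> W r" using w weyl_comp weyl_reflect by blast
  moreover have "map ivec (reflect_word (a # as) vs) = map (\<lambda>v. (w \<circ> reflect (ivec a)) (ivec v)) vs \<and>
      (\<forall>v\<in>set (reflect_word (a # as) vs). length v = 9)" if vs: "\<forall>v\<in>set vs. length v = 9" for vs
    using w(2)[of "map (reflect_list a) vs"] vs ivec_reflect_list[OF a] by auto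
  ultimately show ?case by blast
qed

lemma combination_span:
  assumes "\<forall>b\<in>set bs. length b = 9" "length cs = length bs"
  shows "ivec (combination cs bs) \<in> span (ivec ` set bs) \<and> length (combination cs bs) = 9"
  using assms(2,1)
proof (induction cs bs rule: list_induct2)
  case Nil
  have "ivec [0, 0, 0, 0, 0, 0, 0, 0, 0] = 0"
  proof (rule ivec_eqI[symmetric])
    fix i :: nat assume "i \<le> 8"
    then have "[0, 0, 0, 0, 0, 0, 0, 0, 0 :: int] ! i \<in> set [0, 0, 0, 0, 0, 0, 0, 0, 0]"
      by (intro nth_mem) simp
    then show "(0 :: vec9) $ of_nat i = of_int ([0, 0, 0, 0, 0, 0, 0, 0, 0] ! i)" by simp
  qed
  then show ?case by (simp add: span_zero)
next
  case (Cons c cs b bs)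
  then have "ivec (combination cs bs) \<in> span (ivec ` set (b # bs))"
    using span_mono[of "ivec ` set bs" "ivec ` set (b # bs)"] by auto
  then show ?case
    using Cons by (auto simp: ivec_axpy length_axpy intro!: span_add span_scale intro: span_base)
qed

lemma ivec_scale: "length xs = 9 \<Longrightarrow> ivec (map ((*) k) xs) = of_int k *\<^sub>R ivec xs"
  by (simp add: vec9_eq_iff ivec_nth)

subsection \<open>Walk counts\<close>

fun walk_at :: "int list list \<Rightarrow> nat \<Rightarrow> int list \<Rightarrow> int" where
  "walk_at B 0 b = 1"
| "walk_at B (Suc k) b = (\<Sum>c\<leftarrow>B. ipl b c * walk_at B k c) + 2 * walk_at B k b"

lemma dot_map: "dot (map f xs) (map g xs) = (\<Sum>x\<leftarrow>xs. f x * g x)"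
  by (induction xs) auto

lemma next_walks_map:
  "next_walks (map f xs) w (map g xs) = map (\<lambda>x. dot (f x) w + 2 * g x) xs"
  by (induction xs) auto

lemma walk_list_eq: "walk_list (gram B) k = map (walk_at B k) B"
  by (induction k) (simp_all add: gram_def extend_walks_def next_walks_map dot_map)

lemma inj_on_ivec: "\<forall>b\<in>A. length b = 9 \<Longrightarrow> inj_on ivec A"
  by (auto simp: inj_on_def ivec_inject)

lemma walk_at_eq_walks:
  assumes "distinct B" "\<forall>b\<in>set B. length b = 9" "b \<in> set B"
  shows "real_of_int (walk_at B k b) = walks (ivec ` set B) k (ivec b)"
  using assms(3)
proof (induction k arbitrary: b)
  case (Suc k)
  have "real_of_int (\<Sum>c\<leftarrow>B. ipl b c * walk_at B k c) = (\<Sum>c\<in>set B. real_of_int (ipl b c * walk_at B k c))"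
    using assms(1) by (simp add: sum_list_distinct_conv_sum_set)
  also have "\<dots> = (\<Sum>c\<in>set B. ip (ivec b) (ivec c) * walks (ivec ` set B) k (ivec c))"
    using Suc assms(2) by (intro sum.cong) (auto simp: ip_ivec)
  also have "\<dots> = (\<Sum>u\<in>ivec ` set B. ip (ivec b) u * walks (ivec ` set B) k u)"
    using inj_on_ivec[OF assms(2)] by (simp add: sum.reindex)
  finally show ?case using Suc by simp
qed simp

lemma walk_list_sum:
  assumes "distinct B" "\<forall>b\<in>set B. length b = 9"
  shows "real_of_int (sum_list (walk_list (gram B) k)) = walk_sum (ivec ` set B) k"
proof -
  have "real_of_int (sum_list (walk_list (gram B) k)) = (\<Sum>b\<in>set B. real_of_int (walk_at B k b))"
    using assms(1) by (simp add: walk_list_eq sum_list_distinct_conv_sum_set)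
  also have "\<dots> = (\<Sum>b\<in>set B. walks (ivec ` set B) k (ivec b))"
    using assms by (intro sum.cong) (auto simp: walk_at_eq_walks)
  also have "\<dots> = walk_sum (ivec ` set B) k"
    using inj_on_ivec[OF assms(2)] by (simp add: walk_sum_def sum.reindex)
  finally show ?thesis .
qed

lemma hd_minimal_iff:
  assumes "distinct (x # B)" "\<forall>b\<in>set (x # B). length b = 9"
  shows "hd_minimal (walk_list (gram (x # B)) k) \<longleftrightarrow>
    (\<forall>y\<in>ivec ` set (x # B). walks (ivec ` set (x # B)) k (ivec x) \<le> walks (ivec ` set (x # B)) k y)"
proof -
  have "hd_minimal (walk_list (gram (x # B)) k) \<longleftrightarrow>
    (\<forall>b\<in>set (x # B). walk_at (x # B) k x \<le> walk_at (x # B) k b)"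
    unfolding hd_minimal_def walk_list_eq list_all_iff by simp
  also have "\<dots> \<longleftrightarrow> (\<forall>b\<in>set (x # B). real_of_int (walk_at (x # B) k x) \<le> real_of_int (walk_at (x # B) k b))"
    by (simp only: of_int_le_iff)
  also have "\<dots> \<longleftrightarrow> (\<forall>b\<in>set (x # B). walks (ivec ` set (x # B)) k (ivec x) \<le> walks (ivec ` set (x # B)) k (ivec b))"
    using walk_at_eq_walks[OF assms] by (intro ball_cong refl) (simp only: list.set_intros)
  finally show ?thesis by (simp only: ball_simps)
qed

subsection \<open>Filters and tests\<close>

lemma keep_eq: "keep P x xs = (if P then x # xs else xs)"
  by (cases P) auto

lemma nonneg_with_eq: "nonneg_with b R = filter (\<lambda>x. 0 \<le> ipl x b) R"
  by (induction R) (auto simp: keep_eq)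

lemma orth_with_eq: "orth_with b R = filter (\<lambda>x. ipl x b = 0) R"
  by (induction R) (auto simp: keep_eq)

lemma set_fold_nonneg: "set (fold nonneg_with A R) = {x \<in> set R. \<forall>a\<in>set A. 0 \<le> ipl x a}"
  by (induction A arbitrary: R) (auto simp: nonneg_with_eq)

lemma fold_orth_with:
  "set (fold orth_with A R) = {x \<in> set R. \<forall>a\<in>set A. ipl x a = 0}"
  "distinct R \<Longrightarrow> distinct (fold orth_with A R)"
  by (induction A arbitrary: R) (auto simp: orth_with_eq)

lemma walk_minimal_eq: "walk_minimal B R = filter (\<lambda>x. hd_minimal (walk_list (gram (x # B)) 3)) R"
  by (induction R) (auto simp: keep_eq)

lemma set_required:
  "set (required R B A) = {x \<in> set R. (\<forall>b\<in>set B. 0 \<le> ipl x b) \<and> (\<forall>a\<in>set A. 0 \<le> ipl x a) \<and>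
     hd_minimal (walk_list (gram (x # B)) 3)}"
  unfolding required_def walk_minimal_eq set_filter set_fold_nonneg by auto

lemma ipl_commute: "length x = 9 \<Longrightarrow> length y = 9 \<Longrightarrow> ipl x y = ipl y x"
  using ip_ivec[of x y] ip_ivec[of y x] ip_commute[of "ivec x"] by simp

lemma obtuse_list_imp:
  assumes "obtuse_list B" "\<forall>b\<in>set B. length b = 9"
  shows "obtuse (ivec ` set B)"
proof -
  have "0 \<le> ipl x y" if "x \<in> set B" "y \<in> set B" "x \<noteq> y" for x y
    using assms that
  proof (induction B)
    case (Cons b B)
    then consider "x = b" "y \<in> set B" | "y = b" "x \<in> set B" | "x \<in> set B" "y \<in> set B" by auto
    then show ?case
    proof cases
      case 2
      then have "0 \<le> ipl b x" using Cons.prems by (simp add: list_all_iff)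
      then show ?thesis using 2 Cons.prems ipl_commute[of x b] by simp
    qed (use Cons in \<open>auto simp: list_all_iff\<close>)
  qed simp
  then show ?thesis using assms(2) by (auto simp: obtuse_def ip_ivec)
qed

lemma extensions_ok_mem:
  assumes "extensions_ok r ls B xs es" "x \<in> set xs"
  shows "\<exists>e. extension_ok r ls B x e"
  using assms by (induction r ls B xs es rule: extensions_ok.induct) auto

lemma contained_iff: "contained xs ys \<longleftrightarrow> set xs \<subseteq> set ys"
  by (auto simp: contained_def list_all_iff list_ex_iff)

section \<open>Evaluation of the table\<close>

lemma table_ok_2: "table_ok 2" by code_simp
lemma table_ok_3: "table_ok 3" by code_simp
lemma table_ok_4: "table_ok 4" by code_simp
lemma table_ok_5: "table_ok 5" by code_simp
lemma table_ok_6: "table_ok 6" by code_simp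
lemma table_ok_7: "table_ok 7" by code_simp
lemma table_ok_8: "table_ok 8" by code_simp

lemma table_separated_2: "table_separated 2" by code_simp
lemma table_separated_3: "table_separated 3" by code_simp
lemma table_separated_4: "table_separated 4" by code_simp
lemma table_separated_5: "table_separated 5" by code_simp
lemma table_separated_6: "table_separated 6" by code_simp
lemma table_separated_7: "table_separated 7" by code_simp
lemma table_separated_8: "table_separated 8" by code_simp

lemma table_checked:
  assumes "r \<in> {2..8}" shows "table_ok r" "table_separated r"
proof -
  have "r \<in> {2, 3, 4, 5, 6, 7, 8}" using assms by auto
  then show "table_ok r" "table_separated r"
    using table_ok_2 table_ok_3 table_ok_4 table_ok_5 table_ok_6 table_ok_7 table_ok_8
      table_separated_2 table_separated_3 table_separated_4 table_separated_5 table_separated_6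
      table_separated_7 table_separated_8 by auto
qed

lemma symbols_roots:
  "list_all (\<lambda>e. valid_symbol (symbol_of e) \<and> is_root 8 (elem_coords e)) (z0_list @ map Pos (z2_list @ z3_list))"
  by code_simp

lemma orthogonal_counts_3:
  "length (fold orth_with [coords (L1 1 2 3)] (rts 3)) = 6"
  "length (fold orth_with [coords (L0 2 3)] (rts 3)) = 2"
  by code_simp+

section \<open>Classification of simple sets\<close>

definition label_set :: "c1_symbol list \<Rightarrow> vec9 set" where
  "label_set l = ivec ` set (map coords l)"

lemma root_symbolsD:
  assumes "root_symbols r l" "r \<le> 8"
  shows "label_set l \<subseteq> Rt r" "\<And>b. b \<in> label_set l \<Longrightarrow> height b > 0"
    "\<And>s. s \<in> set l \<Longrightarrow> valid_symbol s" "\<And>s. s \<in> set l \<Longrightarrow> is_root r (coords s)"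
  using assms by (auto simp: root_symbols_def list_all_iff label_set_def Rt_eq_ivec_image height_ivec)

lemma node_simple_set:
  assumes r: "r \<in> {2..8}" and n: "n \<in> set (nodes r)"
  shows "simple_set r (label_set (node_label n))"
    "card (label_set (node_label n)) = length (node_label n)"
proof -
  have r8: "r \<le> 8" using r by auto
  define l where "l = node_label n"
  have ok: "root_symbols r l" "distinct (map coords l)" "obtuse_list (map coords l)"
    using table_checked(1)[OF r] n by (auto simp: table_ok_def list_all_iff node_ok_def l_def)
  have fin: "finite (label_set l)" by (simp add: label_set_def)
  have obt: "obtuse (label_set l)" unfolding label_set_def using ok by (intro obtuse_list_imp) auto
  have sub: "label_set l \<subseteq> canon_perp" using root_symbolsD[OF ok(1) r8] Rt_canon_perp[OF r8] by auto
  have "independent (label_set l)"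
    using root_symbolsD(2)[OF ok(1) r8] by (intro obtuse_positive_independent[OF fin sub obt linear_height])
  then show "simple_set r (label_set (node_label n))"
    using obt root_symbolsD(1)[OF ok(1) r8] by (simp add: simple_set_def l_def)
  have "card (label_set l) = card (set (map coords l))"
    unfolding label_set_def by (intro card_image inj_on_ivec) auto
  also have "\<dots> = length (map coords l)" using ok(2) by (rule distinct_card)
  finally show "card (label_set (node_label n)) = length (node_label n)" by (simp add: l_def)
qed

lemma labels_simple_set:
  assumes "r \<in> {2..8}" "l \<in> set (labels r)"
  shows "simple_set r (label_set l)" "card (label_set l) = length l"
  using assms node_simple_set by (auto simp: labels_def)

lemma valid_wordE:
  assumes "r \<le> 8" "valid_word r ws" "\<forall>v\<in>set vs. length v = 9"
  obtains w where "w \<in> W r"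
    "ivec ` set (reflect_word (map coords ws) vs) = w ` ivec ` set vs"
proof -
  have "list_all (is_root r) (map coords ws)" using assms(2) by (auto simp: valid_word_def list_all_iff)
  from reflect_word_weyl[OF assms(1) this] obtain w where w: "w \<in> W r"
    "\<And>vs. \<forall>v\<in>set vs. length v = 9 \<Longrightarrow> map ivec (reflect_word (map coords ws) vs) = map (\<lambda>v. w (ivec v)) vs"
    by blast
  have "ivec ` set (reflect_word (map coords ws) vs) = w ` ivec ` set vs"
    using arg_cong[OF w(2)[OF assms(3)], of set] by (simp add: image_image)
  then show thesis using w(1) that by simp
qed

lemma simple_set_weyl:
  assumes "r \<le> 8" "w \<in> W r" "simple_set r B"
  shows "simple_set r (w ` B)"
proof -
  have inj: "inj w" using weyl_inj[OF assms(2) order_refl] .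
  have "independent (w ` B)"
    using assms linear_weyl inj by (intro linear_independent_injective_image) (auto simp: simple_set_def intro: inj_on_subset)
  moreover have "w ` B \<subseteq> Rt r" using weyl_image_Rt[OF assms(1,2)] assms(3) by (auto simp: simple_set_def)
  moreover have "obtuse (w ` B)"
    using assms(3) weyl_ip[OF assms(2) order_refl] by (auto simp: simple_set_def obtuse_def)
  ultimately show ?thesis by (simp add: simple_set_def)
qed

lemma weyl_root_closure:
  assumes "w \<in> weyl_group A" "A \<subseteq> Rt r"
  shows "w ` root_closure B = root_closure (w ` B)"
proof -
  have inj: "inj w" and lin: "linear w" using weyl_inj[OF assms] linear_weyl[OF assms(1)] by auto
  have sum: "(icomb (w ` B) c) = w (\<Sum>b\<in>B. of_int (c (w b)) *\<^sub>R b)" for c :: "vec9 \<Rightarrow> int"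
    using lin inj by (subst sum.reindex) (auto simp: linear_sum linear_scale intro: inj_on_subset)
  show ?thesis
  proof (intro equalityI subsetI)
    fix v assume "v \<in> w ` root_closure B"
    then obtain u where u: "v = w u" "u \<in> root_closure B" by auto
    from u(2) obtain c where c: "ip u u = - 2" "u = icomb B c"
      by (rule root_closureE)
    have "v = (\<Sum>b\<in>w ` B. of_int (c (inv w b)) *\<^sub>R b)"
      unfolding sum inv_f_f[OF inj] using u(1) c(2) by simp
    moreover have "ip v v = - 2" using u(1) c(1) weyl_ip[OF assms] by simp
    ultimately show "v \<in> root_closure (w ` B)"
      unfolding root_closure_def by (intro CollectI conjI exI[of _ "\<lambda>b. c (inv w b)"])
  next
    fix v assume "v \<in> root_closure (w ` B)"
    then obtain c where c: "ip v v = - 2" "v = icomb (w ` B) c"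
      by (rule root_closureE)
    define u where "u = (\<Sum>b\<in>B. of_int (c (w b)) *\<^sub>R b)"
    have v: "v = w u" using c(2) sum[of c] by (simp add: u_def)
    then have "ip u u = - 2" using c(1) weyl_ip[OF assms] by simp
    then have "u \<in> root_closure B"
      unfolding root_closure_def by (intro CollectI conjI exI[of _ "\<lambda>b. c (w b)"]) (simp_all only: u_def)
    then show "v \<in> w ` root_closure B" using v by simp
  qed
qed

text \<open>
  The map that carries the set without \<open>b\<close> to an entry \<open>l\<close> is followed by a product of reflections
  that fix \<open>l\<close>.  Both preserve products, so the image \<open>x\<close> of \<open>b\<close> is still obtuse to \<open>l\<close> and still
  minimal for the number of walks; hence the table has an extension for \<open>x\<close>.
\<close>

theorem classification:
  assumes r: "r \<in> {2..8}" and "simple_set r B"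
  shows "\<exists>w\<in>W r. \<exists>l\<in>set (labels r). w ` B = label_set l"
  using assms(2)
proof (induction "card B" arbitrary: B rule: less_induct)
  case less
  have r8: "r \<le> 8" using r by auto
  note B = less.prems
  have finB: "finite B" using simple_set_finite[OF r8 B] .
  show ?case
  proof (cases "B = {}")
    case True
    have "[] \<in> set (labels r)" using table_checked(1)[OF r] by (auto simp: table_ok_def list_ex_iff)
    then show ?thesis using True by (intro bexI[of _ id] bexI[of _ "[]"]) (auto simp: label_set_def intro: weyl_id)
  next
    case False
    \<comment> \<open>The choice of \<open>b\<close> matches the minimality that \<open>required\<close> imposes on \<open>x\<close>.\<close>
    define b where "b = arg_min_on (walks B 3) B"
    have b: "b \<in> B" "\<And>y. y \<in> B \<Longrightarrow> walks B 3 b \<le> walks B 3 y"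
      using arg_min_if_finite(1)[OF finB False] arg_min_least[OF finB False] by (auto simp: b_def)
    define B' where "B' = B - {b}"
    have B': "simple_set r B'" using B independent_mono[of B "B - {b}"] by (auto simp: B'_def simple_set_def obtuse_def)
    have cardB: "card B = Suc (card B')" using card_Suc_Diff1[OF finB b(1)] by (simp add: B'_def)
    then have "card B' < card B" by simp
    from less.hyps[OF this B'] obtain w l where
      w: "w \<in> W r" "l \<in> set (labels r)" "w ` B' = label_set l" by blast
    obtain n where n: "n \<in> set (nodes r)" "l = node_label n" using w(2) by (auto simp: labels_def)
    have ok: "node_ok r (rts r) (labels r) n" using table_checked(1)[OF r] n by (auto simp: table_ok_def list_all_iff)
    define A where "A = label_set (chamber n)"
    have ch: "root_symbols r (chamber n)" using ok by (simp add: node_ok_def)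
    have A: "A \<subseteq> Rt r" "\<And>a. a \<in> A \<Longrightarrow> height a > 0"
      using root_symbolsD[OF ch r8] by (auto simp: A_def)
    have orth: "ip x a = 0" if xa: "x \<in> label_set l" "a \<in> A" for x a
    proof -
      obtain s t where st: "s \<in> set (chamber n)" "t \<in> set l" "a = ivec (coords s)" "x = ivec (coords t)"
        using xa by (auto simp: A_def label_set_def)
      then have "ipl (coords s) (coords t) = 0"
        using ok n by (auto simp: node_ok_def orthogonal_lists_def list_all_iff)
      then have "ip a x = 0" using st by (simp add: ip_ivec)
      then show ?thesis by (simp add: ip_commute)
    qed
    have "w b \<in> Rt r" using weyl_image_Rt[OF r8 w(1)] b(1) B by (auto simp: simple_set_def)
    from exists_dominant[OF r8 A this] obtain u where u: "u \<in> weyl_group A" "u (w b) \<in> Rt r"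
      "\<forall>a\<in>A. ip (u (w b)) a \<ge> 0" by blast
    have uW: "u \<in> W r" using u(1) weyl_mono[OF A(1)] by auto
    define v where "v = u \<circ> w"
    have vW: "v \<in> W r" unfolding v_def using uW w(1) by (rule weyl_comp)
    have fixed: "u x = x" if "x \<in> label_set l" for x using weyl_fixes[OF u(1)] orth that by blast
    have vB': "v ` B' = label_set l"
      unfolding v_def image_comp[symmetric] w(3) using fixed by simp
    obtain x where x: "x \<in> set (rts r)" "v b = ivec x" using u(2) Rt_eq[OF r8] by (auto simp: v_def)
    have lx: "length x = 9" using x(1) set_rts[OF r8] by (auto simp: is_root_def)
    have "B = insert b B'" using b(1) by (auto simp: B'_def)
    then have vB: "v ` B = insert (ivec x) (label_set l)" using vB' x(2) by simp
    have injv: "inj v" using weyl_inj[OF vW order_refl] .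
    have vs: "simple_set r (v ` B)" using simple_set_weyl[OF r8 vW B] .
    have nin: "ivec x \<notin> label_set l"
      unfolding vB'[symmetric] x(2)[symmetric] using injv by (auto simp: B'_def inj_def)
    define bs where "bs = map coords l"
    have bs: "ivec ` set (x # bs) = v ` B" unfolding vB by (simp add: bs_def label_set_def)
    have dist: "distinct (x # bs)"
      using ok n nin by (auto simp: node_ok_def bs_def label_set_def)
    have len: "\<forall>b\<in>set (x # bs). length b = 9" using lx by (auto simp: bs_def)
    have "card (label_set l) = card B'"
      unfolding vB'[symmetric] using injv by (intro card_image) (auto intro: inj_on_subset)
    then have ll: "length l = card B'" using labels_simple_set(2)[OF r w(2)] by simp
    have "length l < r" using ll cardB simple_set_card_le[OF r8 B] by simp
    have "x \<in> set (required (rts r) bs (map coords (chamber n)))"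
      unfolding set_required
    proof (intro CollectI conjI ballI)
      fix y assume y: "y \<in> set bs"
      then have yl: "ivec y \<in> label_set l" by (auto simp: bs_def label_set_def)
      then have "ip (ivec x) (ivec y) \<ge> 0"
        using vs nin unfolding vB simple_set_def obtuse_def by (metis insertCI)
      then show "0 \<le> ipl x y" using lx len y by (simp add: ip_ivec)
    next
      fix y assume y: "y \<in> set (map coords (chamber n))"
      then have "ivec y \<in> A" by (auto simp: A_def label_set_def)
      then have "ip (ivec x) (ivec y) \<ge> 0" using u(3) x(2) by (auto simp: v_def)
      moreover have "length y = 9" using y by auto
      ultimately show "0 \<le> ipl x y" using lx by (simp add: ip_ivec)
    next
      have "walks (v ` B) 3 (v c) = walks B 3 c" if "c \<in> B" for c
        using injv weyl_ip[OF vW order_refl] that by (intro walks_isometry) (auto intro: inj_on_subset)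
      then have "\<forall>y\<in>v ` B. walks (v ` B) 3 (v b) \<le> walks (v ` B) 3 y" using b by auto
      then show "hd_minimal (walk_list (gram (x # bs)) 3)"
        unfolding hd_minimal_iff[OF dist len] bs x(2) .
    qed (rule x(1))
    moreover have "extensions_ok r (labels r) bs (required (rts r) bs (map coords (chamber n))) (extensions n)"
      using ok \<open>length l < r\<close> n by (simp add: node_ok_def bs_def)
    ultimately obtain e where e: "extension_ok r (labels r) bs x e" using extensions_ok_mem by blast
    show ?thesis
    proof (cases e)
      case (Dependent k cs)
      then have k: "k \<noteq> 0" "length cs = length bs" "map ((*) k) x = combination cs bs" using e by auto
      have "of_int k *\<^sub>R ivec x \<in> span (ivec ` set bs)"
        using combination_span[of bs cs] len k by (simp add: ivec_scale[OF lx, symmetric])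
      then have "of_int k *\<^sub>R ivec x \<in> span (label_set l)" by (simp only: bs_def label_set_def)
      then have "(1 / of_int k) *\<^sub>R (of_int k *\<^sub>R ivec x) \<in> span (label_set l)" by (rule span_scale)
      then have "ivec x \<in> span (label_set l)" using k(1) by simp
      moreover have "independent (insert (ivec x) (label_set l))" using vs vB by (simp add: simple_set_def)
      ultimately show ?thesis using nin by (simp add: independent_insert)
    next
      case (Conjugate j ws)
      then have j: "valid_word r ws" "j < length (labels r)" "length (labels r ! j) = Suc (length bs)"
        "set (reflect_word (map coords ws) (x # bs)) \<subseteq> set (map coords (labels r ! j))"
        using e by (auto simp: contained_iff)
      define l' where "l' = labels r ! j"
      have l': "l' \<in> set (labels r)" using j(2) by (simp add: l'_def)
      obtain w' where w': "w' \<in> W r"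
        "ivec ` set (reflect_word (map coords ws) (x # bs)) = w' ` ivec ` set (x # bs)"
        using valid_wordE[OF r8 j(1) len] .
      have W: "w' \<circ> v \<in> W r" using w'(1) vW by (rule weyl_comp)
      have eq: "(w' \<circ> v) ` B = ivec ` set (reflect_word (map coords ws) (x # bs))"
        unfolding w'(2) bs by (simp add: image_comp)
      have "ivec ` set (reflect_word (map coords ws) (x # bs)) \<subseteq> label_set l'"
        using j(4) unfolding l'_def label_set_def by (rule image_mono)
      then have "(w' \<circ> v) ` B \<subseteq> label_set l'" unfolding eq .
      moreover have "card ((w' \<circ> v) ` B) = card B" using card_image_weyl[OF r8 W] .
      moreover have "card (label_set l') = card B"
        using labels_simple_set(2)[OF r l'] j(3) ll cardB by (simp add: l'_def bs_def)
      moreover have "finite (label_set l')" by (simp add: label_set_def)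
      ultimately have "(w' \<circ> v) ` B = label_set l'" using card_subset_eq by metis
      then show ?thesis using W l' by blast
    qed
  qed
qed

section \<open>The invariants separate the classes\<close>

text \<open>
  The relation by which the algorithm compares subsystems, on bases.
\<close>

definition same_invariants :: "nat \<Rightarrow> vec9 set \<Rightarrow> vec9 set \<Rightarrow> bool" where
  "same_invariants r B B' \<longleftrightarrow> gram_iso B B' \<and> card (C_of (Rt r) B) = card (C_of (Rt r) B') \<and>
     card (K_of (Rt r) B) = card (K_of (Rt r) B')"

lemma same_invariants_refl: "same_invariants r B B"
  by (simp add: same_invariants_def gram_iso_refl)

lemma same_invariants_sym: "same_invariants r B B' \<Longrightarrow> same_invariants r B' B"
  by (simp add: same_invariants_def gram_iso_sym)

lemma same_invariants_trans:
  "same_invariants r B B' \<Longrightarrow> same_invariants r B' B'' \<Longrightarrow> same_invariants r B B''"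
  unfolding same_invariants_def using gram_iso_trans by metis

lemma same_invariants_weyl:
  assumes "r \<le> 8" "w \<in> W r"
  shows "same_invariants r B (w ` B)"
  unfolding same_invariants_def C_of_weyl[OF assms] K_of_weyl[OF assms] card_image_weyl[OF assms]
  using weyl_inj[OF assms(2) order_refl] weyl_ip[OF assms(2) order_refl]
  by (auto intro!: gram_iso_image intro: inj_on_subset)

lemma card_C_of_list:
  assumes "r \<le> 8" "\<forall>b\<in>set B. length b = 9"
  shows "card (C_of (Rt r) (ivec ` set B)) = length (fold orth_with B (rts r))"
proof -
  have len: "length x = 9" if "x \<in> set (rts r)" for x using that set_rts[OF assms(1)] by (auto simp: is_root_def)
  have "C_of (Rt r) (ivec ` set B) = ivec ` set (fold orth_with B (rts r))"
    using assms len unfolding C_of_def fold_orth_with(1) Rt_eq[OF assms(1)] by (auto simp: ip_ivec)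
  moreover have "inj_on ivec (set (fold orth_with B (rts r)))"
    using len by (intro inj_on_ivec) (auto simp: fold_orth_with(1))
  ultimately show ?thesis
    using fold_orth_with(2)[OF distinct_rts] by (simp add: card_image distinct_card)
qed

lemma pairwise_orthogonalD:
  assumes "pairwise_orthogonal N" "\<forall>x\<in>set N. length x = 9" "x \<in> set N" "y \<in> set N" "x \<noteq> y"
  shows "ipl x y = 0"
  using assms
proof (induction N)
  case (Cons z N)
  then consider "x = z" "y \<in> set N" | "y = z" "x \<in> set N" | "x \<in> set N" "y \<in> set N" by auto
  then show ?case
  proof cases
    case 2
    then have "ipl z x = 0" using Cons.prems by (simp add: list_all_iff)
    then show ?thesis using 2 Cons.prems ipl_commute[of x z] by simp
  qed (use Cons in \<open>auto simp: list_all_iff\<close>)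
qed simp

lemma pairwise_orthogonal_distinct:
  "pairwise_orthogonal N \<Longrightarrow> \<forall>x\<in>set N. ipl x x \<noteq> 0 \<Longrightarrow> distinct N"
  by (induction N) (auto simp: list_all_iff)

lemma card_K_of_label:
  assumes r: "r \<in> {2..8}" and l: "l \<in> set (labels r)" and K: "K_count r (rts r) l \<noteq> 0"
  shows "card (K_of (Rt r) (label_set l)) = K_count r (rts r) l"
proof -
  have r8: "r \<le> 8" using r by auto
  obtain N where N: "complement_ok r (map coords l) N" "K_count r (rts r) l = length (fold orth_with N (rts r))"
    using K by (auto simp: K_count_def split: option.splits if_splits)
  have len: "\<forall>x\<in>set N. length x = 9" using N(1) by (auto simp: complement_ok_def list_all_iff)
  have norm: "\<forall>x\<in>set N. ipl x x \<noteq> 0" using N(1) by (auto simp: complement_ok_def list_all_iff)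
  have orth: "pairwise_orthogonal N" using N(1) by (simp add: complement_ok_def)
  have simple: "simple_set r (label_set l)" "card (label_set l) = length l"
    using labels_simple_set[OF r l] by auto
  have "card (ivec ` set N) = card (set N)" using inj_on_ivec[OF len] by (rule card_image)
  also have "\<dots> = length N" using pairwise_orthogonal_distinct[OF orth norm] by (rule distinct_card)
  finally have cN: "card (ivec ` set N) = length N" .
  have "K_of (Rt r) (label_set l) = {x \<in> Rt r. \<forall>n\<in>ivec ` set N. ip x n = 0}"
  proof (rule K_of_eq_orthogonal[OF r8])
    show "ivec ` set N \<subseteq> Lambda r"
      using N(1) r8 by (auto simp: Lambda_eq complement_ok_def list_all_iff tail_zero_iff)
    show "ip m n = 0" if mn: "m \<in> ivec ` set N" "n \<in> ivec ` set N" "m \<noteq> n" for m n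
    proof -
      obtain x y where xy: "x \<in> set N" "y \<in> set N" "m = ivec x" "n = ivec y" using mn by blast
      then have "ipl x y = 0" using pairwise_orthogonalD[OF orth len xy(1,2)] mn(3) by auto
      then show ?thesis using xy len by (simp add: ip_ivec)
    qed
    show "ip n n \<noteq> 0" if n: "n \<in> ivec ` set N" for n
      using n norm len by (auto simp: ip_ivec)
    show "ip n (canon r) = 0" if n: "n \<in> ivec ` set N" for n
      using n N(1) r8 by (auto simp: complement_ok_def list_all_iff canon_eq_ivec ip_ivec)
    show "ip b n = 0" if bn: "b \<in> label_set l" "n \<in> ivec ` set N" for b n
      using bn N(1) len by (auto simp: label_set_def complement_ok_def orthogonal_lists_def list_all_iff ip_ivec)
    show "card (label_set l) + card (ivec ` set N) = r"
      using simple cN N(1) by (simp add: complement_ok_def)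
  qed (use simple in \<open>auto simp: simple_set_def\<close>)
  also have "\<dots> = C_of (Rt r) (ivec ` set N)" by (simp add: C_of_def)
  finally show ?thesis using card_C_of_list[OF r8 len] N(2) by simp
qed

lemma all_invariants_eq: "all_invariants r R ls = map (invariants r R) ls"
  by (induction ls) auto

lemma separatedD:
  assumes "separated (map f ls)" "l \<in> set ls" "l' \<in> set ls" "l \<noteq> l'"
    "fst (f l) = fst (f l')" "fst (snd (f l)) = fst (snd (f l'))"
  shows "snd (snd (f l)) \<noteq> 0 \<and> snd (snd (f l')) \<noteq> 0 \<and> snd (snd (f l)) \<noteq> snd (snd (f l'))"
  using assms
proof (induction ls)
  case (Cons a ls)
  then consider "l = a" "l' \<in> set ls" | "l' = a" "l \<in> set ls" | "l \<in> set ls" "l' \<in> set ls" by auto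
  then show ?case by cases (use Cons in \<open>auto simp: list_all_iff\<close>)
qed simp

lemma same_invariants_labels:
  assumes r: "r \<in> {2..8}" and l: "l \<in> set (labels r)" and l': "l' \<in> set (labels r)"
    and same: "same_invariants r (label_set l) (label_set l')"
  shows "l = l'"
proof (rule ccontr)
  assume ne: "l \<noteq> l'"
  have r8: "r \<le> 8" using r by auto
  have sep: "separated (map (invariants r (rts r)) (labels r))"
    using table_checked(2)[OF r] by (simp add: table_separated_def all_invariants_eq)
  have walk: "real_of_int (sum_list (walk_list (gram (map coords a)) k)) = walk_sum (label_set a) k"
    if "a \<in> set (labels r)" for a k
  proof -
    have "distinct (map coords a)"
      using table_checked(1)[OF r] that by (auto simp: table_ok_def list_all_iff node_ok_def labels_def)
    then show ?thesis unfolding label_set_def by (intro walk_list_sum) auto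
  qed
  have "real_of_int (sum_list (walk_list (gram (map coords l)) k)) =
      real_of_int (sum_list (walk_list (gram (map coords l')) k))" for k
    unfolding walk[OF l] walk[OF l'] using same gram_iso_walk_sum by (auto simp: same_invariants_def)
  then have 1: "fst (invariants r (rts r) l) = fst (invariants r (rts r) l')"
    by (simp add: invariants_def)
  have C: "card (C_of (Rt r) (label_set a)) = fst (snd (invariants r (rts r) a))" for a
    using card_C_of_list[OF r8, of "map coords a"] by (simp add: label_set_def invariants_def)
  have 2: "fst (snd (invariants r (rts r) l)) = fst (snd (invariants r (rts r) l'))"
    using same unfolding C[symmetric] by (simp add: same_invariants_def)
  have "K_count r (rts r) l \<noteq> 0" "K_count r (rts r) l' \<noteq> 0" "K_count r (rts r) l \<noteq> K_count r (rts r) l'"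
    using separatedD[OF sep l l' ne 1 2] by (auto simp: invariants_def)
  then show False
    using card_K_of_label[OF r l] card_K_of_label[OF r l'] same by (simp add: same_invariants_def)
qed

theorem same_invariants_imp_conjugate:
  assumes r: "r \<in> {2..8}" and "simple_set r B" "simple_set r B'" "same_invariants r B B'"
  shows "\<exists>w\<in>W r. w ` B = B'"
proof -
  have r8: "r \<le> 8" using r by auto
  obtain w l where w: "w \<in> W r" "l \<in> set (labels r)" "w ` B = label_set l"
    using classification[OF r assms(2)] by blast
  obtain w' l' where w': "w' \<in> W r" "l' \<in> set (labels r)" "w' ` B' = label_set l'"
    using classification[OF r assms(3)] by blast
  have "same_invariants r (label_set l) B"
    using same_invariants_weyl[OF r8 w(1), of B] w(3) same_invariants_sym by metis
  moreover have "same_invariants r B' (label_set l')"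
    using same_invariants_weyl[OF r8 w'(1), of B'] w'(3) by simp
  ultimately have "same_invariants r (label_set l) (label_set l')"
    using assms(4) same_invariants_trans by blast
  then have "l = l'" using same_invariants_labels[OF r w(2) w'(2)] by blast
  obtain u where u: "u \<in> W r" "\<And>x. u (w' x) = x"
    using weyl_inverse[OF w'(1) order_refl] by blast
  have "(u \<circ> w) ` B = u ` w' ` B'" by (simp only: image_comp[symmetric] w(3) w'(3) \<open>l = l'\<close>)
  also have "\<dots> = B'" using u(2) by (simp add: image_image)
  finally show ?thesis using weyl_comp[OF u(1) w(1)] by blast
qed

section \<open>Candidates and the relation of the algorithm\<close>

lemma Z_elements:
  assumes "i \<le> 3" "e \<in> Z i"
  shows "wf_symbol (symbol_of e)" "phi e \<in> Rt 8"
proof -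
  have "i = 0 \<or> i = 1 \<or> i = 2 \<or> i = 3" using assms(1) by auto
  then have "e \<in> set (z0_list @ map Pos (z2_list @ z3_list))"
    using assms(2) by (elim disjE) (auto simp: Z_def Z0_def Z1_def Z2_def Z3_def z0_list_def z2_list_def z3_list_def)
  then have e: "valid_symbol (symbol_of e)" "is_root 8 (elem_coords e)"
    using symbols_roots unfolding list_all_iff by blast+
  then show "wf_symbol (symbol_of e)" by (simp add: valid_symbol_iff)
  show "phi e \<in> Rt 8" using e ivec_in_Rt_iff[of 8 "elem_coords e"] by (simp add: ivec_elem_coords)
qed

lemma Rt_8_Lambda:
  assumes "r \<le> 8" "v \<in> Rt 8" "v \<in> Lambda r"
  shows "v \<in> Rt r"
proof -
  obtain xs where xs: "v = ivec xs" "\<forall>i\<le>8. r < i \<longrightarrow> xs ! i = 0" using assms(1,3) Lambda_eq by auto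
  have "ip v (canon 8) = ip v (canon r)"
    unfolding ip_canon[OF assms(1)] ip_canon[OF order_refl] xs(1) using assms(1) xs(2)
    by (auto intro!: sum.mono_neutral_right simp: ivec_nth)
  then show ?thesis using assms by (simp add: Rt_def)
qed

lemma candidatesI:
  assumes "L \<subseteq> Z i" "inj_on phi L" "r \<le> 8" "simple_set r (phi ` L)"
  shows "(L, r) \<in> candidates r i"
proof -
  have "phi l \<in> Lambda r" if "l \<in> L" for l
    using assms(4) that by (auto simp: simple_set_def Rt_def)
  moreover have "ip (phi l) (phi m) \<in> {0, 1}" if "l \<in> L" "m \<in> L" "l \<noteq> m" for l m
    using simple_set_ip[OF assms(3,4), of "phi l" "phi m"] that assms(2) by (auto simp: inj_on_def)
  ultimately show ?thesis
    using assms unfolding candidates_def simple_set_def by blast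
qed

lemma candidatesD:
  assumes "x \<in> candidates r i" "i \<le> 3" "r \<le> 8"
  shows "snd x = r" "fst x \<subseteq> Z i" "inj_on phi (fst x)" "simple_set r (phi ` fst x)" "is_c1_label x"
proof -
  obtain L where L: "x = (L, r)" "L \<subseteq> {l \<in> Z i. phi l \<in> Lambda r}" "inj_on phi L"
    "independent (phi ` L)" "\<forall>l\<in>L. \<forall>m\<in>L. l \<noteq> m \<longrightarrow> ip (phi l) (phi m) \<in> {0, 1}"
    using assms(1) unfolding candidates_def by blast
  then show "snd x = r" "fst x \<subseteq> Z i" "inj_on phi (fst x)" by auto
  have "phi ` L \<subseteq> Rt r" using L(2) Z_elements(2)[OF assms(2)] Rt_8_Lambda[OF assms(3)] by blast
  moreover have "obtuse (phi ` L)" using L(5) unfolding obtuse_def by fastforce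
  ultimately show "simple_set r (phi ` fst x)" using L by (simp add: simple_set_def)
  have "wf_symbol s" if "Pos s \<in> L \<or> Neg s \<in> L" for s
    using that L(2) Z_elements(1)[OF assms(2), of "Pos s"] Z_elements(1)[OF assms(2), of "Neg s"] by auto
  then show "is_c1_label x" using L(1) by (simp add: is_c1_label_def)
qed

lemma finite_candidates: "i \<le> 3 \<Longrightarrow> finite (candidates r i)"
proof -
  assume "i \<le> 3"
  then have "i = 0 \<or> i = 1 \<or> i = 2 \<or> i = 3" by auto
  then have "finite (Z i)" by (elim disjE) (simp_all add: Z_def Z0_def Z1_def Z2_def Z3_def)
  moreover have "candidates r i \<subseteq> (\<lambda>L. (L, r)) ` Pow (Z i)" unfolding candidates_def by blast
  ultimately show ?thesis using finite_subset by blast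
qed

lemma candidates_geometric:
  assumes "x \<in> candidates r i" "i \<in> {1, 2, 3}" "r \<le> 8"
  shows "geometric x"
proof -
  have "fst x \<subseteq> Z i" using assms by (intro candidatesD(2)) auto
  moreover have "Neg s \<notin> Z i" for s using assms(2) by (auto simp: Z_def Z1_def Z2_def Z3_def)
  ultimately show ?thesis by (auto simp: geometric_def)
qed

lemma represents_iff:
  assumes "x \<in> candidates r i" "i \<le> 3" "r \<le> 8"
  shows "represents x S \<longleftrightarrow> S = root_closure (phi ` fst x)"
proof
  assume "represents x S"
  then show "S = root_closure (phi ` fst x)"
    using root_basis_unique[OF assms(3)] candidatesD(1)[OF assms] by (auto simp: represents_def)
next
  assume S: "S = root_closure (phi ` fst x)"
  have simple: "simple_set r (phi ` fst x)" using candidatesD(4)[OF assms] .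
  then have "root_subsystem r S" unfolding S
    by (intro root_subsystem_root_closure[OF assms(3)]) (simp add: simple_set_def)
  then show "represents x S"
    using candidatesD[OF assms] root_basis_root_closure[OF assms(3) simple] S by (simp add: represents_def)
qed

lemma same_invariants_subsystems:
  assumes r: "r \<le> 8" and S: "root_subsystem r S" "root_subsystem r S'"
    and B: "root_basis S B" "root_basis S' B'"
  shows "same_invariants r B B' \<longleftrightarrow> dynkin_iso S S' \<and> card (C_of (Rt r) S) = card (C_of (Rt r) S') \<and>
    card (K_of (Rt r) S) = card (K_of (Rt r) S')"
  unfolding same_invariants_def dynkin_iso_iff_gram_iso[OF r S B]
    C_of_span[OF root_basis_span[OF B(1)]] C_of_span[OF root_basis_span[OF B(2)]]
    K_of_span[OF root_basis_span[OF B(1)]] K_of_span[OF root_basis_span[OF B(2)]] ..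

text \<open>
  The exceptional pair in rank 3 is consistent with the invariants: 6 roots are orthogonal to 1123,
  and 2 are orthogonal to 23.
\<close>

lemma exception_separated:
  assumes "{x, y} = {({Pos (L1 1 2 3)}, 3), ({Pos (L0 2 3)}, 3 :: nat)}"
  shows "\<not> same_invariants 3 (phi ` fst x) (phi ` fst y)"
proof -
  have C: "card (C_of (Rt 3) {phi (Pos s)}) = length (fold orth_with [coords s] (rts 3))"
    if "valid_symbol s" for s
    using card_C_of_list[of 3 "[coords s]"] that by (simp add: ivec_coords)
  have "card (C_of (Rt 3) {phi (Pos (L1 1 2 3))}) = 6" "card (C_of (Rt 3) {phi (Pos (L0 2 3))}) = 2"
    using C[of "L1 1 2 3"] C[of "L0 2 3"] orthogonal_counts_3 by simp_all
  then have "card (C_of (Rt 3) (phi ` fst x)) \<noteq> card (C_of (Rt 3) (phi ` fst y))"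
    using assms by (auto simp: doubleton_eq_iff)
  then show ?thesis by (simp add: same_invariants_def)
qed

text \<open>
  In particular \<open>label_iso\<close> is an equivalence relation on the candidates, so that reductions exist.
\<close>

lemma label_iso_iff:
  assumes "x \<in> candidates r i" "y \<in> candidates r j" "i \<le> 3" "j \<le> 3" "r \<le> 8"
  shows "label_iso x y \<longleftrightarrow> same_invariants r (phi ` fst x) (phi ` fst y)"
proof -
  note x = candidatesD[OF assms(1,3,5)] and y = candidatesD[OF assms(2,4,5)]
  define S S' where "S = root_closure (phi ` fst x)" and "S' = root_closure (phi ` fst y)"
  have rep: "represents x T \<longleftrightarrow> T = S" "represents y T \<longleftrightarrow> T = S'" for T
    using represents_iff assms by (auto simp: S_def S'_def)
  have sub: "root_subsystem r S" "root_basis S (phi ` fst x)" "root_subsystem r S'" "root_basis S' (phi ` fst y)"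
    using rep[of S] rep[of S'] x(1) y(1) by (auto simp: represents_def)
  have "{x, y} \<noteq> {({Pos (L1 1 2 3)}, 3), ({Pos (L0 2 3)}, 3)}"
    if same: "same_invariants r (phi ` fst x) (phi ` fst y)"
  proof
    assume *: "{x, y} = {({Pos (L1 1 2 3)}, 3), ({Pos (L0 2 3)}, 3)}"
    then have "r = 3" using x(1) by (auto simp: doubleton_eq_iff)
    then show False using exception_separated[OF *] same by simp
  qed
  then show ?thesis
    unfolding label_iso_def rep same_invariants_subsystems[OF assms(5) sub(1,3,2,4)] x(1) y(1) by auto
qed

lemma represents_conjugate_imp_label_iso:
  assumes "x \<in> candidates r i" "y \<in> candidates r j" "i \<le> 3" "j \<le> 3" "r \<le> 8"
    and "represents x S" "represents y S'" "subsystem_iso r S S'"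
  shows "label_iso x y"
proof -
  note x = candidatesD[OF assms(1,3,5)] and y = candidatesD[OF assms(2,4,5)]
  obtain w where w: "w \<in> W r" "w ` S = S'" using assms(8) by (auto simp: subsystem_iso_def)
  have S: "root_subsystem r S" "root_basis S (phi ` fst x)" "root_subsystem r S'" "root_basis S' (phi ` fst y)"
    using assms(6,7) x(1) y(1) by (auto simp: represents_def)
  have ws: "simple_set r (w ` phi ` fst x)" by (rule simple_set_weyl[OF assms(5) w(1) x(4)])
  have "w ` root_closure (phi ` fst x) = root_closure (w ` phi ` fst x)"
    by (rule weyl_root_closure[OF w(1) order_refl])
  then have "S' = root_closure (w ` phi ` fst x)"
    using w(2) root_basis_unique[OF assms(5) S(1,2)] by simp
  then have "root_basis S' (w ` phi ` fst x)" using root_basis_root_closure[OF assms(5) ws] by simp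
  then have "same_invariants r (w ` phi ` fst x) (phi ` fst y)"
    using same_invariants_subsystems[OF assms(5) S(3,3) _ S(4)]
      same_invariants_subsystems[OF assms(5) S(3,3) S(4,4)] same_invariants_refl by blast
  then have "same_invariants r (phi ` fst x) (phi ` fst y)"
    using same_invariants_weyl[OF assms(5) w(1)] same_invariants_trans by blast
  then show ?thesis using label_iso_iff[OF assms(1-5)] by simp
qed

lemma exists_reduction:
  assumes refl: "\<And>x. x \<in> Y \<Longrightarrow> label_iso x x"
    and sym: "\<And>x y. x \<in> Y \<Longrightarrow> y \<in> Y \<Longrightarrow> label_iso x y \<Longrightarrow> label_iso y x"
    and trans: "\<And>x y z. x \<in> Y \<Longrightarrow> y \<in> Y \<Longrightarrow> z \<in> Y \<Longrightarrow> label_iso x y \<Longrightarrow> label_iso y z \<Longrightarrow> label_iso x z"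
  shows "\<exists>Y'. is_reduction Y Y'"
proof -
  define f where "f x = (SOME y. y \<in> Y \<and> label_iso x y)" for x
  have f: "f x \<in> Y" "label_iso x (f x)" if "x \<in> Y" for x
    using someI_ex[of "\<lambda>y. y \<in> Y \<and> label_iso x y"] refl[OF that] that unfolding f_def by blast+
  have feq: "f x = f y" if "x \<in> Y" "y \<in> Y" "label_iso x y" for x y
  proof -
    have "y' \<in> Y \<and> label_iso x y' \<longleftrightarrow> y' \<in> Y \<and> label_iso y y'" for y'
      using that sym trans by meson
    then show ?thesis by (simp add: f_def)
  qed
  have "is_reduction Y (f ` Y)" unfolding is_reduction_def
  proof (intro conjI ballI)
    show "f ` Y \<subseteq> Y" using f by auto
    fix x assume x: "x \<in> Y"
    show "\<exists>!y. y \<in> f ` Y \<and> label_iso x y"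
    proof (rule ex1I[of _ "f x"])
      show "f x \<in> f ` Y \<and> label_iso x (f x)" using f x by simp
      fix y assume y: "y \<in> f ` Y \<and> label_iso x y"
      then obtain z where z: "z \<in> Y" "y = f z" by auto
      have "label_iso x z" using trans[OF x f(1)[OF z(1)] z(1)] y z sym[OF z(1) f(1)[OF z(1)] f(2)[OF z(1)]] by simp
      then show "y = f x" using feq[OF x z(1)] z(2) by simp
    qed
  qed
  then show ?thesis by blast
qed

lemma candidates_reduction:
  assumes "i \<le> 3" "r \<le> 8"
  shows "\<exists>Y'. is_reduction (candidates r i) Y'"
proof (rule exists_reduction)
  show "label_iso x x" if "x \<in> candidates r i" for x
    using label_iso_iff[OF that that assms(1,1,2)] same_invariants_refl by simp
  show "label_iso y x" if "x \<in> candidates r i" "y \<in> candidates r i" "label_iso x y" for x y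
    using label_iso_iff[OF that(1,2) assms(1,1,2)] label_iso_iff[OF that(2,1) assms(1,1,2)]
      that(3) same_invariants_sym by simp
  show "label_iso x z" if "x \<in> candidates r i" "y \<in> candidates r i" "z \<in> candidates r i"
    "label_iso x y" "label_iso y z" for x y z
    using label_iso_iff[OF that(1,2) assms(1,1,2)] label_iso_iff[OF that(2,3) assms(1,1,2)]
      label_iso_iff[OF that(1,3) assms(1,1,2)] that(4,5) same_invariants_trans by blast
qed

subsection \<open>Labels of the table among the candidates\<close>

lemma phi_labels:
  assumes "r \<in> {2..8}" "l \<in> set (labels r)"
  shows "phi ` Pos ` set l = label_set l" "inj_on phi (Pos ` set l)"
proof -
  obtain n where n: "n \<in> set (nodes r)" "l = node_label n" using assms(2) by (auto simp: labels_def)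
  have ok: "root_symbols r l" "distinct (map coords l)"
    using table_checked(1)[OF assms(1)] n by (auto simp: table_ok_def list_all_iff node_ok_def)
  have phi: "phi (Pos s) = ivec (coords s)" if "s \<in> set l" for s
    using root_symbolsD(3)[OF ok(1)] that assms(1) by (simp add: ivec_coords)
  then show "phi ` Pos ` set l = label_set l" by (auto simp: label_set_def image_image)
  have "inj_on coords (set l)" using ok(2) by (simp add: distinct_map)
  then show "inj_on phi (Pos ` set l)" using phi by (auto simp: inj_on_def ivec_inject)
qed

lemma label_candidate:
  assumes "r \<in> {2..8}" "l \<in> set (labels r)"
  shows "\<exists>i\<in>{2, 3}. (Pos ` set l, r) \<in> candidates r i"
proof -
  obtain n where n: "n \<in> set (nodes r)" "l = node_label n" using assms(2) by (auto simp: labels_def)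
  have "contained l z2_list \<or> contained l z3_list"
    using table_checked(1)[OF assms(1)] n by (auto simp: table_ok_def list_all_iff node_ok_def)
  moreover have "Z 2 = Pos ` set z2_list" "Z 3 = Pos ` set z3_list"
    by (simp_all add: Z_def Z2_def Z3_def z2_list_def z3_list_def)
  ultimately have "Pos ` set l \<subseteq> Z 2 \<or> Pos ` set l \<subseteq> Z 3" by (auto simp: contained_iff)
  then show ?thesis
    using phi_labels[OF assms] labels_simple_set(1)[OF assms] assms(1) candidatesI[of "Pos ` set l" _ r] by auto
qed

lemma Z0_list: "Z 0 = set z0_list"
  by (auto simp: Z_def Z0_def z0_list_def)

lemma original_candidate:
  assumes r: "r \<in> {2..8}" and l: "l \<in> set (labels r)"
  shows "\<exists>L. (L, r) \<in> candidates r 0 \<and> (\<exists>w\<in>W r. w ` phi ` L = label_set l)"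
proof -
  have r8: "r \<le> 8" using r by auto
  obtain n where n: "n \<in> set (nodes r)" "l = node_label n" using l by (auto simp: labels_def)
  have ok: "original_ok r l (original n)"
    using table_checked(1)[OF r] n by (auto simp: table_ok_def list_all_iff node_ok_def)
  show ?thesis
  proof (cases "original n")
    case None
    then have "Pos ` set l \<subseteq> Z 0" using ok by (auto simp: contained_iff Z0_list)
    then have "(Pos ` set l, r) \<in> candidates r 0"
      using phi_labels[OF r l] labels_simple_set(1)[OF r l] r8 by (intro candidatesI) auto
    moreover have "id ` phi ` Pos ` set l = label_set l" using phi_labels[OF r l] by simp
    ultimately show ?thesis using weyl_id by blast
  next
    case (Some p)
    obtain es ws where p: "original n = Some (es, ws)" using Some by (cases p) auto
    have es: "set es \<subseteq> Z 0" "valid_word r ws" "length es = length l" "distinct (map elem_coords es)"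
      "set (reflect_word (map coords ws) (map elem_coords es)) \<subseteq> set (map coords l)"
      using ok by (auto simp: p contained_iff Z0_list)
    have phi: "phi e = ivec (elem_coords e)" if "e \<in> set es" for e
      using that es(1) Z_elements(1)[of 0 e] by (subst ivec_elem_coords) (auto simp: valid_symbol_iff)
    have im: "phi ` set es = ivec ` set (map elem_coords es)" using phi by (auto simp: image_image)
    have inj: "inj_on phi (set es)"
      using es(4) phi by (auto simp: distinct_map inj_on_def ivec_inject)
    obtain w where w: "w \<in> W r"
      "ivec ` set (reflect_word (map coords ws) (map elem_coords es)) = w ` ivec ` set (map elem_coords es)"
      by (rule valid_wordE[OF r8 es(2), of "map elem_coords es"]) auto
    have "w ` phi ` set es \<subseteq> label_set l"
      unfolding im w(2)[symmetric] label_set_def using es(5) by (rule image_mono)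
    moreover have "card (w ` phi ` set es) = card (label_set l)"
    proof -
      have "card (w ` phi ` set es) = card (set es)"
        using card_image_weyl[OF r8 w(1)] card_image[OF inj] by simp
      also have "\<dots> = length es" using es(4) by (simp add: distinct_map distinct_card)
      finally show ?thesis using es(3) labels_simple_set(2)[OF r l] by simp
    qed
    ultimately have eq: "w ` phi ` set es = label_set l"
      by (intro card_subset_eq) (auto simp: label_set_def)
    obtain u where u: "u \<in> W r" "\<And>x. u (w x) = x"
      using weyl_inverse[OF w(1) order_refl] by blast
    have "u ` label_set l = phi ` set es" unfolding eq[symmetric] using u(2) by (simp add: image_image)
    then have "simple_set r (phi ` set es)"
      using simple_set_weyl[OF r8 u(1) labels_simple_set(1)[OF r l]] by simp
    then have "(set es, r) \<in> candidates r 0" using es(1) inj r8 by (intro candidatesI) auto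
    then show ?thesis using w(1) eq by blast
  qed
qed

text \<open>
  This makes the output geometric: the classes of \<open>Y 0\<close> all occur in \<open>Y 2\<close> or \<open>Y 3\<close>, so no
  representative is taken from \<open>Y 0\<close>.
\<close>

lemma candidate_occurs:
  assumes r: "r \<in> {2..8}" and x: "x \<in> candidates r 0"
  shows "\<exists>i\<in>{2, 3}. \<exists>y\<in>candidates r i. label_iso x y"
proof -
  have r8: "r \<le> 8" using r by auto
  have simple: "simple_set r (phi ` fst x)" using candidatesD(4)[OF x _ r8] by simp
  obtain w l where w: "w \<in> W r" "l \<in> set (labels r)" "w ` phi ` fst x = label_set l"
    using classification[OF r simple] by blast
  obtain i where i: "i \<in> {2, 3}" "(Pos ` set l, r) \<in> candidates r i" using label_candidate[OF r w(2)] by blast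
  have "same_invariants r (phi ` fst x) (phi ` Pos ` set l)"
    using same_invariants_weyl[OF r8 w(1), of "phi ` fst x"] w(3) phi_labels(1)[OF r w(2)] by simp
  then have "label_iso x (Pos ` set l, r)"
    using label_iso_iff[OF x i(2) _ _ r8] i(1) by auto
  then show ?thesis using i by blast
qed

section \<open>Correctness of the algorithm\<close>

lemma algorithm_has_output: "\<exists>Out. algorithm_output Out"
proof -
  have "\<forall>r i. \<exists>Y'. i \<le> 3 \<and> r \<le> 8 \<longrightarrow> is_reduction (candidates r i) Y'"
    using candidates_reduction by blast
  then obtain Y where Y: "\<And>r i. i \<le> 3 \<Longrightarrow> r \<le> 8 \<Longrightarrow> is_reduction (candidates r i) (Y r i)"
    by metis
  have ex: "\<exists>y. y \<in> Y r (source (Y r) x) \<and> label_iso x y" if r: "r \<in> {2..8}" and x: "x \<in> Y r 0" for r x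
  proof -
    have "x \<in> candidates r 0" using Y[of 0 r] r x by (auto simp: is_reduction_def)
    then have "label_iso x x" using label_iso_iff[of x r 0 x 0] r same_invariants_refl by auto
    then show ?thesis using x unfolding source_def occurs_in_def by (simp only: split: if_split) blast
  qed
  define c where "c x = (SOME y. y \<in> Y (snd x) (source (Y (snd x)) x) \<and> label_iso x y)" for x
  have "c x \<in> Y r (source (Y r) x) \<and> label_iso x (c x)" if r: "r \<in> {2..8}" and x: "x \<in> Y r 0" for r x
  proof -
    have "x \<in> candidates r 0" using Y[of 0 r] r x by (auto simp: is_reduction_def)
    then have "snd x = r" using candidatesD(1)[of x r 0] r by auto
    then show ?thesis using someI_ex[OF ex[OF r x]] by (simp add: c_def)
  qed
  then have "algorithm_output (\<Union>r\<in>{2..8}. c ` Y r 0)"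
    unfolding algorithm_output_def using Y by (intro exI[of _ Y] exI[of _ c]) auto
  then show ?thesis by blast
qed

context
  fixes Y :: "nat \<Rightarrow> nat \<Rightarrow> c1_label set" and c :: "c1_label \<Rightarrow> c1_label" and Out
  assumes Y: "\<forall>r\<in>{2..8}. \<forall>i\<in>{0..3}. is_reduction (candidates r i) (Y r i)"
    and c: "\<forall>r\<in>{2..8}. \<forall>x\<in>Y r 0. c x \<in> Y r (source (Y r) x) \<and> label_iso x (c x)"
    and Out: "Out = (\<Union>r\<in>{2..8}. c ` Y r 0)"
begin

lemma reduction_subset: "r \<in> {2..8} \<Longrightarrow> i \<le> 3 \<Longrightarrow> Y r i \<subseteq> candidates r i"
  using Y by (auto simp: is_reduction_def)

lemma reduction_ex1: "r \<in> {2..8} \<Longrightarrow> i \<le> 3 \<Longrightarrow> x \<in> candidates r i \<Longrightarrow> \<exists>!y. y \<in> Y r i \<and> label_iso x y"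
  using Y by (auto simp: is_reduction_def)

lemma source_geometric:
  assumes r: "r \<in> {2..8}" and x: "x \<in> Y r 0"
  shows "source (Y r) x \<in> {1, 2, 3}"
proof -
  have r8: "r \<le> 8" using r by auto
  have x0: "x \<in> candidates r 0" using reduction_subset[OF r, of 0] x by auto
  obtain i y where y: "i \<in> {2, 3}" "y \<in> candidates r i" "label_iso x y" using candidate_occurs[OF r x0] by blast
  have i3: "i \<le> 3" using y(1) by auto
  obtain z where z: "z \<in> Y r i" "label_iso y z" using reduction_ex1[OF r i3 y(2)] by blast
  have z': "z \<in> candidates r i" using reduction_subset[OF r i3] z(1) by auto
  have "label_iso x z"
    using label_iso_iff[OF x0 y(2) _ i3 r8] label_iso_iff[OF y(2) z' i3 i3 r8] label_iso_iff[OF x0 z' _ i3 r8]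
      y(3) z(2) same_invariants_trans by auto
  then have "occurs_in x (Y r i)" using z(1) by (auto simp: occurs_in_def)
  then show ?thesis using y(1) by (auto simp: source_def)
qed

lemma output_candidate:
  assumes r: "r \<in> {2..8}" and x: "x \<in> Y r 0"
  shows "\<exists>i\<in>{1, 2, 3}. c x \<in> candidates r i"
proof -
  have "c x \<in> Y r (source (Y r) x)" using c r x by blast
  moreover have "source (Y r) x \<in> {1, 2, 3}" using source_geometric[OF r x] .
  moreover have "Y r (source (Y r) x) \<subseteq> candidates r (source (Y r) x)"
    using source_geometric[OF r x] by (intro reduction_subset[OF r]) auto
  ultimately show ?thesis by blast
qed

lemma OutE:
  assumes "(L, r) \<in> Out"
  obtains x i where "r \<in> {2..8}" "x \<in> Y r 0" "c x = (L, r)" "i \<in> {1, 2, 3}" "(L, r) \<in> candidates r i"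
proof -
  obtain r' x where x: "r' \<in> {2..8}" "x \<in> Y r' 0" "c x = (L, r)" using assms Out by auto
  obtain i where i: "i \<in> {1, 2, 3}" "c x \<in> candidates r' i" using output_candidate[OF x(1,2)] by blast
  then have "r' = r" using candidatesD(1)[OF i(2)] x by auto
  then show thesis using that x i by simp
qed

lemma finite_Out: "finite Out"
proof -
  have "finite (Y r 0)" if "r \<in> {2..8}" for r
    using reduction_subset[OF that, of 0] finite_candidates[of 0 r] finite_subset by blast
  then show ?thesis unfolding Out by blast
qed

lemma Out_labels:
  assumes "(L, r) \<in> Out"
  shows "is_c1_label (L, r) \<and> geometric (L, r) \<and> r \<in> {2..8} \<and> (\<exists>S. represents (L, r) S)"
proof -
  obtain x i where x: "r \<in> {2..8}" "i \<in> {1, 2, 3}" "(L, r) \<in> candidates r i" using assms by (rule OutE)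
  have i: "i \<le> 3" "r \<le> 8" using x by auto
  show ?thesis
    using candidatesD(5)[OF x(3) i] candidates_geometric[OF x(3,2) i(2)] represents_iff[OF x(3) i] x(1) by blast
qed

text \<open>
  Existence: the class of \<open>S\<close> has a label over \<open>Z 0\<close>, which is related to some \<open>x\<close> in \<open>Y 0\<close> and to its
  representative \<open>c x\<close>; equal invariants then give a Weyl element.  Uniqueness: labels \<open>c x\<close> and
  \<open>c y\<close> of conjugate subsystems are related, hence so are \<open>x\<close> and \<open>y\<close>, which a reduction
  identifies.
\<close>

lemma Out_ex1:
  assumes r: "r \<in> {2..8}" and S: "root_subsystem r S"
  shows "\<exists>!L. (L, r) \<in> Out \<and> (\<exists>S'. represents (L, r) S' \<and> subsystem_iso r S S')"
proof (rule ex_ex1I)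
  have r8: "r \<le> 8" using r by auto
  obtain B where B: "root_basis S B" using root_basis_exists[OF r8 S] by blast
  have simple: "simple_set r B" using root_basis_simple_set[OF r8 S B] .
  obtain w l where w: "w \<in> W r" "l \<in> set (labels r)" "w ` B = label_set l"
    using classification[OF r simple] by blast
  obtain L0 w0 where L0: "(L0, r) \<in> candidates r 0" "w0 \<in> W r" "w0 ` phi ` L0 = label_set l"
    using original_candidate[OF r w(2)] by blast
  obtain x where x: "x \<in> Y r 0" "label_iso (L0, r) x" using reduction_ex1[OF r _ L0(1)] by auto
  have x0: "x \<in> candidates r 0" using reduction_subset[OF r, of 0] x by auto
  obtain i where i: "i \<in> {1, 2, 3}" "c x \<in> candidates r i" using output_candidate[OF r x(1)] by blast
  have i3: "i \<le> 3" using i by auto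
  have "label_iso x (c x)" using c r x(1) by blast
  then have "same_invariants r (phi ` L0) (phi ` fst (c x))"
    using label_iso_iff[OF x0 i(2) _ i3 r8] label_iso_iff[OF L0(1) x0 _ _ r8] x(2) same_invariants_trans by auto
  moreover have "same_invariants r B (label_set l)" "same_invariants r (label_set l) (phi ` L0)"
    using same_invariants_weyl[OF r8 w(1), of B] same_invariants_weyl[OF r8 L0(2), of "phi ` L0"]
      w(3) L0(3) same_invariants_sym by auto
  ultimately have "same_invariants r B (phi ` fst (c x))" using same_invariants_trans by blast
  then obtain v where v: "v \<in> W r" "v ` B = phi ` fst (c x)"
    using same_invariants_imp_conjugate[OF r simple candidatesD(4)[OF i(2) i3 r8]] by blast
  have "v ` S = root_closure (phi ` fst (c x))"
    using root_basis_unique[OF r8 S B] weyl_root_closure[OF v(1) order_refl, of B] v(2) by simp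
  then have "represents (c x) (v ` S)" using represents_iff[OF i(2) i3 r8] by simp
  moreover have "subsystem_iso r S (v ` S)" using v(1) by (auto simp: subsystem_iso_def)
  moreover have "c x = (fst (c x), r)" using candidatesD(1)[OF i(2) i3 r8] by (metis prod.collapse)
  moreover have "c x \<in> Out" using Out r x(1) by blast
  ultimately show "\<exists>L. (L, r) \<in> Out \<and> (\<exists>S'. represents (L, r) S' \<and> subsystem_iso r S S')" by metis
next
  have r8: "r \<le> 8" using r by auto
  fix L L'
  assume "(L, r) \<in> Out \<and> (\<exists>S'. represents (L, r) S' \<and> subsystem_iso r S S')"
    and "(L', r) \<in> Out \<and> (\<exists>S'. represents (L', r) S' \<and> subsystem_iso r S S')"
  then obtain S1 S2 where L: "(L, r) \<in> Out" "represents (L, r) S1" "subsystem_iso r S S1"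
    and L': "(L', r) \<in> Out" "represents (L', r) S2" "subsystem_iso r S S2" by blast
  obtain x i where x: "x \<in> Y r 0" "c x = (L, r)" "i \<in> {1, 2, 3}" "(L, r) \<in> candidates r i"
    using L(1) by (rule OutE)
  obtain y j where y: "y \<in> Y r 0" "c y = (L', r)" "j \<in> {1, 2, 3}" "(L', r) \<in> candidates r j"
    using L'(1) by (rule OutE)
  have ij: "i \<le> 3" "j \<le> 3" using x y by auto
  have "subsystem_iso r S1 S2"
  proof -
    obtain w w' where w: "w \<in> W r" "w ` S = S1" "w' \<in> W r" "w' ` S = S2"
      using L(3) L'(3) by (auto simp: subsystem_iso_def)
    obtain u where u: "u \<in> W r" "\<And>z. u (w z) = z" using weyl_inverse[OF w(1) order_refl] by blast
    have "(w' \<circ> u) ` S1 = S2" using w(2,4) u(2) by (auto simp: image_image)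
    then show ?thesis using weyl_comp[OF w(3) u(1)] unfolding subsystem_iso_def by (rule bexI)
  qed
  then have "label_iso (c x) (c y)"
    using represents_conjugate_imp_label_iso[OF x(4) y(4) ij r8 L(2) L'(2)] x(2) y(2) by simp
  moreover have "label_iso x (c x)" "label_iso y (c y)" using c r x(1) y(1) by blast+
  moreover have xy: "x \<in> candidates r 0" "y \<in> candidates r 0" using reduction_subset[OF r, of 0] x y by auto
  ultimately have "same_invariants r (phi ` fst x) (phi ` fst (c x))"
    "same_invariants r (phi ` fst (c x)) (phi ` fst (c y))" "same_invariants r (phi ` fst y) (phi ` fst (c y))"
    using label_iso_iff[of x r 0 "c x" i] label_iso_iff[of y r 0 "c y" j] label_iso_iff[of "c x" r i "c y" j]
      ij r8 x y by auto
  then have "same_invariants r (phi ` fst x) (phi ` fst y)"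
    using same_invariants_trans same_invariants_sym by blast
  then have "label_iso x y" "label_iso x x"
    using label_iso_iff[OF xy(1,2) _ _ r8] label_iso_iff[OF xy(1,1) _ _ r8] same_invariants_refl by auto
  then have "x = y" using reduction_ex1[OF r _ xy(1)] x(1) y(1) by blast
  then show "L = L'" using x(2) y(2) by simp
qed

end

theorem proposition6:
  shows "(\<exists>Out. algorithm_output Out) \<and>
    (\<forall>Out. algorithm_output Out \<longrightarrow>
       finite Out \<and>
       (\<forall>(L, r)\<in>Out. is_c1_label (L, r) \<and> geometric (L, r) \<and> r \<in> {2..8} \<and>
          (\<exists>S. represents (L, r) S)) \<and>
       (\<forall>r\<in>{2..8}. \<forall>S. root_subsystem r S \<longrightarrow>
          (\<exists>!L. (L, r) \<in> Out \<and> (\<exists>S'. represents (L, r) S' \<and> subsystem_iso r S S'))))"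
proof (intro conjI allI impI)
  show "\<exists>Out. algorithm_output Out" by (rule algorithm_has_output)
next
  fix Out assume "algorithm_output Out"
  then obtain Y c where out:
    "\<forall>r\<in>{2..8}. \<forall>i\<in>{0..3}. is_reduction (candidates r i) (Y r i)"
    "\<forall>r\<in>{2..8}. \<forall>x\<in>Y r 0. c x \<in> Y r (source (Y r) x) \<and> label_iso x (c x)"
    "Out = (\<Union>r\<in>{2..8}. c ` Y r 0)"
    unfolding algorithm_output_def by blast
  show "finite Out" using out by (rule finite_Out)
  show "\<forall>(L, r)\<in>Out. is_c1_label (L, r) \<and> geometric (L, r) \<and> r \<in> {2..8} \<and> (\<exists>S. represents (L, r) S)"
    using Out_labels[OF out] by auto
  show "\<forall>r\<in>{2..8}. \<forall>S. root_subsystem r S \<longrightarrow>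
      (\<exists>!L. (L, r) \<in> Out \<and> (\<exists>S'. represents (L, r) S' \<and> subsystem_iso r S S'))"
    using Out_ex1[OF out] by blast
qed

end
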